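(* Assume that we are in the two branches, ramified case: $\mathbf L=\mathbf K_1\times\mathbf K$, where $\mathbf K_1$ is a quadratic field extension of $\mathbf K$, $\mathbf A=\mathbf D_1\times\mathbf D$, the maximal ideal of the discrete valuation ring $\mathbf D_1$ is $\tau\mathbf D_1$, $\mathbf D_1/\tau\mathbf D_1\simeq\mathbf k$ and $t\mathbf D_1=\tau^2\mathbf D_1$. Let $v$ be the normalized valuation of $\mathbf D_1$ (so $v(\tau)=1$), and let $e$ be the idempotent of $\mathbf A$ such that $e\mathbf A=\mathbf D_1$. For $\alpha\in\mathbf D_1$ with $v(\alpha)=1$ put $$\mathbf C_{l,q}(\alpha)=\mathbf D+t^l(e+t^q\alpha)\mathbf D+t^{r}\mathbf A,\ \text{ where } r=2l+q\quad(l,q\ge0),$$ $$\mathbf C_r(\alpha)=\mathbf D+t^r\alpha\mathbf D+t^{2r+1}\mathbf A\quad(r\ge0).$$ Then: (1) every over-ring of $\mathbf A_m$ coincides with either $t^k\mathbf C_{l,q}(\alpha)+\mathbf D$ or $t^k\mathbf C_r(\alpha)+\mathbf D$, where $k+r\le m$ (with $r=2l+q$ for the first family); (2) the rings $\mathbf C_{l,q}(\alpha)$ and $\mathbf C_r(\alpha)$ are just all plane curve singularities in this case (i.e. among the cubic rings over $\mathbf D$ in $\mathbf L$).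
   Context: $\mathbf D$ is a complete discrete valuation ring with field of fractions $\mathbf K$, maximal ideal $t\mathbf D$ and residue field $\mathbf k=\mathbf D/t\mathbf D$. $\mathbf L$ is a $3$-dimensional (commutative) semisimple $\mathbf K$-algebra. A cubic ring over $\mathbf D$ (in $\mathbf L$) is a $\mathbf D$-subalgebra of $\mathbf L$ that is a free $\mathbf D$-module of rank $3$. $\mathbf A$ is the integral closure of $\mathbf D$ in $\mathbf L$; it is assumed to be a finitely generated $\mathbf D$-module. For $m\ge0$, $\mathbf A_m=t^m\mathbf A+\mathbf D$. An over-ring of a cubic ring $\mathbf C$ is a cubic ring $\mathbf B$ with $\mathbf C\subseteq\mathbf B\subset\mathbf L$. $\mathbf D$ is embedded diagonally in $\mathbf A=\mathbf D_1\times\mathbf D$, and $\mathbf D_1$ is identified with $e\mathbf A=\mathbf D_1\times 0$. The embedding dimension of a local noetherian ring $\mathbf C$ with maximal ideal $\mathbf J$ is $\dim_{\mathbf C/\mathbf J}\mathbf J/\mathbf J^2$; a local noetherian ring of Krull dimension $1$ and embedding dimension $2$ is called a plane curve singularity.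
   Formalization: In part (2) the family C_{l,q}(α) is taken with l ≥ 1 only: for l = 0 the ring C_{0,q}(α) contains the nontrivial idempotent e = (e + t^qα) − t^qα, so it is not local and is not a plane curve singularity. *)

theory Defs
  imports
    "HOL-Algebra.Algebra"
    "HOL-Library.Extended_Nat"
    "Jordan_Normal_Form.Missing_VectorSpace"
begin

text \<open>Subrings and subfields are subsets of an ambient ring \<open>R\<close>; such a subset \<open>C\<close>, regarded as a
  ring in its own right, is the record \<open>R\<lparr>carrier := C\<rparr>\<close>.\<close>

section \<open>Local rings\<close>

definition local_ring :: "('a, 'm) ring_scheme \<Rightarrow> bool" where
  "local_ring R \<longleftrightarrow> cring R \<and> (\<exists>!J. maximalideal J R)"

definition max_ideal :: "('a, 'm) ring_scheme \<Rightarrow> 'a set" where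
  "max_ideal R = (THE J. maximalideal J R)"

primrec ideal_power :: "('a, 'm) ring_scheme \<Rightarrow> 'a set \<Rightarrow> nat \<Rightarrow> 'a set" where
  "ideal_power R J 0 = carrier R"
| "ideal_power R J (Suc n) = ideal_prod R (ideal_power R J n) J"

text \<open>The canonical map from \<open>R\<close> to the inverse limit of the rings \<open>R / J\<^sup>n\<close> is injective (first
  conjunct) and surjective (second conjunct), where \<open>J\<close> is the maximal ideal of \<open>R\<close>. The sequence
  \<open>x\<close> consists of representatives of a compatible family of residue classes.\<close>

definition complete_local_ring :: "('a, 'm) ring_scheme \<Rightarrow> bool" where
  "complete_local_ring R \<longleftrightarrow> local_ring R \<and>
     (\<Inter>n. ideal_power R (max_ideal R) n) = {\<zero>\<^bsub>R\<^esub>} \<and>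
     (\<forall>x :: nat \<Rightarrow> 'a.
        (\<forall>n. x n \<in> carrier R \<and> x (Suc n) \<ominus>\<^bsub>R\<^esub> x n \<in> ideal_power R (max_ideal R) n) \<longrightarrow>
        (\<exists>y \<in> carrier R. \<forall>n. y \<ominus>\<^bsub>R\<^esub> x n \<in> ideal_power R (max_ideal R) n))"

definition discrete_valuation_ring :: "('a, 'm) ring_scheme \<Rightarrow> bool" where
  "discrete_valuation_ring R \<longleftrightarrow> principal_domain R \<and> local_ring R \<and> \<not> field R"

text \<open>The normalized valuation of a discrete valuation ring, on elements of the ring:
  the largest \<open>n\<close> such that \<open>x\<close> lies in the \<open>n\<close>-th power of the maximal ideal, and \<open>\<infinity>\<close> for
  \<open>x = \<zero>\<close>.\<close>

definition normalized_valuation :: "('a, 'm) ring_scheme \<Rightarrow> 'a \<Rightarrow> enat" where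
  "normalized_valuation R x = (SUP n \<in> {n. x \<in> ideal_power R (max_ideal R) n}. enat n)"

section \<open>Plane curve singularities\<close>

definition krull_dim :: "('a, 'm) ring_scheme \<Rightarrow> enat" where
  "krull_dim R = Sup {enat n | n. \<exists>P :: nat \<Rightarrow> 'a set.
     (\<forall>i \<le> n. primeideal (P i) R) \<and> (\<forall>i < n. P i \<subset> P (Suc i))}"

text \<open>\<open>J / J\<^sup>2\<close> as a module over \<open>R / J\<close>; its elements are the cosets of \<open>J\<^sup>2\<close> that are contained in
  \<open>J\<close>, and the class of \<open>a\<close> times the class of \<open>x\<close> is the class of \<open>a \<otimes> x\<close>. The multiplicative
  fields of the record, required by its type, play no role.\<close>

definition cotangent_space :: "('a, 'm) ring_scheme \<Rightarrow> 'a set \<Rightarrow> ('a set, 'a set) module" where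
  "cotangent_space R J =
     \<lparr> partial_object.carrier = {ideal_prod R J J +>\<^bsub>R\<^esub> x | x. x \<in> J},
       monoid.mult = rcoset_mult R (ideal_prod R J J),
       monoid.one = undefined,
       ring.zero = ideal_prod R J J,
       ring.add = set_add R,
       module.smult = rcoset_mult R (ideal_prod R J J) \<rparr>"

definition embedding_dim :: "('a, 'm) ring_scheme \<Rightarrow> nat" where
  "embedding_dim R =
     vectorspace.dim (R Quot (max_ideal R)) (cotangent_space R (max_ideal R))"

definition plane_curve_singularity :: "('a, 'm) ring_scheme \<Rightarrow> bool" where
  "plane_curve_singularity R \<longleftrightarrow>
     local_ring R \<and> noetherian_ring R \<and> krull_dim R = 1 \<and> embedding_dim R = 2"

section \<open>Subrings and submodules of an algebra\<close>

definition fraction_field_of :: "('a, 'm) ring_scheme \<Rightarrow> 'a set \<Rightarrow> 'a set" where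
  "fraction_field_of F D = {a \<otimes>\<^bsub>F\<^esub> inv\<^bsub>F\<^esub> b | a b. a \<in> D \<and> b \<in> D \<and> b \<noteq> \<zero>\<^bsub>F\<^esub>}"

definition integral_closure :: "('a, 'm) ring_scheme \<Rightarrow> 'a set \<Rightarrow> 'a set" where
  "integral_closure R D = {x \<in> carrier R. \<exists>p. polynomial\<^bsub>R\<^esub> D p \<and> p \<noteq> [] \<and>
     lead_coeff p = \<one>\<^bsub>R\<^esub> \<and> ring.eval R p x = \<zero>\<^bsub>R\<^esub>}"

definition finitely_generated_over :: "('a, 'm) ring_scheme \<Rightarrow> 'a set \<Rightarrow> 'a set \<Rightarrow> bool" where
  "finitely_generated_over R D M \<longleftrightarrow> (\<exists>us. set us \<subseteq> carrier R \<and> M = ring.Span R D us)"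

text \<open>Every element of \<open>M\<close> is a \<open>D\<close>-linear combination of the list \<open>us\<close> in exactly one way. (The
  library predicate \<open>ring.independent\<close> is not used because it expresses linear independence only over
  a field.)\<close>

definition free_of_rank :: "('a, 'm) ring_scheme \<Rightarrow> 'a set \<Rightarrow> nat \<Rightarrow> 'a set \<Rightarrow> bool" where
  "free_of_rank R D n M \<longleftrightarrow> (\<exists>us. length us = n \<and> set us \<subseteq> carrier R \<and>
     bij_betw (\<lambda>ds. ring.combine R ds us) {ds. length ds = n \<and> set ds \<subseteq> D} M)"

definition cubic_ring :: "('a, 'm) ring_scheme \<Rightarrow> 'a set \<Rightarrow> 'a set \<Rightarrow> bool" where
  "cubic_ring L D C \<longleftrightarrow> subring C L \<and> D \<subseteq> C \<and> free_of_rank L D 3 C"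

definition over_ring :: "('a, 'm) ring_scheme \<Rightarrow> 'a set \<Rightarrow> 'a set \<Rightarrow> 'a set \<Rightarrow> bool" where
  "over_ring L D C B \<longleftrightarrow> cubic_ring L D B \<and> C \<subseteq> B"

section \<open>The rings of the classification\<close>

text \<open>Here \<open>D\<close>, \<open>t\<close> and \<open>a\<close> lie in \<open>L\<close>: they are the images in \<open>L\<close> of the base ring, its
  uniformizer and the element \<open>\<alpha>\<close>. The ring \<open>scaled_ring L D t m A\<close> is
  \<open>A\<^sub>m = t\<^sup>m A + D\<close>. For \<open>l = 0\<close> the ring \<open>ring_C_lq\<close> contains \<open>(e + t\<^sup>q a) - t\<^sup>q a = e\<close>, a
  nontrivial idempotent, and hence is not local.\<close>

definition scaled_ring :: "('a, 'm) ring_scheme \<Rightarrow> 'a set \<Rightarrow> 'a \<Rightarrow> nat \<Rightarrow> 'a set \<Rightarrow> 'a set" where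
  "scaled_ring L D t k C = ((t [^]\<^bsub>L\<^esub> k) <#\<^bsub>L\<^esub> C) <+>\<^bsub>L\<^esub> D"

definition ring_C_lq ::
    "('a, 'm) ring_scheme \<Rightarrow> 'a set \<Rightarrow> 'a set \<Rightarrow> 'a \<Rightarrow> 'a \<Rightarrow> nat \<Rightarrow> nat \<Rightarrow> 'a \<Rightarrow> 'a set" where
  "ring_C_lq L D A t e l q a =
     (D <+>\<^bsub>L\<^esub> ((t [^]\<^bsub>L\<^esub> l \<otimes>\<^bsub>L\<^esub> (e \<oplus>\<^bsub>L\<^esub> t [^]\<^bsub>L\<^esub> q \<otimes>\<^bsub>L\<^esub> a)) <#\<^bsub>L\<^esub> D))
       <+>\<^bsub>L\<^esub> ((t [^]\<^bsub>L\<^esub> (2 * l + q)) <#\<^bsub>L\<^esub> A)"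

definition ring_C_r ::
    "('a, 'm) ring_scheme \<Rightarrow> 'a set \<Rightarrow> 'a set \<Rightarrow> 'a \<Rightarrow> nat \<Rightarrow> 'a \<Rightarrow> 'a set" where
  "ring_C_r L D A t r a =
     (D <+>\<^bsub>L\<^esub> ((t [^]\<^bsub>L\<^esub> r \<otimes>\<^bsub>L\<^esub> a) <#\<^bsub>L\<^esub> D)) <+>\<^bsub>L\<^esub> ((t [^]\<^bsub>L\<^esub> (2 * r + 1)) <#\<^bsub>L\<^esub> A)"

end

theory Submission
  imports Defs
begin

text \<open>A cubic ring \<open>C\<close> lies in \<open>A = D\<^sub>1 \<times> D\<close>: powers of its elements have bounded denominators. As \<open>C\<close>
  contains the diagonal, it is \<open>D + M\<close> with \<open>M = C \<inter> e A\<close>, a \<open>D\<close>-submodule of \<open>D\<^sub>1\<close> closed under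
  multiplication and containing some \<open>\<tau>\<^sup>N D\<^sub>1\<close>. Nonzero elements of \<open>D\<close> have even valuation in \<open>D\<^sub>1\<close>, and two
  elements of consecutive valuations \<open>n\<close>, \<open>n + 1\<close> form a \<open>D\<close>-basis of \<open>\<tau>\<^sup>n D\<^sub>1\<close>. Hence, if \<open>x \<in> M\<close> has minimal
  valuation \<open>n\<close> and \<open>n'\<close> is the least valuation of the other parity in \<open>M\<close>, then \<open>M = D x + \<tau>\<^bsup>n'\<^esup> D\<^sub>1\<close>. The
  parity of \<open>n\<close> separates the two families, and \<open>x\<^sup>2 \<in> M\<close> is exactly the bound on \<open>n'\<close> that makes \<open>k \<ge> 0\<close>.

  If \<open>M = t\<^sup>k M'\<close> with \<open>k \<ge> 1\<close>, the maximal ideal \<open>J = t D + M\<close> satisfies \<open>J\<^sup>2 \<subseteq> t J\<close>, so the embedding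
  dimension is \<open>3\<close>. If \<open>k = 0\<close>, then \<open>M = D x + D x\<^sup>2\<close>, so \<open>J\<close> is generated by \<open>t\<close> and \<open>x\<close>, unless \<open>x\<close> is a
  unit; in that case \<open>e \<in> C\<close> and \<open>C\<close> is not local.\<close>

text \<open>Denominators are bounded because \<open>C\<close> has finitely many generators over D,
  while an element of negative valuation would have powers exceeding every bound. That
  \<open>M\<close> contains some \<tau>^N D1 is where rank 3 enters: if all nonzero elements of
  \<open>M\<close> had valuations of one parity, subtracting multiples of \<open>x\<close> would
  leave no remainder, \<open>M\<close> would be \<open>D x\<close>, and \<open>C\<close> would have
  rank at most 2.

  The parameters come from the two valuations. If n = 2i and n' = 2j + 1, then \<open>x\<close> can
  be taken as t^i (1 + t^q \<alpha>), and the equations k + l = i and k + 2l + q = j determine k and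
  l. Only the class of \<open>x\<close> modulo \<tau>^(2j) matters, so q can be cut off at j - i,
  which gives l >= 0. The element x^2 - t^i x of \<open>M\<close> has the odd valuation 2(2i + q) +
  1, so j <= 2i + q, which is k >= 0. If n = 2i + 1 and n' = 2j, then r = j - i - 1, k = 2i + 1 - j,
  and the even valuation 4i + 2 of x^2 gives the bound.

  Valuations do not occur as functions in the arguments: an element is placed in a set
  \<open>S n\<close>. The degree of K1 over K enters as the linear dependence over D of any three
  elements.\<close>

lemma (in field) inv_closed_nz:
  assumes "x \<in> carrier R" "x \<noteq> \<zero>"
  shows "inv x \<in> carrier R" "inv x \<noteq> \<zero>" "x \<otimes> inv x = \<one>" "inv x \<otimes> x = \<one>" "inv (inv x) = x"
proof -
  have u: "x \<in> Units R" using assms by (simp add: field_Units)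
  then show "inv x \<in> carrier R" "x \<otimes> inv x = \<one>" "inv x \<otimes> x = \<one>" "inv (inv x) = x" by auto
  from Units_inv_Units[OF u] show "inv x \<noteq> \<zero>" by (simp add: field_Units)
qed

lemma (in field) inv_mult_nz:
  assumes "x \<in> carrier R" "x \<noteq> \<zero>" "y \<in> carrier R" "y \<noteq> \<zero>"
  shows "inv (x \<otimes> y) = inv x \<otimes> inv y"
proof -
  note x = inv_closed_nz[OF assms(1,2)] and y = inv_closed_nz[OF assms(3,4)]
  have "(x \<otimes> y) \<otimes> (inv x \<otimes> inv y) = (x \<otimes> inv x) \<otimes> (y \<otimes> inv y)"
    using assms x y by (simp add: m_ac)
  also have "\<dots> = \<one>" using x y by simp
  finally show ?thesis using assms x y
    by (intro comm_inv_char) auto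
qed

lemma (in domain) nat_pow_nonzero:
  "x \<in> carrier R \<Longrightarrow> x \<noteq> \<zero> \<Longrightarrow> x [^] (n::nat) \<noteq> \<zero>"
  by (induction n) (auto simp: integral_iff)

lemma (in ring) add_minus_cancel:
  assumes "x \<in> carrier R" "y \<in> carrier R"
  shows "x \<oplus> (y \<ominus> x) = y" "(y \<ominus> x) \<oplus> x = y"
  using assms by algebra+


text \<open>Closure under negation is absorption applied to - 1, so the additive subgroup condition
  reduces to sums and multiples.\<close>

lemma (in cring) idealI_closed:
  assumes "I \<subseteq> carrier R" "\<zero> \<in> I"
    and "\<And>x y. x \<in> I \<Longrightarrow> y \<in> I \<Longrightarrow> x \<oplus> y \<in> I"
    and "\<And>a x. a \<in> carrier R \<Longrightarrow> x \<in> I \<Longrightarrow> a \<otimes> x \<in> I"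
  shows "ideal I R"
proof (rule idealI[OF ring_axioms])
  have "\<ominus> x \<in> I" if "x \<in> I" for x
  proof -
    have "(\<ominus> \<one>) \<otimes> x \<in> I" using that by (intro assms(4)) auto
    then show ?thesis using that assms(1) by (auto simp: l_minus)
  qed
  then show "subgroup I (add_monoid R)"
    using assms(1-3) by (intro group.subgroupI[OF add.is_group]) (auto simp: a_inv_def)
qed (use assms m_comm in \<open>auto, metis subsetD\<close>)

text \<open>An ideal that is not inside \<open>J\<close> contains a unit and is therefore
  everything; so \<open>J\<close> contains every proper ideal.\<close>

lemma (in cring) unique_maximalideal:
  assumes J: "ideal J R" "carrier R \<noteq> J" and units: "\<And>x. x \<in> carrier R \<Longrightarrow> x \<notin> J \<Longrightarrow> x \<in> Units R"
  shows "maximalideal I R \<longleftrightarrow> I = J"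
proof -
  have sub: "I \<subseteq> J" if "ideal I R" "carrier R \<noteq> I" for I
  proof
    fix x assume x: "x \<in> I"
    interpret I: ideal I R by fact
    show "x \<in> J"
    proof (rule ccontr)
      assume "x \<notin> J"
      then have "x \<in> Units R" using x units I.Icarr by auto
      then have "\<one> \<in> I" using I.I_l_closed[OF x, of "inv x"] by auto
      then show False using that I.one_imp_carrier by auto
    qed
  qed
  have Jc: "J \<subseteq> carrier R" using J(1) by (meson ideal.Icarr subsetI)
  show ?thesis
  proof
    assume I: "maximalideal I R"
    interpret I: maximalideal I R by fact
    have "I \<subseteq> J" using sub I.is_ideal I.I_notcarr by auto
    then show "I = J" using I.I_maximal[OF J(1)] Jc J(2) by auto
  next
    assume "I = J"
    then show "maximalideal I R" using J sub by (auto intro!: maximalidealI)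
  qed
qed

section \<open>Discrete valuation rings in a field\<close>

text \<open>A discrete valuation ring is described inside an ambient field by a uniformizer and the
  factorization into a power of it and a unit. The field \<open>R\<close> may be larger than the
  fraction field of \<open>V\<close>: both D, with uniformizer t, and D1, with uniformizer \<tau>,
  are placed in the same field K1, so that their elements can be multiplied without
  embeddings.\<close>

locale valuation_subring = field R for R (structure) +
  fixes V :: "'a set" and \<pi> :: 'a
  assumes subring: "subring V R"
    and pi: "\<pi> \<in> V" "\<pi> \<noteq> \<zero>" "inv \<pi> \<notin> V"
    and factor: "x \<in> V \<Longrightarrow> x \<noteq> \<zero> \<Longrightarrow> \<exists>n u. u \<in> V \<and> u \<noteq> \<zero> \<and> inv u \<in> V \<and> x = \<pi> [^] (n::nat) \<otimes> u"
begin

text \<open>With v the valuation of \<open>V\<close>, \<open>P n\<close> is v >= n and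
  \<open>S n\<close> is v = n. Membership in \<open>S n\<close> replaces an equation for v, and zero
  lies in no \<open>S n\<close>, so no value infinity has to be handled.\<close>

definition U where "U = {u \<in> V. u \<noteq> \<zero> \<and> inv u \<in> V}"
definition P where "P n = {\<pi> [^] (n::nat) \<otimes> x | x. x \<in> V}"
definition S where "S n = {\<pi> [^] (n::nat) \<otimes> u | u. u \<in> U}"

lemma V_carrier: "x \<in> V \<Longrightarrow> x \<in> carrier R" using subringE(1)[OF subring] by auto
lemma V_zero: "\<zero> \<in> V" by (rule subringE(2)[OF subring])
lemma V_one: "\<one> \<in> V" by (rule subringE(3)[OF subring])
lemma V_neg: "x \<in> V \<Longrightarrow> \<ominus> x \<in> V" by (rule subringE(5)[OF subring])
lemma V_mult: "x \<in> V \<Longrightarrow> y \<in> V \<Longrightarrow> x \<otimes> y \<in> V" by (rule subringE(6)[OF subring])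
lemma V_add: "x \<in> V \<Longrightarrow> y \<in> V \<Longrightarrow> x \<oplus> y \<in> V" by (rule subringE(7)[OF subring])
lemma V_minus: "x \<in> V \<Longrightarrow> y \<in> V \<Longrightarrow> x \<ominus> y \<in> V" by (simp add: minus_eq V_neg V_add)
lemma V_pow: "x \<in> V \<Longrightarrow> x [^] (n::nat) \<in> V" by (induction n) (auto simp: V_one V_mult)

lemmas V_closed = V_carrier V_zero V_one V_neg V_mult V_add V_minus V_pow

lemma pi_carrier: "\<pi> \<in> carrier R" using pi V_carrier by auto
lemma pi_pow_carrier: "\<pi> [^] (n::nat) \<in> carrier R" using pi_carrier by simp
lemma pi_pow_nz: "\<pi> [^] (n::nat) \<noteq> \<zero>" using nat_pow_nonzero pi_carrier pi by simp
lemma pi_pow_V: "\<pi> [^] (n::nat) \<in> V" using V_pow pi by simp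

lemma U_V: "u \<in> U \<Longrightarrow> u \<in> V" and U_nz: "u \<in> U \<Longrightarrow> u \<noteq> \<zero>" and U_inv_V: "u \<in> U \<Longrightarrow> inv u \<in> V"
  by (auto simp: U_def)
lemma U_carrier: "u \<in> U \<Longrightarrow> u \<in> carrier R" using U_V V_carrier by auto
lemma U_one: "\<one> \<in> U" by (simp add: U_def V_one)
lemma U_inv: "u \<in> U \<Longrightarrow> inv u \<in> U"
  using inv_closed_nz[of u] U_carrier by (auto simp: U_def)
lemma U_mult: "u \<in> U \<Longrightarrow> w \<in> U \<Longrightarrow> u \<otimes> w \<in> U"
  using U_carrier[of u] U_carrier[of w]
  by (auto simp: U_def V_mult integral_iff inv_mult_nz)
lemma U_cancel: "u \<in> U \<Longrightarrow> u \<otimes> inv u = \<one>" "u \<in> U \<Longrightarrow> inv u \<otimes> u = \<one>"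
  using inv_closed_nz U_carrier U_nz by auto

lemma P_I: "x \<in> V \<Longrightarrow> \<pi> [^] n \<otimes> x \<in> P n" by (auto simp: P_def)
lemma P_E: "x \<in> P n \<Longrightarrow> (\<And>y. y \<in> V \<Longrightarrow> x = \<pi> [^] n \<otimes> y \<Longrightarrow> Q) \<Longrightarrow> Q" by (auto simp: P_def)
lemma P_V: "x \<in> P n \<Longrightarrow> x \<in> V" by (auto simp: P_def V_mult pi_pow_V)
lemma P_carrier: "x \<in> P n \<Longrightarrow> x \<in> carrier R" using P_V V_carrier by auto
lemma P_0: "P 0 = V" by (auto simp: P_def V_carrier) (metis V_carrier l_one)
lemma P_add: "x \<in> P n \<Longrightarrow> y \<in> P n \<Longrightarrow> x \<oplus> y \<in> P n"
  unfolding P_def using pi_pow_carrier V_carrier V_add by (auto simp: r_distr[symmetric])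
lemma P_neg: "x \<in> P n \<Longrightarrow> \<ominus> x \<in> P n"
  unfolding P_def using pi_pow_carrier V_carrier V_neg by (auto simp: r_minus[symmetric])
lemma P_minus: "x \<in> P n \<Longrightarrow> y \<in> P n \<Longrightarrow> x \<ominus> y \<in> P n"
  by (simp add: minus_eq P_neg P_add)
lemma P_mult: assumes "x \<in> P m" "y \<in> P n" shows "x \<otimes> y \<in> P (m + n)"
proof -
  obtain a b where a: "a \<in> V" "x = \<pi> [^] m \<otimes> a" and b: "b \<in> V" "y = \<pi> [^] n \<otimes> b"
    using assms by (auto elim!: P_E)
  have "x \<otimes> y = \<pi> [^] (m + n) \<otimes> (a \<otimes> b)"
    using a b V_carrier pi_pow_carrier pi_carrier by (simp add: m_ac nat_pow_mult[symmetric])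
  then show ?thesis using a b by (simp add: P_I V_mult)
qed
lemma P_smult: "a \<in> V \<Longrightarrow> x \<in> P n \<Longrightarrow> a \<otimes> x \<in> P n"
  using P_mult[of a 0 x n] by (simp add: P_0)
lemma P_zero: "\<zero> \<in> P n" using P_I[OF V_zero, of n] pi_pow_carrier by simp
lemma pi_pow_P: "\<pi> [^] n \<in> P n" using P_I[OF V_one, of n] pi_pow_carrier by simp
lemma P_mono: assumes "m \<le> n" "x \<in> P n" shows "x \<in> P m"
proof -
  obtain a where a: "a \<in> V" "x = \<pi> [^] n \<otimes> a" using assms by (auto elim!: P_E)
  have "x = \<pi> [^] m \<otimes> (\<pi> [^] (n - m) \<otimes> a)"
    using a assms V_carrier pi_carrier by (simp add: m_assoc[symmetric] nat_pow_mult)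
  then show ?thesis using a by (simp add: P_I V_mult pi_pow_V)
qed

lemma S_I: "u \<in> U \<Longrightarrow> \<pi> [^] n \<otimes> u \<in> S n" by (auto simp: S_def)
lemma S_E: "x \<in> S n \<Longrightarrow> (\<And>y. y \<in> U \<Longrightarrow> x = \<pi> [^] n \<otimes> y \<Longrightarrow> Q) \<Longrightarrow> Q" by (auto simp: S_def)
lemma S_P: "x \<in> S n \<Longrightarrow> x \<in> P n" by (auto simp: S_def P_def U_V)
lemma S_carrier: "x \<in> S n \<Longrightarrow> x \<in> carrier R" using S_P P_carrier by auto
lemma S_V: "x \<in> S n \<Longrightarrow> x \<in> V" using S_P P_V by auto
lemma S_0: "S 0 = U" by (auto simp: S_def U_carrier) (metis U_carrier l_one)
lemma S_nz: "x \<in> S n \<Longrightarrow> x \<noteq> \<zero>"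
  using pi_pow_carrier pi_pow_nz U_carrier U_nz by (auto simp: S_def integral_iff)
lemma S_mult: assumes "x \<in> S m" "y \<in> S n" shows "x \<otimes> y \<in> S (m + n)"
proof -
  obtain a b where a: "a \<in> U" "x = \<pi> [^] m \<otimes> a" and b: "b \<in> U" "y = \<pi> [^] n \<otimes> b"
    using assms by (auto elim!: S_E)
  have "x \<otimes> y = \<pi> [^] (m + n) \<otimes> (a \<otimes> b)"
    using a b U_carrier pi_pow_carrier pi_carrier by (simp add: m_ac nat_pow_mult[symmetric])
  then show ?thesis using a b by (simp add: S_I U_mult)
qed
lemma pi_pow_S: "\<pi> [^] n \<in> S n" using S_I[OF U_one, of n] pi_pow_carrier by simp
lemma S_pow: "x \<in> S m \<Longrightarrow> x [^] (k::nat) \<in> S (k * m)"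
proof (induction k)
  case (Suc k)
  then have "x [^] k \<otimes> x \<in> S (k * m + m)" by (intro S_mult) auto
  then show ?case by (simp add: add.commute)
qed (simp add: S_0 U_one)

lemma S_ex: "x \<in> V \<Longrightarrow> x \<noteq> \<zero> \<Longrightarrow> \<exists>n. x \<in> S n"
  using factor by (fastforce simp: S_def U_def)

lemma S_div: assumes "x \<in> S m" "y \<in> P n" "m \<le> n" shows "\<exists>a \<in> P (n - m). y = a \<otimes> x"
proof -
  obtain u where u: "u \<in> U" "x = \<pi> [^] m \<otimes> u" using assms by (auto elim!: S_E)
  obtain b where b: "b \<in> V" "y = \<pi> [^] n \<otimes> b" using assms by (auto elim!: P_E)
  have "y = (\<pi> [^] (n - m) \<otimes> \<pi> [^] m) \<otimes> b \<otimes> (inv u \<otimes> u)"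
    using b assms u by (simp add: U_cancel nat_pow_mult pi_carrier V_carrier)
  also have "\<dots> = \<pi> [^] (n - m) \<otimes> (inv u \<otimes> b) \<otimes> x"
    using b u U_carrier[of u] U_inv[of u] U_carrier[of "inv u"] V_carrier pi_carrier by (simp add: m_ac)
  finally show ?thesis using b u U_inv_V by (blast intro: P_I V_mult)
qed

lemma pi_no_U: "\<pi> \<otimes> x \<notin> U" if "x \<in> V"
proof
  assume a: "\<pi> \<otimes> x \<in> U"
  have nz: "x \<noteq> \<zero>" using U_nz[OF a] pi_carrier by auto
  have "inv \<pi> = inv (\<pi> \<otimes> x) \<otimes> x"
    using that inv_closed_nz[OF V_carrier[OF that] nz] inv_closed_nz[OF pi_carrier pi(2)] V_carrier nz pi_carrier
    by (simp add: inv_mult_nz pi m_assoc)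
  then show False using pi(3) that U_inv_V[OF a] V_mult by simp
qed

lemma S_P_le: assumes "x \<in> S n" "x \<in> P m" shows "m \<le> n"
proof (rule ccontr)
  assume "\<not> m \<le> n"
  then have "x \<in> P (Suc n)" using assms P_mono[of "Suc n" m] by simp
  then obtain b where b: "b \<in> V" "x = \<pi> [^] Suc n \<otimes> b" by (auto elim!: P_E)
  obtain u where u: "u \<in> U" "x = \<pi> [^] n \<otimes> u" using assms by (auto elim!: S_E)
  have "\<pi> [^] n \<otimes> u = \<pi> [^] n \<otimes> (\<pi> \<otimes> b)"
    using b u pi_carrier V_carrier by (simp add: m_assoc)
  then have "u = \<pi> \<otimes> b" using u b pi_carrier V_carrier U_carrier pi_pow_carrier pi_pow_nz
    by (meson m_closed m_lcancel)
  then show False using pi_no_U b u by simp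
qed

lemma S_unique: "x \<in> S m \<Longrightarrow> x \<in> S n \<Longrightarrow> m = n"
  using S_P_le S_P by (meson le_antisym)

lemma S_iff: "x \<in> S n \<longleftrightarrow> x \<in> P n \<and> x \<notin> P (Suc n)"
proof
  assume "x \<in> S n" then show "x \<in> P n \<and> x \<notin> P (Suc n)" using S_P S_P_le[of x n "Suc n"] by auto
next
  assume a: "x \<in> P n \<and> x \<notin> P (Suc n)"
  then have "x \<in> V" "x \<noteq> \<zero>" using P_V P_zero by auto
  then obtain m where m: "x \<in> S m" using S_ex by auto
  have "n \<le> m" using S_P_le m a by auto
  moreover have "m \<le> n"
  proof (rule ccontr)
    assume "\<not> m \<le> n" then have "x \<in> P (Suc n)" using S_P[OF m] P_mono[of "Suc n" m] by auto
    then show False using a by simp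
  qed
  ultimately show "x \<in> S n" using m by simp
qed

lemma U_iff: "u \<in> U \<longleftrightarrow> u \<in> V \<and> u \<notin> P 1"
  using S_iff[of u 0] by (simp add: S_0 P_0)

lemma S_perturb: assumes "x \<in> S n" "y \<in> P (Suc n)" shows "x \<oplus> y \<in> S n"
proof -
  have c: "x \<in> carrier R" "y \<in> carrier R" using assms S_carrier P_carrier by auto
  have "x \<oplus> y \<in> P n" using assms S_P P_mono[of n "Suc n" y] by (auto intro: P_add)
  moreover have "x \<oplus> y \<notin> P (Suc n)"
  proof
    assume "x \<oplus> y \<in> P (Suc n)"
    then have "(x \<oplus> y) \<ominus> y \<in> P (Suc n)" using assms P_minus by auto
    moreover have "(x \<oplus> y) \<ominus> y = x" using c by algebra
    ultimately show False using assms S_iff by auto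
  qed
  ultimately show ?thesis by (simp add: S_iff)
qed

lemma S_mult_P: assumes "x \<in> S m" "y \<in> V" "x \<otimes> y \<in> P n" "m \<le> n" shows "y \<in> P (n - m)"
proof -
  obtain a where a: "a \<in> P (n - m)" "x \<otimes> y = a \<otimes> x" using S_div assms by blast
  have "x \<otimes> y = x \<otimes> a" using a P_carrier[OF a(1)] S_carrier[OF assms(1)] by (simp add: m_comm)
  then have "y = a" using S_carrier[OF assms(1)] S_nz[OF assms(1)] V_carrier[OF assms(2)] P_carrier[OF a(1)]
    by (simp add: m_lcancel)
  then show ?thesis using a by simp
qed

text \<open>If z had a negative valuation m - n, the element c z^k would have valuation a + k (m -
  n), with a that of c, which is negative for large k. The assumption on
  \<open>\<pi> [^] n \<otimes> z\<close> gives z a valuation in the first place, since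
  \<open>R\<close> may contain elements outside the fraction field of \<open>V\<close>.\<close>

lemma bounded_powers_imp_V:
  assumes z: "z \<in> carrier R" "\<pi> [^] (n::nat) \<otimes> z \<in> V"
    and c: "c \<in> V" "c \<noteq> \<zero>" "\<And>k::nat. c \<otimes> z [^] k \<in> V"
  shows "z \<in> V"
proof (cases "z = \<zero>")
  case False
  have "\<pi> [^] n \<otimes> z \<noteq> \<zero>" using False z pi_pow_nz pi_pow_carrier by (simp add: integral_iff)
  then obtain m where m: "\<pi> [^] n \<otimes> z \<in> S m" using S_ex z by auto
  show ?thesis
  proof (cases "n \<le> m")
    case True
    then obtain a where a: "a \<in> P (m - n)" "\<pi> [^] n \<otimes> z = a \<otimes> \<pi> [^] n"
      using S_div[OF pi_pow_S S_P[OF m]] by blast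
    then have "\<pi> [^] n \<otimes> z = \<pi> [^] n \<otimes> a" using P_carrier pi_pow_carrier by (simp add: m_comm)
    then have "z = a" using z P_carrier[OF a(1)] pi_pow_carrier pi_pow_nz by (simp add: m_lcancel)
    then show ?thesis using a P_V by simp
  next
    case n: False
    obtain a where a: "c \<in> S a" using S_ex c by auto
    \<comment> \<open>The valuation drops by at least 1 with each power, so a + 1 powers outweigh
      the valuation a of c.\<close>
    define k where "k = Suc a"
    have "(c \<otimes> z [^] k) \<otimes> \<pi> [^] (n * k) = c \<otimes> (\<pi> [^] n \<otimes> z) [^] k"
      using z V_carrier[OF c(1)] pi_carrier by (simp add: m_ac nat_pow_distrib nat_pow_pow)
    also have "\<dots> \<in> S (a + k * m)" by (intro S_mult S_pow a m)
    finally have "n * k \<le> a + k * m"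
      using P_smult[OF c(3)[of k] pi_pow_P] S_P_le by blast
    moreover have "(m + 1) * k \<le> n * k" using n by (intro mult_right_mono) auto
    ultimately show ?thesis by (simp add: algebra_simps k_def)
  qed
qed (simp add: V_zero)


section \<open>The valuation subring as a ring: its ideals and its normalized valuation\<close>

abbreviation Q where "Q \<equiv> R\<lparr>carrier := V\<rparr>"

lemma Q_cring: "cring Q"
  using subring_is_domain[OF subring] by (simp add: domain.axioms(1))

lemma Q_ideal_P: "ideal (P n) Q"
  using Q_cring by (rule cring.idealI_closed)
    (auto simp: P_V P_zero P_add P_smult)

lemma Q_Units: "Units Q = U"
proof
  show "Units Q \<subseteq> U"
  proof
    fix x assume "x \<in> Units Q"
    then obtain y where y: "x \<in> V" "y \<in> V" "x \<otimes> y = \<one>" "y \<otimes> x = \<one>" by (auto simp: Units_def)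
    then have nz: "x \<noteq> \<zero>" using V_carrier[of y] by auto
    have "inv x = y" using y V_carrier by (intro comm_inv_char) auto
    then show "x \<in> U" using y nz by (simp add: U_def)
  qed
  show "U \<subseteq> Units Q" using U_cancel U_V U_inv_V unfolding Units_def by fastforce
qed

lemma Q_maximal_iff: "maximalideal J Q \<longleftrightarrow> J = P 1"
proof (rule cring.unique_maximalideal[OF Q_cring Q_ideal_P])
  show "carrier Q \<noteq> P 1" using U_iff[of \<one>] U_one by auto
  show "x \<in> Units Q" if "x \<in> carrier Q" "x \<notin> P 1" for x using that U_iff by (simp add: Q_Units)
qed

lemma Q_max_ideal: "max_ideal Q = P 1"
  unfolding max_ideal_def Q_maximal_iff by simp

lemma Q_ideal_power: "ideal_power Q (P 1) n = P n"
proof (induction n)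
  case 0
  then show ?case by (simp add: P_0)
next
  case (Suc n)
  have "ideal_prod Q (P n) (P 1) = P (Suc n)"
  proof
    show "ideal_prod Q (P n) (P 1) \<subseteq> P (Suc n)"
    proof
      fix x assume "x \<in> ideal_prod Q (P n) (P 1)"
      then show "x \<in> P (Suc n)"
        by (induction rule: ideal_prod.induct) (use P_mult[of _ n _ 1] P_add in auto)
    qed
    show "P (Suc n) \<subseteq> ideal_prod Q (P n) (P 1)"
    proof
      fix x assume "x \<in> P (Suc n)"
      then obtain a where a: "a \<in> V" "x = \<pi> [^] Suc n \<otimes> a" by (auto elim: P_E)
      then have "x = \<pi> [^] n \<otimes>\<^bsub>Q\<^esub> (\<pi> [^] (1::nat) \<otimes> a)"
        using V_carrier pi_carrier by (simp add: m_assoc)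
      then show "x \<in> ideal_prod Q (P n) (P 1)"
        using ideal_prod.prod[OF pi_pow_P[of n] P_I[OF a(1), of 1], of Q] by simp
    qed
  qed
  then show ?case using Suc by simp
qed

text \<open>The supremum is 1 exactly if x lies in \<open>P 1\<close> and not in \<open>P 2\<close>.
  This ties the valuation of the definitions to \<open>S 1\<close>, the form in which \<alpha> is
  used everywhere below.\<close>

lemma normalized_valuation_eq_1: "normalized_valuation Q x = 1 \<longleftrightarrow> x \<in> S 1"
proof -
  let ?N = "{n. x \<in> P n}"
  have v: "normalized_valuation Q x = Sup (enat ` ?N)"
    unfolding normalized_valuation_def by (simp add: Q_max_ideal Q_ideal_power del: One_nat_def)
  show ?thesis
  proof
    assume a: "normalized_valuation Q x = 1"
    have "\<exists>n\<in>?N. n \<noteq> 0"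
    proof (rule ccontr)
      assume "\<not> (\<exists>n\<in>?N. n \<noteq> 0)"
      then have "Sup (enat ` ?N) \<le> 0" by (intro Sup_least) (auto simp: zero_enat_def)
      then show False using a v by simp
    qed
    then obtain n where n: "x \<in> P n" "n \<noteq> 0" by auto
    then have "x \<in> P 1" using P_mono[of 1 n] by auto
    moreover have "x \<notin> P 2"
    proof
      assume "x \<in> P 2"
      then have "enat 2 \<le> Sup (enat ` ?N)" by (intro Sup_upper) auto
      then show False using a v by (simp add: one_enat_def)
    qed
    ultimately show "x \<in> S 1" by (simp add: S_iff numeral_2_eq_2)
  next
    assume a: "x \<in> S 1"
    then have "Sup (enat ` ?N) \<le> 1" using S_P_le[OF a]
      by (intro Sup_least) (auto simp: one_enat_def)
    moreover have "enat 1 \<le> Sup (enat ` ?N)" using S_P[OF a] by (intro Sup_upper) auto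
    ultimately show "normalized_valuation Q x = 1" using v by (simp add: one_enat_def)
  qed
qed

end

section \<open>Principal ideal domains with one maximal ideal as valuation subrings\<close>

text \<open>Each irreducible element of a principal ideal domain generates a maximal ideal. If there
  is only one such ideal, every irreducible is a unit times p, and a factorization into irreducibles
  collapses to a power of p times a unit.\<close>

lemma (in principal_domain) factor_by_unique_maximal:
  assumes unique: "\<exists>!J. maximalideal J R"
    and p: "p \<in> carrier R" "maximalideal (PIdl p) R"
    and x: "x \<in> carrier R" "x \<noteq> \<zero>"
  shows "\<exists>n. \<exists>u \<in> Units R. x = p [^] (n::nat) \<otimes> u"
proof (cases "x \<in> Units R")
  case True
  then show ?thesis using x by (intro exI[of _ 0] bexI[of _ x]) auto
next
  case False
  have foldr: "set fs \<subseteq> carrier (mult_of R) \<Longrightarrow> \<forall>f \<in> set fs. irreducible (mult_of R) f \<Longrightarrow>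
      \<exists>n. \<exists>u \<in> Units R. foldr (\<otimes>) fs \<one> = p [^] (n::nat) \<otimes> u" for fs
  proof (induction fs)
    case Nil
    show ?case by (intro exI[of _ 0] bexI[of _ \<one>]) auto
  next
    case (Cons f fs)
    then obtain n u where u: "u \<in> Units R" "foldr (\<otimes>) fs \<one> = p [^] (n::nat) \<otimes> u" by auto
    have f: "f \<in> carrier R" "ring_irreducible f"
      using Cons.prems ring_irreducibleI'[of f] by auto
    have "PIdl f = PIdl p" using unique irreducible_imp_maximalideal[OF f] p by blast
    then obtain w where w: "w \<in> Units R" "f = w \<otimes> p"
      using associated_iff_same_ideal[OF f(1) p(1)] ring_associated_iff[OF f(1) p(1)] by auto
    have "foldr (\<otimes>) (f # fs) \<one> = p [^] Suc n \<otimes> (w \<otimes> u)"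
      using w u p Units_closed by (simp add: m_ac)
    then show ?case using w u by blast
  qed
  obtain fs where fs: "set fs \<subseteq> carrier (mult_of R)" "wfactors (mult_of R) fs x"
    using factorization_property[of x] x False by auto
  obtain n u where u: "u \<in> Units R" "foldr (\<otimes>) fs \<one> = p [^] (n::nat) \<otimes> u"
    using foldr[OF fs(1)] fs(2) by (auto simp: wfactors_def)
  have c: "p [^] n \<otimes> u \<in> carrier R" using u p by auto
  have "x \<sim>\<^bsub>mult_of R\<^esub> p [^] n \<otimes> u"
    using fs(2) u by (auto simp: wfactors_def associated_def)
  then have "x \<sim> p [^] n \<otimes> u"
    by (auto simp: associated_def)
  then obtain w where w: "w \<in> Units R" "x = w \<otimes> (p [^] n \<otimes> u)"
    using ring_associated_iff[OF x(1) c] by auto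
  then have "x = p [^] n \<otimes> (w \<otimes> u)" using w(1) u p Units_closed by (simp add: m_ac)
  then show ?thesis using w u by blast
qed

text \<open>The exclusion of fields gives p nonzero, because a zero maximal ideal would make the
  ring a field; properness of the ideal of p keeps the inverse of p out of \<open>V\<close>.\<close>

lemma (in field) valuation_subringI:
  assumes V: "subring V R"
    and dvr: "discrete_valuation_ring (R\<lparr>carrier := V\<rparr>)"
    and p: "p \<in> V" "maximalideal (PIdl\<^bsub>R\<lparr>carrier := V\<rparr>\<^esub> p) (R\<lparr>carrier := V\<rparr>)"
  shows "valuation_subring R V p"
proof -
  let ?Q = "R\<lparr>carrier := V\<rparr>"
  have unique: "\<exists>!J. maximalideal J ?Q" and nf: "\<not> field ?Q"
    using dvr by (auto simp: discrete_valuation_ring_def local_ring_def)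
  interpret Q: principal_domain ?Q using dvr by (simp add: discrete_valuation_ring_def)
  have Vc: "V \<subseteq> carrier R" using subringE(1)[OF V] .
  have "p \<noteq> \<zero>"
  proof
    assume "p = \<zero>"
    then have "PIdl\<^bsub>?Q\<^esub> p = {\<zero>\<^bsub>?Q\<^esub>}" using Vc subringE(2)[OF V]
      by (auto simp: cgenideal_def subset_iff intro!: exI[of _ "\<zero>"])
    then show False using p Q.zeromaximalideal_fieldI nf by simp
  qed
  moreover have "inv p \<notin> V"
  proof
    assume i: "inv p \<in> V"
    have "p \<in> Units ?Q"
      using i p(1) inv_closed_nz(3,4)[of p] \<open>p \<noteq> \<zero>\<close> Vc
      by (auto simp: Units_def intro!: bexI[of _ "inv p"])
    then have "carrier ?Q = PIdl\<^bsub>?Q\<^esub> p" using Q.ideal_eq_carrier_iff[of p] p by simp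
    then show False using maximalideal.I_notcarr[OF p(2)] by simp
  qed
  moreover have "\<exists>n u. u \<in> V \<and> u \<noteq> \<zero> \<and> inv u \<in> V \<and> x = p [^] (n::nat) \<otimes> u"
    if x: "x \<in> V" "x \<noteq> \<zero>" for x
  proof -
    obtain n u where u: "u \<in> Units ?Q" "x = p [^]\<^bsub>?Q\<^esub> (n::nat) \<otimes> u"
      using Q.factor_by_unique_maximal[OF unique _ p(2), of x] p(1) x by auto
    obtain w where w: "u \<in> V" "w \<in> V" "u \<otimes> w = \<one>" using u by (auto simp: Units_def)
    have "u \<noteq> \<zero>" using w Vc by auto
    moreover have "inv u = w" using w Vc by (intro comm_inv_char) auto
    ultimately show ?thesis using u w by (auto simp: nat_pow_consistent[symmetric])
  qed
  ultimately show ?thesis using V p(1) field_axioms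
    by (intro valuation_subring.intro valuation_subring_axioms.intro) blast+
qed

section \<open>Embedding dimension and Krull dimension\<close>

lemma (in abelian_monoid) finsum_two:
  assumes "a \<noteq> b" "f a \<in> carrier G" "f b \<in> carrier G"
  shows "(\<Oplus>s\<in>{a, b}. f s) = f a \<oplus> f b"
  using assms by (simp add: finsum_insert)

lemma (in abelian_monoid) finsum_three:
  assumes "a \<noteq> b" "a \<noteq> c" "b \<noteq> c" "f a \<in> carrier G" "f b \<in> carrier G" "f c \<in> carrier G"
  shows "(\<Oplus>s\<in>{a, b, c}. f s) = f a \<oplus> (f b \<oplus> f c)"
  using assms by (simp add: finsum_insert)

locale cotangent = cring R for R (structure) +
  fixes J
  assumes maximal: "maximalideal J R"
begin

abbreviation J2 where "J2 \<equiv> ideal_prod R J J"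
abbreviation M where "M \<equiv> cotangent_space R J"

sublocale J: ideal J R using maximal by (rule maximalideal.axioms)
sublocale J2: ideal J2 R by (rule ideal_prod_is_ideal[OF J.is_ideal J.is_ideal])

lemma J2_J: "x \<in> J2 \<Longrightarrow> x \<in> J"
  using ideal_prod_inter[OF J.is_ideal J.is_ideal] by auto

lemma coset_eq_iff:
  assumes "ideal I R" "x \<in> carrier R" "y \<in> carrier R"
  shows "I +> x = I +> y \<longleftrightarrow> x \<ominus> y \<in> I"
proof -
  interpret I: ideal I R by fact
  interpret I: abelian_subgroup I R by (rule abelian_subgroupI3[OF I.is_additive_subgroup is_abelian_group])
  show ?thesis
  proof
    assume "I +> x = I +> y"
    then have "x \<in> I +> y" using I.a_rcos_self assms by auto
    then obtain h where h: "h \<in> I" "x = h \<oplus> y" by (auto simp: a_r_coset_def r_coset_def)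
    have "h \<oplus> y \<ominus> y = h" using I.Icarr[OF h(1)] assms(3) by algebra
    then show "x \<ominus> y \<in> I" using h by simp
  next
    assume a: "x \<ominus> y \<in> I"
    have "(x \<ominus> y) \<oplus> y = x" using assms by (simp add: add_minus_cancel)
    then have "x \<in> I +> y"
      using a by (auto simp: a_r_coset_def r_coset_def intro!: bexI[of _ "x \<ominus> y"])
    then show "I +> x = I +> y"
      using a_repr_independence[of x I y] I.a_subgroup assms by simp
  qed
qed

definition c where "c x = J2 +> x"
definition q where "q x = J +> x"

lemma c_eq: "x \<in> carrier R \<Longrightarrow> y \<in> carrier R \<Longrightarrow> c x = c y \<longleftrightarrow> x \<ominus> y \<in> J2"
  unfolding c_def by (rule coset_eq_iff[OF J2.is_ideal])
lemma q_eq: "x \<in> carrier R \<Longrightarrow> y \<in> carrier R \<Longrightarrow> q x = q y \<longleftrightarrow> x \<ominus> y \<in> J"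
  unfolding q_def by (rule coset_eq_iff[OF J.is_ideal])

lemma carrier_M: "carrier M = c ` J" by (auto simp: cotangent_space_def c_def)
lemma zero_M: "\<zero>\<^bsub>M\<^esub> = c \<zero>"
  using J2.a_subset by (simp add: cotangent_space_def c_def)
lemma carrier_Q: "carrier (R Quot J) = q ` carrier R"
  by (auto simp: FactRing_simps q_def)
lemma zero_Q: "\<zero>\<^bsub>R Quot J\<^esub> = q \<zero>"
  using J.a_subset by (simp add: FactRing_def q_def)
lemma one_Q: "\<one>\<^bsub>R Quot J\<^esub> = q \<one>" by (simp add: FactRing_def q_def)
lemma add_Q: "x \<in> carrier R \<Longrightarrow> y \<in> carrier R \<Longrightarrow> q x \<oplus>\<^bsub>R Quot J\<^esub> q y = q (x \<oplus> y)"
  by (simp add: FactRing_def q_def J.a_rcos_sum)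
lemma mult_Q: "x \<in> carrier R \<Longrightarrow> y \<in> carrier R \<Longrightarrow> q x \<otimes>\<^bsub>R Quot J\<^esub> q y = q (x \<otimes> y)"
  by (simp add: FactRing_def q_def J.rcoset_mult_add)
lemma add_M: "x \<in> J \<Longrightarrow> y \<in> J \<Longrightarrow> c x \<oplus>\<^bsub>M\<^esub> c y = c (x \<oplus> y)"
  by (simp add: cotangent_space_def c_def J2.a_rcos_sum J.Icarr)

text \<open>\<open>rcoset_mult\<close> is a union of cosets over all products of representatives, so
  every choice must give the same coset. Changing a by j in J and x by i in J^2 changes the product
  by (j + a) i + j x, which lies in J^2.\<close>

lemma smult_M: assumes "a \<in> carrier R" "x \<in> J" shows "q a \<odot>\<^bsub>M\<^esub> c x = c (a \<otimes> x)"
proof -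
  have carr: "x \<in> carrier R" "a \<otimes> x \<in> carrier R" using assms J.Icarr by auto
  have "J2 +> (a' \<otimes> x') = c (a \<otimes> x)" if a': "a' \<in> q a" and x': "x' \<in> c x" for a' x'
  proof -
    obtain j where j: "j \<in> J" "a' = j \<oplus> a" using a' by (auto simp: q_def a_r_coset_def r_coset_def)
    obtain i where i: "i \<in> J2" "x' = i \<oplus> x" using x' by (auto simp: c_def a_r_coset_def r_coset_def)
    have ic: "i \<in> carrier R" "j \<in> carrier R" using i j J2_J J.Icarr by auto
    have "a' \<otimes> x' \<ominus> a \<otimes> x = (j \<oplus> a) \<otimes> i \<oplus> j \<otimes> x"
      unfolding i j using carr ic assms(1) by algebra
    also have "\<dots> \<in> J2" using i j assms carr ic
      by (intro J2.a_closed J2.I_l_closed ideal_prod.prod) auto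
    finally have "c (a' \<otimes> x') = c (a \<otimes> x)" using i j ic carr assms by (subst c_eq) auto
    then show ?thesis by (simp add: c_def)
  qed
  moreover have "a \<in> q a" "x \<in> c x" using J.a_rcos_self J2.a_rcos_self assms carr by (auto simp: q_def c_def)
  ultimately have "rcoset_mult R J2 (q a) (c x) = c (a \<otimes> x)"
    unfolding rcoset_mult_def by blast
  then show ?thesis by (simp add: cotangent_space_def)
qed

lemma vectorspace: "vectorspace (R Quot J) M"
proof -
  interpret Q: field "R Quot J" by (rule maximalideal.quotient_is_field[OF maximal is_cring])
  have ab: "abelian_group M"
  proof (rule abelian_groupI)
    show "\<exists>y\<in>carrier M. y \<oplus>\<^bsub>M\<^esub> x = \<zero>\<^bsub>M\<^esub>" if x: "x \<in> carrier M" for x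
    proof -
      obtain z where z: "z \<in> J" "x = c z" using x by (auto simp: carrier_M)
      then have "c (\<ominus> z) \<oplus>\<^bsub>M\<^esub> x = \<zero>\<^bsub>M\<^esub>"
        using J.Icarr J.a_inv_closed by (simp add: add_M zero_M l_neg)
      then show ?thesis using z J.a_inv_closed by (auto simp: carrier_M)
    qed
  qed (auto simp: carrier_M zero_M add_M J.Icarr a_ac J.a_closed J.zero_closed)
  have "module (R Quot J) M"
    by (rule moduleI[OF Q.is_cring ab])
      (auto simp: carrier_M carrier_Q zero_M one_Q add_Q mult_Q add_M smult_M J.Icarr J.a_closed
        J.I_l_closed l_distr r_distr m_assoc)
  then show ?thesis by (rule vectorspace.intro[OF _ Q.field_axioms])
qed

text \<open>Spanning and independence in J / J^2 are lifted to sums in the ring itself, so that the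
  applications below work with elements and not with cosets.\<close>

lemma dim_M_eq_card:
  assumes S: "finite S" "S \<subseteq> J"
    and span: "\<And>x. x \<in> J \<Longrightarrow> \<exists>g \<in> S \<rightarrow> carrier R. x \<ominus> (\<Oplus>s\<in>S. g s \<otimes> s) \<in> J2"
    and indep: "\<And>g. g \<in> S \<rightarrow> carrier R \<Longrightarrow> (\<Oplus>s\<in>S. g s \<otimes> s) \<in> J2 \<Longrightarrow> \<forall>s\<in>S. g s \<in> J"
  shows "vectorspace.dim (R Quot J) M = card S"
proof -
  interpret V: vectorspace "R Quot J" M by (rule vectorspace)
  have SR: "S \<subseteq> carrier R" using S J.Icarr by auto
  have sumJ: "T \<subseteq> S \<Longrightarrow> (\<Oplus>s\<in>T. g s \<otimes> s) \<in> J" if g: "g \<in> S \<rightarrow> carrier R" for g T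
  proof -
    assume T: "T \<subseteq> S"
    then have "finite T" using S finite_subset by auto
    then show ?thesis using T
    proof (induction T rule: finite_induct)
      case (insert s T)
      then have "(\<Oplus>s\<in>insert s T. g s \<otimes> s) = g s \<otimes> s \<oplus> (\<Oplus>s\<in>T. g s \<otimes> s)"
        using g SR by (intro finsum_insert) (auto simp: Pi_def subset_iff)
      then show ?case using insert g S by (auto intro!: J.a_closed J.I_l_closed)
    qed (simp add: J.zero_closed)
  qed
  have sum_M: "T \<subseteq> S \<Longrightarrow> (\<Oplus>\<^bsub>M\<^esub>s\<in>T. q (g s) \<odot>\<^bsub>M\<^esub> c s) = c (\<Oplus>s\<in>T. g s \<otimes> s)"
    if g: "g \<in> S \<rightarrow> carrier R" for g T
  proof -
    assume T: "T \<subseteq> S"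
    then have "finite T" using S finite_subset by auto
    then show ?thesis using T
    proof (induction T rule: finite_induct)
      case empty
      then show ?case by (simp add: zero_M)
    next
      case (insert s T)
      have 1: "(\<Oplus>s\<in>insert s T. g s \<otimes> s) = g s \<otimes> s \<oplus> (\<Oplus>s\<in>T. g s \<otimes> s)"
        using insert g SR by (intro finsum_insert) (auto simp: Pi_def subset_iff)
      have cl: "q (g s) \<odot>\<^bsub>M\<^esub> c s \<in> carrier M" if "s \<in> S" for s
        using that g S by (auto simp: smult_M carrier_M Pi_def subset_iff J.I_l_closed)
      have "(\<Oplus>\<^bsub>M\<^esub>s\<in>insert s T. q (g s) \<odot>\<^bsub>M\<^esub> c s) = q (g s) \<odot>\<^bsub>M\<^esub> c s \<oplus>\<^bsub>M\<^esub> (\<Oplus>\<^bsub>M\<^esub>s\<in>T. q (g s) \<odot>\<^bsub>M\<^esub> c s)"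
        using insert cl by (intro V.finsum_insert) auto
      also have "\<dots> = c (g s \<otimes> s) \<oplus>\<^bsub>M\<^esub> c (\<Oplus>s\<in>T. g s \<otimes> s)"
        using insert g S by (auto simp: smult_M Pi_def subset_iff)
      also have "\<dots> = c (g s \<otimes> s \<oplus> (\<Oplus>s\<in>T. g s \<otimes> s))"
        using insert g S sumJ[OF g, of T] by (intro add_M) (auto simp: J.I_l_closed Pi_def subset_iff)
      finally show ?case using 1 by simp
    qed
  qed
  have inj: "inj_on c S"
  proof (rule inj_onI, rule ccontr)
    fix s s' assume s: "s \<in> S" "s' \<in> S" "c s = c s'" "s \<noteq> s'"
    \<comment> \<open>The combination s - s': if s and s' had the same class, it would lie in J^2,
      and \<open>indep\<close> would put its coefficient 1 into J.\<close>
    define g where "g = (\<lambda>x. if x = s then \<one> else if x = s' then \<ominus> \<one> else \<zero>)"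
    have g: "g \<in> S \<rightarrow> carrier R" by (auto simp: g_def)
    have sR: "s \<in> carrier R" "s' \<in> carrier R" using s SR by auto
    have "(\<Oplus>x\<in>S. g x \<otimes> x) = (\<Oplus>x\<in>{s, s'} \<union> (S - {s, s'}). g x \<otimes> x)" using s by (intro finsum_cong') (use g SR in auto)
    also have "\<dots> = (\<Oplus>x\<in>{s, s'}. g x \<otimes> x) \<oplus> (\<Oplus>x\<in>S - {s, s'}. g x \<otimes> x)"
      using S s g SR by (intro finsum_Un_disjoint) auto
    also have "(\<Oplus>x\<in>S - {s, s'}. g x \<otimes> x) = (\<Oplus>x\<in>S - {s, s'}. \<zero>)"
      using SR by (intro finsum_cong') (auto simp: g_def)
    also have "\<dots> = \<zero>" by simp
    also have "(\<Oplus>x\<in>{s, s'}. g x \<otimes> x) = s \<ominus> s'"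
      using s sR by (subst finsum_two) (auto simp: g_def l_minus minus_eq)
    finally have "(\<Oplus>x\<in>S. g x \<otimes> x) = s \<ominus> s'" using sR by simp
    then have "g s \<in> J" using indep[OF g] s c_eq[OF sR] by auto
    then show False using J.one_imp_carrier maximalideal.I_notcarr[OF maximal] by (simp add: g_def)
  qed
  let ?B = "c ` S"
  have B: "finite ?B" "?B \<subseteq> carrier M" using S by (auto simp: carrier_M)
  have lin: "V.lincomb f ?B = c (\<Oplus>s\<in>S. g s \<otimes> s)"
    if g: "g \<in> S \<rightarrow> carrier R" and f: "\<And>s. s \<in> S \<Longrightarrow> f (c s) = q (g s)" for f g
  proof -
    have cl: "f (c s) \<odot>\<^bsub>M\<^esub> c s \<in> carrier M" if "s \<in> S" for s
      using that g S f by (auto simp: smult_M carrier_M Pi_def subset_iff J.I_l_closed)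
    have "V.lincomb f ?B = (\<Oplus>\<^bsub>M\<^esub>s\<in>S. f (c s) \<odot>\<^bsub>M\<^esub> c s)"
      unfolding V.lincomb_def using inj cl by (intro V.finsum_reindex) auto
    also have "\<dots> = (\<Oplus>\<^bsub>M\<^esub>s\<in>S. q (g s) \<odot>\<^bsub>M\<^esub> c s)"
      using f cl by (intro V.finsum_cong') auto
    also have "\<dots> = c (\<Oplus>s\<in>S. g s \<otimes> s)" by (rule sum_M[OF g]) simp
    finally show ?thesis .
  qed
  have "V.lin_indpt ?B"
  proof (rule V.finite_lin_indpt2[OF B])
    fix f assume f: "f \<in> ?B \<rightarrow> carrier (R Quot J)" and z: "V.lincomb f ?B = \<zero>\<^bsub>M\<^esub>"
    have "\<forall>s\<in>S. \<exists>r \<in> carrier R. f (c s) = q r" using f by (auto simp: carrier_Q)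
    then obtain g where g: "\<And>s. s \<in> S \<Longrightarrow> g s \<in> carrier R" "\<And>s. s \<in> S \<Longrightarrow> f (c s) = q (g s)"
      by metis
    have gS: "g \<in> S \<rightarrow> carrier R" using g by auto
    have sc: "(\<Oplus>s\<in>S. g s \<otimes> s) \<in> carrier R" using sumJ[OF gS] J.Icarr by auto
    have "c (\<Oplus>s\<in>S. g s \<otimes> s) = c \<zero>" using lin[OF gS g(2)] z zero_M by simp
    then have "(\<Oplus>s\<in>S. g s \<otimes> s) \<in> J2" using sc by (simp add: c_eq minus_eq)
    then have "\<forall>s\<in>S. g s \<in> J" by (rule indep[OF gS])
    then have "\<forall>s\<in>S. q (g s) = q \<zero>" using g by (simp add: q_eq minus_eq)
    then show "\<forall>v\<in>?B. f v = \<zero>\<^bsub>R Quot J\<^esub>" using g by (simp add: zero_Q)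
  qed
  moreover have "V.gen_set ?B"
  proof
    show "V.span ?B \<subseteq> carrier M" by (rule V.span_is_subset2[OF B(2)])
    show "carrier M \<subseteq> V.span ?B"
    proof
      fix y assume "y \<in> carrier M"
      then obtain x where x: "x \<in> J" "y = c x" by (auto simp: carrier_M)
      obtain g where g: "g \<in> S \<rightarrow> carrier R" "x \<ominus> (\<Oplus>s\<in>S. g s \<otimes> s) \<in> J2" using span[OF x(1)] by auto
      define f where "f v = q (g (inv_into S c v))" for v
      have f: "f (c s) = q (g s)" if "s \<in> S" for s using inj that by (simp add: f_def)
      have "y = c (\<Oplus>s\<in>S. g s \<otimes> s)" using x g J.Icarr sumJ[OF g(1)] by (simp add: c_eq)
      then have "y = V.lincomb f ?B" using lin[OF g(1) f] by simp
      moreover have "f \<in> ?B \<rightarrow> carrier (R Quot J)" using f g by (auto simp: carrier_Q)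
      ultimately show "y \<in> V.span ?B" using B by (auto simp: V.finite_span)
    qed
  qed
  ultimately have "V.basis ?B" using B by (simp add: V.basis_def)
  then have "V.dim = card ?B" by (rule V.dim_basis[OF B(1)])
  then show ?thesis using card_image[OF inj] by simp
qed

end

text \<open>Every strict inclusion of primes ends in \<open>J\<close>, so two consecutive ones would
  make \<open>J\<close> a proper subset of itself.\<close>

lemma (in cring) krull_dim_eq_1:
  assumes J: "maximalideal J R"
    and P: "primeideal P R" "P \<subset> J"
    and above: "\<And>P' Q. primeideal P' R \<Longrightarrow> primeideal Q R \<Longrightarrow> P' \<subset> Q \<Longrightarrow> Q = J"
  shows "krull_dim R = 1"
proof -
  let ?chain = "\<lambda>n. \<exists>P :: nat \<Rightarrow> 'a set. (\<forall>i \<le> n. primeideal (P i) R) \<and> (\<forall>i < n. P i \<subset> P (Suc i))"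
  have le: "n \<le> 1" if chain: "?chain n" for n
  proof (rule ccontr)
    assume n: "\<not> n \<le> 1"
    obtain C where C: "\<forall>i \<le> n. primeideal (C i) R" "\<forall>i < n. C i \<subset> C (Suc i)" using chain by blast
    have "C 0 \<subset> C 1" "C 1 \<subset> C 2" "primeideal (C 0) R" "primeideal (C 1) R" "primeideal (C 2) R"
      using C n by (auto simp: numeral_2_eq_2)
    then have "C 1 = J" "C 2 = J" using above by blast+
    then show False using \<open>C 1 \<subset> C 2\<close> by simp
  qed
  have "?chain 1"
  proof (intro exI conjI allI impI)
    fix i :: nat
    show "primeideal ((\<lambda>i. if i = 0 then P else J) i) R"
      using P maximalideal_prime[OF J] by auto
    assume "i < 1"
    then show "(\<lambda>i. if i = 0 then P else J) i \<subset> (\<lambda>i. if i = 0 then P else J) (Suc i)" using P by auto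
  qed
  then have "enat 1 \<le> krull_dim R" unfolding krull_dim_def by (intro Sup_upper) blast
  moreover have "krull_dim R \<le> enat 1" unfolding krull_dim_def
  proof (rule Sup_least)
    fix x assume "x \<in> {enat n | n. ?chain n}"
    then obtain n where "x = enat n" "?chain n" by blast
    then show "x \<le> enat 1" using le by simp
  qed
  ultimately show ?thesis by (simp add: one_enat_def)
qed

section \<open>Submodules of a ramified quadratic extension\<close>

context valuation_subring
begin

lemma S_neg: assumes "x \<in> S n" shows "\<ominus> x \<in> S n"
proof -
  have "\<ominus> x \<notin> P (Suc n)"
    using P_neg[of "\<ominus> x" "Suc n"] assms S_carrier[OF assms] S_iff[of x n] by auto
  then show ?thesis using assms P_neg[of x n] by (simp add: S_iff)
qed

lemma pi_pow_cancel: assumes "x \<in> carrier R" "y \<in> carrier R" "\<pi> [^] (n::nat) \<otimes> x = \<pi> [^] n \<otimes> y" shows "x = y"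
  using assms pi_pow_carrier pi_pow_nz by (simp add: m_lcancel)

lemma P_1_E: "x \<in> P 1 \<Longrightarrow> (\<And>y. y \<in> V \<Longrightarrow> x = \<pi> \<otimes> y \<Longrightarrow> thesis) \<Longrightarrow> thesis"
  using pi_carrier by (auto elim!: P_E)

end

text \<open>Ramification enters as \<open>t_S\<close>, the valuation 2 of t in D1. The quadratic
  degree enters as \<open>dependent\<close>, with the denominators of the relation already cleared,
  so that the arguments of this locale stay with coefficients in D.\<close>

locale two_branch = field R + D: valuation_subring R D t + D1: valuation_subring R D1 \<tau>
  for R (structure) and D t D1 \<tau> +
  assumes D_D1: "D \<subseteq> D1"
    and t_S: "t \<in> D1.S 2"
    and dependent: "x \<in> carrier R \<Longrightarrow> y \<in> carrier R \<Longrightarrow> z \<in> carrier R \<Longrightarrow>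
      \<exists>a b c. a \<in> D \<and> b \<in> D \<and> c \<in> D \<and> (a \<noteq> \<zero> \<or> b \<noteq> \<zero> \<or> c \<noteq> \<zero>) \<and> a \<otimes> x \<oplus> b \<otimes> y \<oplus> c \<otimes> z = \<zero>"
begin

lemma D_in_D1: "x \<in> D \<Longrightarrow> x \<in> D1" using D_D1 by auto
lemma t_carrier: "t \<in> carrier R" by (rule D.pi_carrier)
lemma t_pow_carrier: "t [^] (n::nat) \<in> carrier R" by (rule D.pi_pow_carrier)
lemma t_D1: "t \<in> D1" using D.pi D_in_D1 by auto

lemma D_U: "u \<in> D.U \<Longrightarrow> u \<in> D1.U"
  by (auto simp: D.U_def D1.U_def D_in_D1)

lemma t_pow_S: "t [^] (n::nat) \<in> D1.S (2 * n)"
  using D1.S_pow[OF t_S, of n] by (simp add: mult.commute)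

lemma D_S: assumes "d \<in> D.S n" shows "d \<in> D1.S (2 * n)"
proof -
  obtain u where u: "u \<in> D.U" "d = t [^] n \<otimes> u" using assms by (auto elim: D.S_E)
  then show ?thesis using D1.S_mult[OF t_pow_S[of n], of u 0] D_U by (simp add: D1.S_0)
qed

lemma t_pow_P: "x \<in> D1.P m \<Longrightarrow> t [^] (n::nat) \<otimes> x \<in> D1.P (2 * n + m)"
  using D1.P_mult[OF D1.S_P[OF t_pow_S]] .

lemma P_even_E:
  assumes "x \<in> D1.P (2 * n + m)"
  obtains y where "y \<in> D1.P m" "x = t [^] n \<otimes> y"
proof -
  obtain a where "a \<in> D1.P (2 * n + m - 2 * n)" "x = a \<otimes> t [^] n"
    using D1.S_div[OF t_pow_S[of n] assms] by auto
  then show thesis using that[of a] D1.P_carrier[of a m] t_pow_carrier by (simp add: m_comm)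
qed

text \<open>Units of D stay units of D1, so an element of D that is not a unit in D1 is not a unit
  in D either.\<close>

lemma D_P_1: assumes "d \<in> D" "d \<in> D1.P 1" shows "d \<in> D.P 1"
  using assms D.U_iff[of d] D_U[of d] D1.U_iff[of d] by auto

lemma S_smult: "d \<in> D.S i \<Longrightarrow> x \<in> D1.S n \<Longrightarrow> d \<otimes> x \<in> D1.S (2 * i + n)"
  using D1.S_mult[OF D_S] .

lemma D_P_smult: assumes "d \<in> D.P i" "x \<in> D1.P n" shows "d \<otimes> x \<in> D1.P (2 * i + n)"
proof -
  obtain e where e: "e \<in> D" "d = t [^] i \<otimes> e" using assms by (auto elim: D.P_E)
  have "d \<otimes> x = t [^] i \<otimes> (e \<otimes> x)"
    using e assms D.V_carrier t_pow_carrier D1.P_carrier by (simp add: m_assoc)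
  then show ?thesis using t_pow_P[OF D1.P_smult[OF D_in_D1[OF e(1)] assms(2)]] by simp
qed

text \<open>The valuations 2 i + m and 2 j + n of the two terms differ in parity, so the terms
  cannot cancel.\<close>

lemma independent_parity:
  assumes x: "x \<in> D1.S m" and y: "y \<in> D1.S n" and mn: "even m \<noteq> even n"
    and ab: "a \<in> D" "b \<in> D" and z: "a \<otimes> x \<oplus> b \<otimes> y = \<zero>"
  shows "a = \<zero> \<and> b = \<zero>"
proof -
  note c = D1.S_carrier[OF x] D1.S_carrier[OF y] D.V_carrier[OF ab(1)] D.V_carrier[OF ab(2)]
  have eq: "b \<otimes> y = \<ominus> (a \<otimes> x)" using z c minus_equality[of "b \<otimes> y" "a \<otimes> x"] by (simp add: a_comm)
  have "a = \<zero>"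
  proof (rule ccontr)
    assume "a \<noteq> \<zero>"
    then obtain i where i: "a \<in> D.S i" using D.S_ex ab by auto
    then have s: "b \<otimes> y \<in> D1.S (2 * i + m)" using eq D1.S_neg[OF S_smult[OF i x]] by simp
    then have "b \<noteq> \<zero>" using D1.S_nz[OF s] c by auto
    then obtain j where j: "b \<in> D.S j" using D.S_ex ab by auto
    have "2 * i + m = 2 * j + n" using D1.S_unique[OF s S_smult[OF j y]] .
    then show False using mn by presburger
  qed
  then have "b \<otimes> y = \<zero>" using eq c by simp
  then show ?thesis using \<open>a = \<zero>\<close> c D1.S_nz[OF y] by (simp add: integral_iff)
qed

lemma unique_parity:
  assumes x: "x \<in> D1.S m" and y: "y \<in> D1.S n" and mn: "even m \<noteq> even n"
    and ab: "a \<in> D" "b \<in> D" "a' \<in> D" "b' \<in> D" and eq: "a \<otimes> x \<oplus> b \<otimes> y = a' \<otimes> x \<oplus> b' \<otimes> y"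
  shows "a = a'" "b = b'"
proof -
  note c = D1.S_carrier[OF x] D1.S_carrier[OF y] ab[THEN D.V_carrier]
  have "(a \<ominus> a') \<otimes> x \<oplus> (b \<ominus> b') \<otimes> y = (a \<otimes> x \<oplus> b \<otimes> y) \<ominus> (a' \<otimes> x \<oplus> b' \<otimes> y)"
    using c by algebra
  also have "\<dots> = \<zero>" using eq c by simp
  finally have "a \<ominus> a' = \<zero> \<and> b \<ominus> b' = \<zero>"
    using ab by (intro independent_parity[OF x y mn]) (auto simp: D.V_minus)
  then show "a = a'" "b = b'" using c by (auto simp: r_right_minus_eq)
qed

text \<open>Modulo \<tau>^(n+1) only a x survives, so a is not a unit. Being in D, it is then
  divisible by t, which has valuation 2, and a x drops out even modulo \<tau>^(n+2). The same
  argument then applies to b y.\<close>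

lemma coefficients_P_1:
  assumes x: "x \<in> D1.S n" and y: "y \<in> D1.S (Suc n)" and ab: "a \<in> D" "b \<in> D"
    and z: "a \<otimes> x \<oplus> b \<otimes> y \<in> D1.P (n + 2)"
  shows "a \<in> D.P 1 \<and> b \<in> D.P 1"
proof -
  note c = D1.S_carrier[OF x] D1.S_carrier[OF y] D.V_carrier[OF ab(1)] D.V_carrier[OF ab(2)]
  have z': "a \<otimes> x \<oplus> b \<otimes> y \<in> D1.P (Suc n)" using z D1.P_mono[of "Suc n" "n + 2"] by simp
  have "b \<otimes> y \<in> D1.P (Suc n)" using D1.P_smult[OF D_in_D1[OF ab(2)] D1.S_P[OF y]] .
  then have "(a \<otimes> x \<oplus> b \<otimes> y) \<ominus> b \<otimes> y \<in> D1.P (Suc n)" using z' D1.P_minus by auto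
  moreover have "(a \<otimes> x \<oplus> b \<otimes> y) \<ominus> b \<otimes> y = x \<otimes> a" using c by algebra
  ultimately have "a \<in> D1.P 1" using D1.S_mult_P[OF x D_in_D1[OF ab(1)], of "Suc n"] by simp
  then have a: "a \<in> D.P 1" using D_P_1 ab by auto
  have "a \<otimes> x \<in> D1.P (n + 2)" using D_P_smult[OF a D1.S_P[OF x]] by (simp add: add.commute)
  then have "(a \<otimes> x \<oplus> b \<otimes> y) \<ominus> a \<otimes> x \<in> D1.P (n + 2)" using z D1.P_minus by auto
  moreover have "(a \<otimes> x \<oplus> b \<otimes> y) \<ominus> a \<otimes> x = y \<otimes> b" using c by algebra
  ultimately have "b \<in> D1.P 1" using D1.S_mult_P[OF y D_in_D1[OF ab(2)], of "n + 2"] by simp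
  then show ?thesis using a D_P_1 ab by auto
qed

text \<open>For s > 0 the element t^s z has valuation at least n + 2, so both coefficients of its
  representation are divisible by t. One factor t is cancelled at a time.\<close>

lemma basis_descent:
  assumes x: "x \<in> D1.S n" and y: "y \<in> D1.S (Suc n)" and z: "z \<in> D1.P n"
  shows "a \<in> D \<Longrightarrow> b \<in> D \<Longrightarrow> t [^] (s::nat) \<otimes> z = a \<otimes> x \<oplus> b \<otimes> y \<Longrightarrow>
    \<exists>a b. a \<in> D \<and> b \<in> D \<and> z = a \<otimes> x \<oplus> b \<otimes> y"
proof (induction s arbitrary: a b)
  case 0
  then show ?case using D1.P_carrier[OF z] by auto
next
  case (Suc s)
  have "t [^] Suc s \<otimes> z \<in> D1.P (2 * Suc s + n)" by (rule t_pow_P[OF z])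
  then have "a \<otimes> x \<oplus> b \<otimes> y \<in> D1.P (n + 2)"
    using Suc.prems D1.P_mono[of "n + 2" "2 * Suc s + n"] by auto
  then have "a \<in> D.P 1" "b \<in> D.P 1" using coefficients_P_1[OF x y] Suc.prems by auto
  then obtain a' b' where ab: "a' \<in> D" "a = t \<otimes> a'" "b' \<in> D" "b = t \<otimes> b'"
    by (meson D.P_1_E)
  note c = D1.S_carrier[OF x] D1.S_carrier[OF y] D1.P_carrier[OF z] D.V_carrier[OF ab(1)] D.V_carrier[OF ab(3)]
    t_carrier t_pow_carrier[of s]
  have "t [^] (1::nat) \<otimes> (t [^] s \<otimes> z) = t [^] Suc s \<otimes> z" using c by (simp add: m_ac)
  also have "\<dots> = (t \<otimes> a') \<otimes> x \<oplus> (t \<otimes> b') \<otimes> y" using Suc.prems ab by simp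
  also have "\<dots> = t [^] (1::nat) \<otimes> (a' \<otimes> x \<oplus> b' \<otimes> y)" using c by (simp add: r_distr m_assoc)
  finally have "t [^] s \<otimes> z = a' \<otimes> x \<oplus> b' \<otimes> y"
    using D.pi_pow_cancel[of "t [^] s \<otimes> z" "a' \<otimes> x \<oplus> b' \<otimes> y" 1] c by simp
  then show ?case using Suc.IH ab by blast
qed

text \<open>The dependence relation has a nonzero coefficient d at z, since x and y alone are
  independent by parity. With d = t^s u and u a unit this represents t^s z, and the descent removes
  the power of t.\<close>

lemma basis:
  assumes x: "x \<in> D1.S n" and y: "y \<in> D1.S (Suc n)" and z: "z \<in> D1.P n"
  shows "\<exists>a b. a \<in> D \<and> b \<in> D \<and> z = a \<otimes> x \<oplus> b \<otimes> y"
proof -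
  obtain a b d where d: "a \<in> D" "b \<in> D" "d \<in> D" "a \<noteq> \<zero> \<or> b \<noteq> \<zero> \<or> d \<noteq> \<zero>"
      "a \<otimes> x \<oplus> b \<otimes> y \<oplus> d \<otimes> z = \<zero>"
    using dependent[OF D1.S_carrier[OF x] D1.S_carrier[OF y] D1.P_carrier[OF z]] by auto
  note c = D1.S_carrier[OF x] D1.S_carrier[OF y] D1.P_carrier[OF z] d(1-3)[THEN D.V_carrier]
  have "d \<noteq> \<zero>"
  proof
    assume "d = \<zero>"
    then have "a \<otimes> x \<oplus> b \<otimes> y = \<zero>" using d c by simp
    then show False using independent_parity[OF x y _ d(1,2)] d \<open>d = \<zero>\<close> by auto
  qed
  then obtain s where "d \<in> D.S s" using D.S_ex d by auto
  then obtain u where u: "u \<in> D.U" "d = t [^] s \<otimes> u" by (auto elim: D.S_E)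
  let ?a = "\<ominus> (inv u \<otimes> a)" and ?b = "\<ominus> (inv u \<otimes> b)"
  have ab: "?a \<in> D" "?b \<in> D" using u d D.U_inv_V D.V_neg D.V_mult by auto
  note c' = c t_pow_carrier[of s] D.U_carrier[OF u(1)] D.V_carrier[OF D.U_inv_V[OF u(1)]]
  have "d \<otimes> z = \<ominus> (a \<otimes> x \<oplus> b \<otimes> y)"
    using minus_equality[of "d \<otimes> z" "a \<otimes> x \<oplus> b \<otimes> y"] d(5) c by (simp add: a_comm)
  then have "inv u \<otimes> (d \<otimes> z) = ?a \<otimes> x \<oplus> ?b \<otimes> y"
    using c' by (simp add: l_minus r_minus r_distr m_assoc minus_add)
  moreover have "inv u \<otimes> (d \<otimes> z) = (inv u \<otimes> u) \<otimes> (t [^] s \<otimes> z)"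
    using u(2) c' by (simp add: m_ac)
  ultimately have "t [^] s \<otimes> z = ?a \<otimes> x \<oplus> ?b \<otimes> y" using D.U_cancel[OF u(1)] c' by simp
  then show ?thesis using basis_descent[OF x y z ab] by simp
qed

section \<open>Submodules of D1 over D and their normal form\<close>

definition dmodule where
  "dmodule M \<longleftrightarrow> M \<subseteq> D1 \<and> \<zero> \<in> M \<and> (\<forall>x\<in>M. \<forall>y\<in>M. x \<oplus> y \<in> M) \<and> (\<forall>d\<in>D. \<forall>x\<in>M. d \<otimes> x \<in> M)"

lemma dmoduleD:
  assumes "dmodule M"
  shows "x \<in> M \<Longrightarrow> x \<in> D1" "\<zero> \<in> M" "x \<in> M \<Longrightarrow> y \<in> M \<Longrightarrow> x \<oplus> y \<in> M"
    "d \<in> D \<Longrightarrow> x \<in> M \<Longrightarrow> d \<otimes> x \<in> M" "x \<in> M \<Longrightarrow> x \<in> carrier R"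
  using assms D1.V_carrier by (auto simp: dmodule_def)

lemma dmodule_neg: assumes "dmodule M" "x \<in> M" shows "\<ominus> x \<in> M"
proof -
  have "(\<ominus> \<one>) \<otimes> x \<in> M" using assms by (intro dmoduleD(4)) (auto simp: D.V_closed)
  then show ?thesis using dmoduleD(5)[OF assms] by (simp add: l_minus)
qed

lemma dmodule_minus: "dmodule M \<Longrightarrow> x \<in> M \<Longrightarrow> y \<in> M \<Longrightarrow> x \<ominus> y \<in> M"
  by (simp add: minus_eq dmoduleD dmodule_neg)

definition gen where "gen x j = {d \<otimes> x \<oplus> z | d z. d \<in> D \<and> z \<in> D1.P j}"

lemma gen_I: "d \<in> D \<Longrightarrow> z \<in> D1.P j \<Longrightarrow> d \<otimes> x \<oplus> z \<in> gen x j" by (auto simp: gen_def)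

text \<open>With the basis x, x \<tau> of \<tau>^n D1 one has z = a x + b x \<tau>. The last term is
  z - a x, hence in \<open>M\<close>, and if b is nonzero it has valuation 2 j + n + 1, with j the
  valuation of b in D.\<close>

lemma minimal_valuation_remainder:
  assumes M: "dmodule M" and x: "x \<in> M" "x \<in> D1.S n"
    and min: "\<And>z m. z \<in> M \<Longrightarrow> z \<in> D1.S m \<Longrightarrow> n \<le> m" and z: "z \<in> M"
  obtains a w where "a \<in> D" "w \<in> M" "z = a \<otimes> x \<oplus> w" "w = \<zero> \<or> (\<exists>m. w \<in> D1.S m \<and> even m \<noteq> even n)"
proof -
  note M' = dmoduleD[OF M]
  have "z \<in> D1.P n"
  proof (cases "z = \<zero>")
    case False
    then obtain m where m: "z \<in> D1.S m" using D1.S_ex M'(1)[OF z] by auto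
    then show ?thesis using min[OF z m] D1.S_P[OF m] D1.P_mono by auto
  qed (simp add: D1.P_zero)
  moreover have xt: "x \<otimes> \<tau> \<in> D1.S (Suc n)" using D1.S_mult[OF x(2) D1.pi_pow_S[of 1]] D1.pi_carrier by simp
  ultimately obtain a b where ab: "a \<in> D" "b \<in> D" "z = a \<otimes> x \<oplus> b \<otimes> (x \<otimes> \<tau>)" using basis[OF x(2)] by blast
  let ?w = "b \<otimes> (x \<otimes> \<tau>)"
  have "z \<ominus> a \<otimes> x \<in> M" using z ab x M M'(4) dmodule_minus by auto
  moreover have "z \<ominus> a \<otimes> x = ?w"
    using ab(3) M'(5)[OF x(1)] D.V_carrier[OF ab(1)] D.V_carrier[OF ab(2)] D1.pi_carrier by algebra
  ultimately have "?w \<in> M" by simp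
  moreover have "?w = \<zero> \<or> (\<exists>m. ?w \<in> D1.S m \<and> even m \<noteq> even n)"
  proof (cases "b = \<zero>")
    case False
    then obtain j where j: "b \<in> D.S j" using D.S_ex ab by auto
    have "even (2 * j + Suc n) \<noteq> even n" by simp
    then show ?thesis using S_smult[OF j xt] by blast
  qed (use D1.S_carrier[OF xt] in simp)
  ultimately show thesis using that ab by blast
qed

text \<open>What remains of an element of \<open>M\<close> after subtraction of a multiple of x has
  valuation at least n', by the choice of n'. Conversely, y and a multiple t^s x of valuation n' - 1
  form a basis of \<tau>^(n' - 1) D1, which therefore lies in \<open>M\<close>. Both exponents n'
  and n' - 1 are offered because the two families need the even one, which is a power of t.\<close>

lemma dmodule_structure:
  assumes M: "dmodule M" and p: "p \<in> M" "p \<in> D1.S i" and p': "p' \<in> M" "p' \<in> D1.S i'" and par: "even i \<noteq> even i'"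
  obtains x y n n' where "x \<in> M" "x \<in> D1.S n" "y \<in> M" "y \<in> D1.S n'" "n < n'" "even n \<noteq> even n'"
    "\<And>z m. z \<in> M \<Longrightarrow> z \<in> D1.S m \<Longrightarrow> n \<le> m"
    "\<And>z m. z \<in> M \<Longrightarrow> z \<in> D1.S m \<Longrightarrow> even m \<noteq> even n \<Longrightarrow> n' \<le> m"
    "M = gen x n'" "M = gen x (n' - 1)" "M = {a \<otimes> x \<oplus> b \<otimes> y | a b. a \<in> D \<and> b \<in> D}"
proof -
  note M' = dmoduleD[OF M]
  define n where "n = (LEAST n. \<exists>z\<in>M. z \<in> D1.S n)"
  have "\<exists>z\<in>M. z \<in> D1.S n" unfolding n_def by (rule LeastI_ex) (use p in auto)
  then obtain x where x: "x \<in> M" "x \<in> D1.S n" by auto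
  have min: "n \<le> m" if "z \<in> M" "z \<in> D1.S m" for z m
    unfolding n_def by (rule Least_le) (use that in auto)
  define n' where "n' = (LEAST n'. \<exists>z\<in>M. z \<in> D1.S n' \<and> even n' \<noteq> even n)"
  have "\<exists>z\<in>M. z \<in> D1.S n' \<and> even n' \<noteq> even n" unfolding n'_def
    by (rule LeastI_ex) (use p p' par in metis)
  then obtain y where y: "y \<in> M" "y \<in> D1.S n'" "even n' \<noteq> even n" by auto
  have min': "n' \<le> m" if "z \<in> M" "z \<in> D1.S m" "even m \<noteq> even n" for z m
    unfolding n'_def by (rule Least_le) (use that in auto)
  have "n \<le> n'" by (rule min[OF y(1,2)])
  then have lt: "n < n'" using y(3) by (cases "n = n'") auto
  note c = M'(5)[OF x(1)] M'(5)[OF y(1)]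
  \<comment> \<open>n' - 1 has the parity of n, so multiplying x by a power of t, each factor of
    which raises the valuation by 2, reaches it exactly.\<close>
  define s where "s = (n' - 1 - n) div 2"
  have s: "2 * s + n = n' - 1" using lt y(3) unfolding s_def by presburger
  have x': "t [^] s \<otimes> x \<in> D1.S (n' - 1)" using D1.S_mult[OF t_pow_S[of s] x(2)] s by simp
  have P_M: "\<exists>a b. a \<in> D \<and> b \<in> D \<and> z = a \<otimes> (t [^] s \<otimes> x) \<oplus> b \<otimes> y" if "z \<in> D1.P (n' - 1)" for z
    using basis[OF x' _ that, of y] y lt by simp
  have M_gen: "M \<subseteq> gen x n'"
  proof
    fix z assume z: "z \<in> M"
    obtain a w where w: "a \<in> D" "w \<in> M" "z = a \<otimes> x \<oplus> w" "w = \<zero> \<or> (\<exists>m. w \<in> D1.S m \<and> even m \<noteq> even n)"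
      by (rule minimal_valuation_remainder[OF M x min z])
    have "w \<in> D1.P n'"
      using w(4)
    proof (elim disjE exE conjE)
      fix m assume m: "w \<in> D1.S m" "even m \<noteq> even n"
      show ?thesis using min'[OF w(2) m] D1.S_P[OF m(1)] D1.P_mono by blast
    qed (simp add: D1.P_zero)
    then show "z \<in> gen x n'" using w gen_I by auto
  qed
  have gen_gen: "gen x n' \<subseteq> gen x (n' - 1)"
    unfolding gen_def using D1.P_mono[of "n' - 1" n'] by auto
  have gen_span: "gen x (n' - 1) \<subseteq> {a \<otimes> x \<oplus> b \<otimes> y | a b. a \<in> D \<and> b \<in> D}"
  proof
    fix z assume "z \<in> gen x (n' - 1)"
    then obtain d w where d: "d \<in> D" "w \<in> D1.P (n' - 1)" "z = d \<otimes> x \<oplus> w" by (auto simp: gen_def)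
    obtain a b where ab: "a \<in> D" "b \<in> D" "w = a \<otimes> (t [^] s \<otimes> x) \<oplus> b \<otimes> y" using P_M[OF d(2)] by auto
    have "z = (d \<oplus> a \<otimes> t [^] s) \<otimes> x \<oplus> b \<otimes> y"
      using d ab c D.V_carrier t_pow_carrier by (simp add: l_distr a_assoc m_assoc)
    then show "z \<in> {a \<otimes> x \<oplus> b \<otimes> y | a b. a \<in> D \<and> b \<in> D}"
      using d ab D.V_add D.V_mult D.pi_pow_V by blast
  qed
  have span_M: "{a \<otimes> x \<oplus> b \<otimes> y | a b. a \<in> D \<and> b \<in> D} \<subseteq> M" using x y M'(3,4) by auto
  show thesis
    by (rule that[OF x y(1,2) lt _ min min']) (use y(3) M_gen gen_gen gen_span span_M in auto)
qed

section \<open>Multiplicatively closed submodules and their classification\<close>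

text \<open>The shape of the intersection of a cubic ring with e A: closed under products, in
  general without a unit element, and of full rank over D, which is expressed by containing some
  \<tau>^N D1.\<close>

definition rng_lattice where
  "rng_lattice M \<longleftrightarrow> dmodule M \<and> (\<forall>x\<in>M. \<forall>y\<in>M. x \<otimes> y \<in> M) \<and> (\<exists>N. D1.P N \<subseteq> M)"

definition scale where "scale k M = {t [^] (k::nat) \<otimes> z | z. z \<in> M}"

text \<open>The generators of the two families, with \<open>t\<^sup>r D\<^sub>1\<close> written as \<open>\<tau>\<^bsup>2r\<^esup> D\<^sub>1\<close>; the names refer to the parity
  of the least valuation.\<close>

definition even_module where
  "even_module l q \<alpha> = gen (t [^] (l::nat) \<otimes> (\<one> \<oplus> t [^] (q::nat) \<otimes> \<alpha>)) (2 * (2 * l + q))"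

definition odd_module where
  "odd_module r \<alpha> = gen (t [^] (r::nat) \<otimes> \<alpha>) (2 * (2 * r + 1))"

lemma S_even_E:
  assumes "x \<in> D1.S (2 * n + m)"
  obtains y where "y \<in> D1.S m" "x = t [^] n \<otimes> y"
proof -
  obtain y where y: "y \<in> D1.P m" "x = t [^] n \<otimes> y"
    using P_even_E[OF D1.S_P[OF assms]] by blast
  have "y \<notin> D1.P (Suc m)"
  proof
    assume "y \<in> D1.P (Suc m)"
    then have "x \<in> D1.P (2 * n + Suc m)" unfolding y(2) by (rule t_pow_P)
    then show False using D1.S_P_le[OF assms] by force
  qed
  then show thesis using that[of y] y by (simp add: D1.S_iff)
qed

lemma gen_D1: "x \<in> D1 \<Longrightarrow> gen x j \<subseteq> D1"
  unfolding gen_def using D1.V_add D1.V_mult D_in_D1 D1.P_V by auto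

lemma dmodule_gen: assumes x: "x \<in> D1" shows "dmodule (gen x j)"
proof -
  note xc = D1.V_carrier[OF x]
  have "\<zero> \<in> gen x j" using gen_I[OF D.V_zero D1.P_zero, of x j] xc by simp
  moreover have "u \<oplus> v \<in> gen x j" if uv: "u \<in> gen x j" "v \<in> gen x j" for u v
  proof -
    obtain a p b p' where ab: "a \<in> D" "p \<in> D1.P j" "u = a \<otimes> x \<oplus> p" "b \<in> D" "p' \<in> D1.P j" "v = b \<otimes> x \<oplus> p'"
      using uv by (auto simp: gen_def)
    note c = xc D.V_carrier[OF ab(1)] D.V_carrier[OF ab(4)] D1.P_carrier[OF ab(2)] D1.P_carrier[OF ab(5)]
    have "u \<oplus> v = (a \<oplus> b) \<otimes> x \<oplus> (p \<oplus> p')" unfolding ab using c by algebra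
    then show ?thesis using ab gen_I D.V_add D1.P_add by simp
  qed
  moreover have "d \<otimes> u \<in> gen x j" if du: "d \<in> D" "u \<in> gen x j" for d u
  proof -
    obtain a p where ab: "a \<in> D" "p \<in> D1.P j" "u = a \<otimes> x \<oplus> p" using du by (auto simp: gen_def)
    have "d \<otimes> u = (d \<otimes> a) \<otimes> x \<oplus> d \<otimes> p"
      using ab du xc D.V_carrier D1.P_carrier by (simp add: r_distr m_assoc)
    then show ?thesis using ab du gen_I D.V_mult D1.P_smult[OF D_in_D1] by simp
  qed
  ultimately show ?thesis using gen_D1[OF x] by (auto simp: dmodule_def)
qed

lemma gen_self: "x \<in> D1 \<Longrightarrow> x \<in> gen x j"
  using gen_I[OF D.V_one D1.P_zero, of x j] D1.V_carrier by simp

lemma P_subset_gen: "x \<in> D1 \<Longrightarrow> D1.P j \<subseteq> gen x j"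
proof
  fix z assume "x \<in> D1" "z \<in> D1.P j"
  then show "z \<in> gen x j" using gen_I[OF D.V_zero, of z j x] D1.V_carrier D1.P_carrier by simp
qed

lemma gen_subset: assumes M: "dmodule M" "x \<in> M" "D1.P j \<subseteq> M" shows "gen x j \<subseteq> M"
  unfolding gen_def using M dmoduleD[OF M(1)] by auto

text \<open>Only the class of the generator modulo \<tau>^j, and up to units of D, matters; this is
  what allows the generator to be normalized to t^i (1 + t^q \<alpha>).\<close>

lemma gen_cong:
  assumes x': "x' \<in> D1" and u: "u \<in> D.U" and p: "p \<in> D1.P j"
  shows "gen (u \<otimes> x' \<oplus> p) j = gen x' j"
proof
  let ?x = "u \<otimes> x' \<oplus> p"
  have x: "?x \<in> D1" using x' D_in_D1[OF D.U_V[OF u]] D1.P_V[OF p] D1.V_add D1.V_mult by auto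
  show "gen ?x j \<subseteq> gen x' j"
    using gen_I[OF D.U_V[OF u] p] x' by (intro gen_subset dmodule_gen P_subset_gen) auto
  have c: "u \<in> carrier R" "inv u \<in> carrier R" "x' \<in> carrier R" "p \<in> carrier R" "?x \<in> carrier R"
    using D.U_carrier[OF u] D.V_carrier[OF D.U_inv_V[OF u]] D1.V_carrier x' D1.P_carrier[OF p] by auto
  have "x' = (inv u \<otimes> u) \<otimes> x'" using c D.U_cancel[OF u] by simp
  also have "\<dots> = inv u \<otimes> (u \<otimes> x' \<oplus> p) \<oplus> (\<ominus> (inv u \<otimes> p))" using c(1-4) by algebra
  also have "\<dots> \<in> gen ?x j"
    using u p by (intro gen_I D.U_inv_V D1.P_neg D1.P_smult D_in_D1)
  finally show "gen x' j \<subseteq> gen ?x j" using x by (intro gen_subset dmodule_gen P_subset_gen)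
qed

lemma scale_gen: assumes x: "x \<in> carrier R" shows "scale k (gen x j) = gen (t [^] k \<otimes> x) (2 * k + j)"
proof
  show "scale k (gen x j) \<subseteq> gen (t [^] k \<otimes> x) (2 * k + j)"
  proof
    fix z assume "z \<in> scale k (gen x j)"
    then obtain d p where d: "d \<in> D" "p \<in> D1.P j" "z = t [^] k \<otimes> (d \<otimes> x \<oplus> p)" by (auto simp: scale_def gen_def)
    then have "z = d \<otimes> (t [^] k \<otimes> x) \<oplus> t [^] k \<otimes> p"
      using x D.V_carrier[OF d(1)] D1.P_carrier[OF d(2)] t_pow_carrier[of k] by (simp add: r_distr m_ac)
    then show "z \<in> gen (t [^] k \<otimes> x) (2 * k + j)" using d gen_I t_pow_P by simp
  qed
  show "gen (t [^] k \<otimes> x) (2 * k + j) \<subseteq> scale k (gen x j)"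
  proof
    fix z assume "z \<in> gen (t [^] k \<otimes> x) (2 * k + j)"
    then obtain d p where d: "d \<in> D" "p \<in> D1.P (2 * k + j)" "z = d \<otimes> (t [^] k \<otimes> x) \<oplus> p" by (auto simp: gen_def)
    obtain p' where p': "p' \<in> D1.P j" "p = t [^] k \<otimes> p'" using P_even_E[OF d(2)] by blast
    have "z = t [^] k \<otimes> (d \<otimes> x \<oplus> p')"
      using d p' x D.V_carrier[OF d(1)] D1.P_carrier[OF p'(1)] t_pow_carrier[of k] by (simp add: r_distr m_ac)
    then show "z \<in> scale k (gen x j)" using d p' gen_I by (auto simp: scale_def)
  qed
qed

lemma unit_perturb: "\<alpha> \<in> D1.S 1 \<Longrightarrow> \<one> \<oplus> t [^] (q::nat) \<otimes> \<alpha> \<in> D1.U"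
  using D1.S_perturb[of \<one> 0 "t [^] q \<otimes> \<alpha>"] t_pow_P[OF D1.S_P, of \<alpha> 1 q] D1.P_mono[of 1 "2 * q + 1"] D1.U_one
  by (auto simp: D1.S_0)

lemma even_generator_S: "\<alpha> \<in> D1.S 1 \<Longrightarrow> t [^] (l::nat) \<otimes> (\<one> \<oplus> t [^] (q::nat) \<otimes> \<alpha>) \<in> D1.S (2 * l)"
  using D1.S_mult[OF t_pow_S[of l], of _ 0] unit_perturb by (simp add: D1.S_0)

lemma odd_generator_S: "\<alpha> \<in> D1.S 1 \<Longrightarrow> t [^] (r::nat) \<otimes> \<alpha> \<in> D1.S (2 * r + 1)"
  using D1.S_mult[OF t_pow_S[of r], of _ 1] by simp

text \<open>For x = t^i (1 + s) with s = t^q \<alpha>, the difference x^2 - t^i x equals t^(2i) s (1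
  + s): the even leading term cancels and s supplies an odd valuation.\<close>

lemma even_generator_square:
  assumes \<alpha>: "\<alpha> \<in> D1.S 1" and x: "x = t [^] (i::nat) \<otimes> (\<one> \<oplus> t [^] (q::nat) \<otimes> \<alpha>)"
  shows "x \<otimes> x \<ominus> t [^] i \<otimes> x \<in> D1.S (2 * (2 * i + q) + 1)"
proof -
  let ?a = "t [^] i" and ?b = "t [^] q"
  have c: "?a \<in> carrier R" "?b \<in> carrier R" "\<alpha> \<in> carrier R"
    using t_pow_carrier D1.S_carrier[OF \<alpha>] by auto
  have "x \<otimes> x \<ominus> ?a \<otimes> x = ?a \<otimes> (?a \<otimes> (?b \<otimes> (\<alpha> \<otimes> (\<one> \<oplus> ?b \<otimes> \<alpha>))))"
    unfolding x using c one_closed by algebra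
  also have "\<dots> \<in> D1.S (2 * i + (2 * i + (2 * q + (1 + 0))))"
    using \<alpha> unit_perturb[OF \<alpha>] by (intro D1.S_mult t_pow_S) (simp_all add: D1.S_0)
  finally show ?thesis by simp
qed

text \<open>These are the coefficients in the basis 1, \<tau> of D1: if d were not a unit, a would
  lie in \<tau> D1. So every unit of D1 has the residue of a unit of D.\<close>

lemma unit_residue: assumes a: "a \<in> D1.U" shows "\<exists>d \<in> D.U. \<exists>b \<in> D. a = d \<oplus> b \<otimes> \<tau>"
proof -
  have \<tau>: "\<tau> \<in> D1.P 1" "\<tau> \<in> D1.S (Suc 0)" using D1.pi_pow_P[of 1] D1.pi_pow_S[of 1] D1.pi_carrier by auto
  obtain d b where d: "d \<in> D" "b \<in> D" "a = d \<otimes> \<one> \<oplus> b \<otimes> \<tau>"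
    using basis[of \<one> 0 \<tau> a] \<tau> D1.U_one D1.U_V[OF a] by (auto simp: D1.S_0 D1.P_0)
  have "d \<notin> D.P 1"
  proof
    assume "d \<in> D.P 1"
    then have "d \<otimes> \<one> \<in> D1.P (2 * 1 + 0)" by (rule D_P_smult) (simp add: D1.P_0 D1.V_one)
    then have "d \<otimes> \<one> \<in> D1.P 1" using D1.P_mono[of 1 2] by simp
    then have "a \<in> D1.P 1" using d D1.P_add D1.P_smult[OF D_in_D1[OF d(2)] \<tau>(1)] by simp
    then show False using a D1.U_iff by simp
  qed
  then show ?thesis using d D.U_iff D.V_carrier by auto
qed

text \<open>The clause on m comes from the minimality of n': a module that contains t^m D1 contains
  elements of valuations 2 m and 2 m + 1, and the one with the parity of n' gives the bound.\<close>

lemma rng_lattice_classification: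
  assumes M: "rng_lattice M"
  shows "(\<exists>k l q \<alpha>. \<alpha> \<in> D1.S 1 \<and> M = scale k (even_module l q \<alpha>) \<and>
           (\<forall>m. D1.P (2 * m) \<subseteq> M \<longrightarrow> k + (2 * l + q) \<le> m)) \<or>
         (\<exists>k r \<alpha>. \<alpha> \<in> D1.S 1 \<and> M = scale k (odd_module r \<alpha>) \<and>
           (\<forall>m. D1.P (2 * m) \<subseteq> M \<longrightarrow> k + r \<le> m))"
proof -
  have dM: "dmodule M" and mult: "\<And>x y. x \<in> M \<Longrightarrow> y \<in> M \<Longrightarrow> x \<otimes> y \<in> M"
    using M by (auto simp: rng_lattice_def)
  note M' = dmoduleD[OF dM]
  obtain N where N: "D1.P N \<subseteq> M" using M by (auto simp: rng_lattice_def)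
  have NM: "\<tau> [^] N \<in> M" "\<tau> [^] Suc N \<in> M"
    using N D1.pi_pow_P[of N] D1.pi_pow_P[of "Suc N"] D1.P_mono[of N "Suc N"] by auto
  have parity: "even N \<noteq> even (Suc N)" by simp
  obtain x y n n' where xy: "x \<in> M" "x \<in> D1.S n" "y \<in> M" "y \<in> D1.S n'" "n < n'" "even n \<noteq> even n'"
    and "\<And>z m. z \<in> M \<Longrightarrow> z \<in> D1.S m \<Longrightarrow> n \<le> m"
    and min: "\<And>z m. z \<in> M \<Longrightarrow> z \<in> D1.S m \<Longrightarrow> even m \<noteq> even n \<Longrightarrow> n' \<le> m"
    and gen: "M = gen x n'" "M = gen x (n' - 1)"
      "M = {a \<otimes> x \<oplus> b \<otimes> y | a b. a \<in> D \<and> b \<in> D}"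
    by (rule dmodule_structure[OF dM NM(1) D1.pi_pow_S NM(2) D1.pi_pow_S parity]) (rule that; assumption)
  have xc: "x \<in> carrier R" using M'(5) xy by auto
  show ?thesis
  proof (cases "even n")
    case True
    define i j where "i = n div 2" and "j = n' div 2"
    have ij: "n = 2 * i" "n' = 2 * j + 1" "i \<le> j"
      using True xy(5,6) unfolding i_def j_def by (auto elim!: evenE oddE)
    have gen: "M = gen x (2 * j)" using gen(2) ij by simp
    obtain x0 where x0: "x0 \<in> D1.S 0" "x = t [^] i \<otimes> x0"
      using S_even_E[of x i 0] xy(2) ij by auto
    obtain a b where aU: "a \<in> D.U" and b: "b \<in> D" and x0_eq: "x0 = a \<oplus> b \<otimes> \<tau>"
      using unit_residue[of x0] x0(1) by (auto simp: D1.S_0)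
    have aD: "a \<in> D" by (rule D.U_V[OF aU])
    have \<tau>P: "\<tau> \<in> D1.P 1" using D1.pi_pow_P[of 1] D1.pi_carrier by simp
    \<comment> \<open>Dividing by the unit a of D brings the generator to t^i (1 + b'
      \<tau>).\<close>
    define b' where "b' = inv a \<otimes> b"
    have b': "b' \<in> D" "b = a \<otimes> b'"
      using aD b aU D.U_inv_V D.V_mult D.U_cancel[OF aU] D.V_carrier[OF D.U_inv_V[OF aU]] D.V_carrier
      by (auto simp: b'_def m_assoc[symmetric])
    note c = D.V_carrier[OF aD] D.V_carrier[OF b'(1)] D1.pi_carrier t_pow_carrier[of i] one_closed
    \<comment> \<open>After multiplication by t^i, the term b' \<tau> has to become t^q \<alpha>
      modulo \<tau>^(2j). If b' = t^p u with p <= j - i, take q = p and \<alpha> = u \<tau>.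
      Otherwise the term is negligible and can be exchanged for another negligible one, namely q = j
      - i with \<alpha> = \<tau>.\<close>
    have "\<exists>q \<alpha>. \<alpha> \<in> D1.S 1 \<and> q \<le> j - i \<and> t [^] i \<otimes> (b' \<otimes> \<tau>) \<ominus> t [^] i \<otimes> (t [^] q \<otimes> \<alpha>) \<in> D1.P (2 * j)"
    proof (cases "\<exists>p \<le> j - i. b' \<in> D.S p")
      case True
      then obtain p u where p: "p \<le> j - i" "u \<in> D.U" "b' = t [^] p \<otimes> u" by (auto elim: D.S_E)
      have "u \<otimes> \<tau> \<in> D1.S (0 + 1)" using D_U[OF p(2)] D1.pi_pow_S[of 1] D1.pi_carrier
        by (intro D1.S_mult) (auto simp: D1.S_0)
      moreover have "b' \<otimes> \<tau> = t [^] p \<otimes> (u \<otimes> \<tau>)"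
        using p D.U_carrier D1.pi_carrier t_pow_carrier by (simp add: m_assoc)
      then have "t [^] i \<otimes> (b' \<otimes> \<tau>) \<ominus> t [^] i \<otimes> (t [^] p \<otimes> (u \<otimes> \<tau>)) = \<zero>"
        using c by (metis m_closed r_right_minus_eq)
      ultimately show ?thesis using p D1.P_zero by (intro exI[of _ p] exI[of _ "u \<otimes> \<tau>"]) auto
    next
      case False
      have b'P: "b' \<in> D.P (j - i)"
      proof (cases "b' = \<zero>")
        case nz: False
        then obtain p where p: "b' \<in> D.S p" using D.S_ex b' by auto
        then have "j - i \<le> p" using False nat_le_linear by blast
        then show ?thesis using D.S_P[OF p] D.P_mono by auto
      qed (simp add: D.P_zero)
      have P: "t [^] i \<otimes> (d \<otimes> \<tau>) \<in> D1.P (2 * j)" if "d \<in> D.P (j - i)" for d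
      proof -
        have "t [^] i \<otimes> (d \<otimes> \<tau>) \<in> D1.P (2 * i + (2 * (j - i) + 1))"
          by (intro t_pow_P D_P_smult that \<tau>P)
        then show ?thesis using ij D1.P_mono[of "2 * j" "2 * i + (2 * (j - i) + 1)"] by auto
      qed
      have "\<tau> \<in> D1.S 1" using D1.pi_pow_S[of 1] D1.pi_carrier by simp
      then show ?thesis using D1.P_minus[OF P[OF b'P] P[OF D.pi_pow_P]] by blast
    qed
    then obtain q \<alpha> where q: "\<alpha> \<in> D1.S 1" "q \<le> j - i"
      "t [^] i \<otimes> (b' \<otimes> \<tau>) \<ominus> t [^] i \<otimes> (t [^] q \<otimes> \<alpha>) \<in> D1.P (2 * j)" by auto
    define x2 where "x2 = t [^] i \<otimes> (\<one> \<oplus> t [^] q \<otimes> \<alpha>)"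
    have x2D: "x2 \<in> D1" using D1.S_V[OF even_generator_S[OF q(1)]] by (simp add: x2_def)
    let ?p = "a \<otimes> (t [^] i \<otimes> (b' \<otimes> \<tau>) \<ominus> t [^] i \<otimes> (t [^] q \<otimes> \<alpha>))"
    have "x = a \<otimes> x2 \<oplus> ?p" unfolding x0 x0_eq b'(2) x2_def
      using c t_pow_carrier[of q] D1.S_carrier[OF q(1)] by algebra
    moreover have "?p \<in> D1.P (2 * j)" by (rule D1.P_smult[OF D_in_D1[OF aD] q(3)])
    ultimately have M2: "M = gen x2 (2 * j)" using gen gen_cong[OF x2D aU] by simp
    then have x2M: "x2 \<in> M" using gen_self[OF x2D] by simp
    have "x2 \<otimes> x2 \<ominus> t [^] i \<otimes> x2 \<in> M"
      using dmodule_minus[OF dM mult[OF x2M x2M] M'(4)[OF D.pi_pow_V x2M]] .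
    from min[OF this even_generator_square[OF q(1) x2_def]] have "j \<le> 2 * i + q"
      using ij True by simp
    \<comment> \<open>The bounds q <= j - i and j <= 2 i + q make both subtractions exact on
      \<open>nat\<close>.\<close>
    define l k where "l = j - i - q" and "k = 2 * i + q - j"
    have lk: "k + l = i" "k + (2 * l + q) = j" "2 * k + 2 * (2 * l + q) = 2 * j"
      using \<open>j \<le> 2 * i + q\<close> q(2) ij unfolding l_def k_def by auto
    have c2: "\<one> \<oplus> t [^] q \<otimes> \<alpha> \<in> carrier R" using D1.U_carrier[OF unit_perturb[OF q(1)]] .
    have x2': "t [^] k \<otimes> (t [^] l \<otimes> (\<one> \<oplus> t [^] q \<otimes> \<alpha>)) = x2"
      unfolding x2_def lk(1)[symmetric] using c2 t_carrier by (simp add: nat_pow_mult[symmetric] m_assoc)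
    have "M = scale k (even_module l q \<alpha>)"
      unfolding even_module_def
      by (subst scale_gen) (use c2 t_pow_carrier[of l] in simp, simp only: lk(3) x2' M2)
    moreover have "k + (2 * l + q) \<le> m" if "D1.P (2 * m) \<subseteq> M" for m
    proof -
      have "\<tau> [^] (2 * m + 1) \<in> M" using that D1.pi_pow_P[of "2 * m + 1"] D1.P_mono[of "2 * m" "2 * m + 1"] by auto
      from min[OF this D1.pi_pow_S] show ?thesis using True lk ij by simp
    qed
    ultimately show ?thesis using q(1) by blast
  next
    case False
    define i j where "i = n div 2" and "j = n' div 2"
    have ij: "n = 2 * i + 1" "n' = 2 * j" "i < j"
      using False xy(5,6) unfolding i_def j_def by (auto elim!: evenE oddE)
    obtain \<alpha> where \<alpha>: "\<alpha> \<in> D1.S 1" "x = t [^] i \<otimes> \<alpha>"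
      using S_even_E[of x i 1] xy(2) ij by auto
    have "x \<otimes> x \<in> D1.S (n + n)" by (intro D1.S_mult xy)
    from min[OF mult[OF xy(1) xy(1)] this] have "j \<le> 2 * i + 1" using ij by simp
    \<comment> \<open>The solution of k + r = i and k + 2 r + 1 = j; i < j and the bound from x^2
      make the subtractions exact on \<open>nat\<close>.\<close>
    define r k where "r = j - i - 1" and "k = 2 * i + 1 - j"
    have rk: "k + r = i" "2 * k + 2 * (2 * r + 1) = 2 * j"
      using \<open>j \<le> 2 * i + 1\<close> ij unfolding r_def k_def by auto
    have x': "t [^] k \<otimes> (t [^] r \<otimes> \<alpha>) = x"
      unfolding \<alpha>(2) rk(1)[symmetric] using D1.S_carrier[OF \<alpha>(1)] t_carrier
      by (simp add: nat_pow_mult[symmetric] m_assoc)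
    have "M = scale k (odd_module r \<alpha>)"
      unfolding odd_module_def
      by (subst scale_gen)
        (use D1.S_carrier[OF \<alpha>(1)] t_pow_carrier[of r] in simp, simp only: rk(2) x' ij(2)[symmetric] gen(1)[symmetric])
    moreover have "k + r \<le> m" if "D1.P (2 * m) \<subseteq> M" for m
    proof -
      have "\<tau> [^] (2 * m) \<in> M" using that D1.pi_pow_P[of "2 * m"] by auto
      from min[OF this D1.pi_pow_S] show ?thesis using False rk ij by simp
    qed
    ultimately show ?thesis using \<alpha>(1) by blast
  qed
qed

section \<open>The modules of the two families as rings\<close>

text \<open>As \<tau>^j D1 is an ideal of D1, all terms in a product of two elements fall into it,
  except the multiple of x^2.\<close>

lemma rng_lattice_gen:
  assumes x: "x \<in> D1" and xx: "x \<otimes> x \<in> gen x j"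
  shows "rng_lattice (gen x j)"
proof -
  have d: "dmodule (gen x j)" by (rule dmodule_gen[OF x])
  note xc = D1.V_carrier[OF x]
  have "u \<otimes> v \<in> gen x j" if uv: "u \<in> gen x j" "v \<in> gen x j" for u v
  proof -
    obtain a p b p' where ab: "a \<in> D" "p \<in> D1.P j" "u = a \<otimes> x \<oplus> p" "b \<in> D" "p' \<in> D1.P j" "v = b \<otimes> x \<oplus> p'"
      using uv by (auto simp: gen_def)
    note c = xc D.V_carrier[OF ab(1)] D.V_carrier[OF ab(4)] D1.P_carrier[OF ab(2)] D1.P_carrier[OF ab(5)]
    have "u \<otimes> v = (a \<otimes> b) \<otimes> (x \<otimes> x) \<oplus> ((a \<otimes> x) \<otimes> p' \<oplus> ((b \<otimes> x) \<otimes> p \<oplus> p \<otimes> p'))"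
      unfolding ab using c by algebra
    moreover have "(a \<otimes> x) \<otimes> p' \<oplus> ((b \<otimes> x) \<otimes> p \<oplus> p \<otimes> p') \<in> D1.P j"
      by (intro D1.P_add D1.P_smult D1.V_mult D_in_D1[OF ab(1)] D_in_D1[OF ab(4)] D1.P_V[OF ab(2)] x ab(2,5))
    moreover have "(a \<otimes> b) \<otimes> (x \<otimes> x) \<in> gen x j" using ab xx dmoduleD(4)[OF d] D.V_mult by simp
    ultimately show ?thesis using dmoduleD(3)[OF d] P_subset_gen[OF x, of j] by auto
  qed
  then show ?thesis using d P_subset_gen[OF x] unfolding rng_lattice_def by blast
qed

text \<open>The elements t^(l+q) x and x^2 - t^l x have the consecutive valuations 4 l + 2 q and 4 l
  + 2 q + 1, so they form a basis of the ideal part \<tau>^(4l+2q) D1. Hence x and x^2 generate the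
  module over D.\<close>

lemma even_module_plane:
  fixes l q :: nat
  assumes \<alpha>: "\<alpha> \<in> D1.S 1" and x: "x = t [^] l \<otimes> (\<one> \<oplus> t [^] q \<otimes> \<alpha>)"
  shows "rng_lattice (even_module l q \<alpha>)" "x \<in> even_module l q \<alpha>" "x \<in> D1.S (2 * l)" "even_module l q \<alpha> \<subseteq> D1.P (2 * l)"
    "z \<in> even_module l q \<alpha> \<Longrightarrow> \<exists>a b. a \<in> D \<and> b \<in> D \<and> z = a \<otimes> x \<oplus> b \<otimes> (x \<otimes> x)"
proof -
  let ?j = "2 * (2 * l + q)"
  have M: "even_module l q \<alpha> = gen x ?j" by (simp add: even_module_def x)
  show xS: "x \<in> D1.S (2 * l)" unfolding x by (rule even_generator_S[OF \<alpha>])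
  have xD: "x \<in> D1" by (rule D1.S_V[OF xS])
  note xc = D1.V_carrier[OF xD]
  let ?y = "x \<otimes> x \<ominus> t [^] l \<otimes> x"
  have y: "?y \<in> D1.S (Suc ?j)" using even_generator_square[OF \<alpha>, of x l q] by (simp add: x)
  have tc: "t [^] l \<in> carrier R" by (rule t_pow_carrier)
  have "x \<otimes> x = t [^] l \<otimes> x \<oplus> ?y" using xc tc by algebra
  moreover have "?y \<in> D1.P ?j" using D1.S_P[OF y] D1.P_mono[of ?j "Suc ?j"] by simp
  ultimately have "x \<otimes> x \<in> gen x ?j" using gen_I[OF D.pi_pow_V] by metis
  then show "rng_lattice (even_module l q \<alpha>)" unfolding M by (rule rng_lattice_gen[OF xD])
  show "x \<in> even_module l q \<alpha>" unfolding M by (rule gen_self[OF xD])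
  have PM: "p \<in> D1.P (2 * l)" if "p \<in> D1.P ?j" for p using that D1.P_mono[of "2 * l" ?j] by simp
  show "even_module l q \<alpha> \<subseteq> D1.P (2 * l)"
    unfolding M gen_def using PM D1.P_add D1.P_smult[OF D_in_D1] D1.S_P[OF xS] by auto
  show "\<exists>a b. a \<in> D \<and> b \<in> D \<and> z = a \<otimes> x \<oplus> b \<otimes> (x \<otimes> x)" if z: "z \<in> even_module l q \<alpha>"
  proof -
    obtain d p where d: "d \<in> D" "p \<in> D1.P ?j" "z = d \<otimes> x \<oplus> p" using z by (auto simp: M gen_def)
    have "t [^] (l + q) \<otimes> x \<in> D1.S (2 * (l + q) + 2 * l)" by (intro D1.S_mult t_pow_S xS)
    then have x': "t [^] (l + q) \<otimes> x \<in> D1.S ?j" by (simp add: algebra_simps)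
    obtain a b where ab: "a \<in> D" "b \<in> D" "p = a \<otimes> (t [^] (l + q) \<otimes> x) \<oplus> b \<otimes> ?y"
      using basis[OF x' y d(2)] by auto
    have "z = (d \<oplus> a \<otimes> t [^] (l + q) \<ominus> b \<otimes> t [^] l) \<otimes> x \<oplus> b \<otimes> (x \<otimes> x)"
      unfolding d(3) ab(3) using xc tc t_pow_carrier[of "l + q"] D.V_carrier[OF ab(1)] D.V_carrier[OF ab(2)] D.V_carrier[OF d(1)]
      by algebra
    moreover have "d \<oplus> a \<otimes> t [^] (l + q) \<ominus> b \<otimes> t [^] l \<in> D"
      using d ab by (intro D.V_minus D.V_add D.V_mult D.pi_pow_V)
    ultimately show ?thesis using ab by blast
  qed
qed

text \<open>Here the ideal part \<tau>^(4r+2) D1 has the basis x^2, t^(r+1) x, of valuations 4 r + 2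
  and 4 r + 3.\<close>

lemma odd_module_plane:
  fixes r :: nat
  assumes \<alpha>: "\<alpha> \<in> D1.S 1" and x: "x = t [^] r \<otimes> \<alpha>"
  shows "rng_lattice (odd_module r \<alpha>)" "x \<in> odd_module r \<alpha>" "x \<in> D1.S (2 * r + 1)" "odd_module r \<alpha> \<subseteq> D1.P (2 * r + 1)"
    "z \<in> odd_module r \<alpha> \<Longrightarrow> \<exists>a b. a \<in> D \<and> b \<in> D \<and> z = a \<otimes> x \<oplus> b \<otimes> (x \<otimes> x)"
proof -
  let ?j = "2 * (2 * r + 1)"
  have M: "odd_module r \<alpha> = gen x ?j" by (simp add: odd_module_def x)
  show xS: "x \<in> D1.S (2 * r + 1)" unfolding x by (rule odd_generator_S[OF \<alpha>])
  have xD: "x \<in> D1" by (rule D1.S_V[OF xS])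
  note xc = D1.V_carrier[OF xD]
  have xx: "x \<otimes> x \<in> D1.S ?j" using D1.S_mult[OF xS xS] by (simp add: algebra_simps)
  then have "x \<otimes> x \<in> gen x ?j" using P_subset_gen[OF xD] D1.S_P by auto
  then show "rng_lattice (odd_module r \<alpha>)" unfolding M by (rule rng_lattice_gen[OF xD])
  show "x \<in> odd_module r \<alpha>" unfolding M by (rule gen_self[OF xD])
  have PM: "p \<in> D1.P (2 * r + 1)" if "p \<in> D1.P ?j" for p using that D1.P_mono[of "2 * r + 1" ?j] by simp
  show "odd_module r \<alpha> \<subseteq> D1.P (2 * r + 1)"
    unfolding M gen_def using PM D1.P_add D1.P_smult[OF D_in_D1] D1.S_P[OF xS] by auto
  show "\<exists>a b. a \<in> D \<and> b \<in> D \<and> z = a \<otimes> x \<oplus> b \<otimes> (x \<otimes> x)" if z: "z \<in> odd_module r \<alpha>"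
  proof -
    obtain d p where d: "d \<in> D" "p \<in> D1.P ?j" "z = d \<otimes> x \<oplus> p" using z by (auto simp: M gen_def)
    have "t [^] (r + 1) \<otimes> x \<in> D1.S (2 * (r + 1) + (2 * r + 1))" by (intro D1.S_mult t_pow_S xS)
    then have x': "t [^] (r + 1) \<otimes> x \<in> D1.S (Suc ?j)" by (simp add: algebra_simps)
    obtain b a where ab: "b \<in> D" "a \<in> D" "p = b \<otimes> (x \<otimes> x) \<oplus> a \<otimes> (t [^] (r + 1) \<otimes> x)"
      using basis[OF xx x' d(2)] by auto
    have "z = (d \<oplus> a \<otimes> t [^] (r + 1)) \<otimes> x \<oplus> b \<otimes> (x \<otimes> x)"
      unfolding d(3) ab(3) using xc t_pow_carrier[of "r + 1"] D.V_carrier[OF ab(1)] D.V_carrier[OF ab(2)] D.V_carrier[OF d(1)]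
      by algebra
    moreover have "d \<oplus> a \<otimes> t [^] (r + 1) \<in> D"
      using d ab by (intro D.V_add D.V_mult D.pi_pow_V)
    ultimately show ?thesis using ab by blast
  qed
qed

end

section \<open>Cubic rings\<close>

lemma set_add_I: "a \<in> A \<Longrightarrow> b \<in> B \<Longrightarrow> a \<oplus>\<^bsub>R\<^esub> b \<in> A <+>\<^bsub>R\<^esub> B"
  by (auto simp: set_add_def')

lemma l_coset_I: "b \<in> B \<Longrightarrow> a \<otimes>\<^bsub>R\<^esub> b \<in> a <#\<^bsub>R\<^esub> B"
  by (auto simp: l_coset_def)

text \<open>\<open>K\<close> is the second factor of L. That it is the fraction field of D is
  recorded in the form in which it is applied: powers of t clear the denominators of its
  elements.\<close>

locale two_branch_algebra = two_branch +
  fixes K :: "'a set"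
  assumes K: "subring K R" "D \<subseteq> K" "y \<in> K \<Longrightarrow> \<exists>n. t [^] (n::nat) \<otimes> y \<in> D"
begin

abbreviation L where "L \<equiv> RDirProd R (R\<lparr>carrier := K\<rparr>)"
abbreviation DL where "DL \<equiv> {(d, d) | d. d \<in> D}"
abbreviation tL where "tL \<equiv> (t, t)"

lemma L_simps [simp]:
  "carrier L = carrier R \<times> K"
  "p \<otimes>\<^bsub>L\<^esub> q = (fst p \<otimes> fst q, snd p \<otimes> snd q)"
  "p \<oplus>\<^bsub>L\<^esub> q = (fst p \<oplus> fst q, snd p \<oplus> snd q)"
  "\<zero>\<^bsub>L\<^esub> = (\<zero>, \<zero>)" "\<one>\<^bsub>L\<^esub> = (\<one>, \<one>)"
  by (cases p; cases q; simp add: RDirProd_def DirProd_def monoid.defs)+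

lemma L_ring: "ring L"
  by (rule RDirProd_ring[OF ring_axioms subring_is_ring[OF K(1)]])

lemma K_carrier: "y \<in> K \<Longrightarrow> y \<in> carrier R" using subringE(1)[OF K(1)] by auto
lemma D_K: "y \<in> D \<Longrightarrow> y \<in> K" using K(2) by auto

sublocale L: cring L
proof (rule cringI)
  show "abelian_group L" using L_ring by (rule ring.is_abelian_group)
  show "comm_monoid L"
    using monoid.monoid_comm_monoidI[OF ring.is_monoid[OF L_ring]] K_carrier m_comm by fastforce
  show "(x \<oplus>\<^bsub>L\<^esub> y) \<otimes>\<^bsub>L\<^esub> z = x \<otimes>\<^bsub>L\<^esub> z \<oplus>\<^bsub>L\<^esub> y \<otimes>\<^bsub>L\<^esub> z"
    if "x \<in> carrier L" "y \<in> carrier L" "z \<in> carrier L" for x y z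
    using ring.ring_simprules(13)[OF L_ring that] .
qed

lemma L_neg: "x \<in> carrier R \<Longrightarrow> y \<in> K \<Longrightarrow> \<ominus>\<^bsub>L\<^esub> (x, y) = (\<ominus> x, \<ominus> y)"
  using K_carrier subringE(5)[OF K(1)] by (intro L.minus_equality) (auto simp: l_neg)

lemma tL_pow: "tL [^]\<^bsub>L\<^esub> (n::nat) = (t [^] n, t [^] n)"
  by (induction n) auto

text \<open>The ring D + M, with D on the diagonal and \<open>M\<close> inside the first factor; the
  second coordinate of an element is its D-part.\<close>

definition ext where "ext M = {(d \<oplus> m, d) | d m. d \<in> D \<and> m \<in> M}"

lemma ext_iff: assumes "M \<subseteq> carrier R"
  shows "(x, y) \<in> ext M \<longleftrightarrow> x \<in> carrier R \<and> y \<in> D \<and> x \<ominus> y \<in> M"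
proof
  assume "(x, y) \<in> ext M"
  then obtain m where m: "y \<in> D" "m \<in> M" "x = y \<oplus> m" by (auto simp: ext_def)
  have "y \<oplus> m \<ominus> y = m" using m assms D.V_carrier[OF m(1)] by (subst a_comm) (auto simp: minus_eq a_assoc r_neg)
  then show "x \<in> carrier R \<and> y \<in> D \<and> x \<ominus> y \<in> M" using m assms D.V_carrier by auto
next
  assume a: "x \<in> carrier R \<and> y \<in> D \<and> x \<ominus> y \<in> M"
  then have "x = y \<oplus> (x \<ominus> y)" using add_minus_cancel(1)[of y x] D.V_carrier by simp
  then show "(x, y) \<in> ext M" using a unfolding ext_def by blast
qed

lemma ext_I: "d \<in> D \<Longrightarrow> m \<in> M \<Longrightarrow> (d \<oplus> m, d) \<in> ext M" by (auto simp: ext_def)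
lemma ext_E: "p \<in> ext M \<Longrightarrow> (\<And>d m. d \<in> D \<Longrightarrow> m \<in> M \<Longrightarrow> p = (d \<oplus> m, d) \<Longrightarrow> thesis) \<Longrightarrow> thesis"
  by (auto simp: ext_def)

lemma rng_latticeD:
  assumes "rng_lattice M"
  shows "dmodule M" "x \<in> M \<Longrightarrow> y \<in> M \<Longrightarrow> x \<otimes> y \<in> M" "\<exists>N. D1.P N \<subseteq> M" "M \<subseteq> carrier R"
  using assms dmoduleD(5)[of M] by (auto simp: rng_lattice_def)

lemma subring_ext: assumes M: "rng_lattice M" shows "subring (ext M) L"
proof (rule L.subringI)
  note dM = rng_latticeD(1)[OF M] note M' = dmoduleD[OF dM]
  show "ext M \<subseteq> carrier L" using D.V_carrier M'(5) D_K by (auto simp: ext_def)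
  show "\<one>\<^bsub>L\<^esub> \<in> ext M" using ext_I[OF D.V_one M'(2)] by simp
  show "\<ominus>\<^bsub>L\<^esub> h \<in> ext M" if "h \<in> ext M" for h
    using that
  proof (rule ext_E)
    fix d m assume d: "d \<in> D" "m \<in> M" "h = (d \<oplus> m, d)"
    then have "\<ominus>\<^bsub>L\<^esub> h = (\<ominus> d \<oplus> \<ominus> m, \<ominus> d)"
      using D.V_carrier M'(5) D_K by (simp add: L_neg minus_add)
    then show ?thesis using d ext_I D.V_neg dmodule_neg[OF dM] by simp
  qed
  fix h h' assume "h \<in> ext M" "h' \<in> ext M"
  then obtain d m d' m' where d: "d \<in> D" "m \<in> M" "h = (d \<oplus> m, d)" "d' \<in> D" "m' \<in> M" "h' = (d' \<oplus> m', d')"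
    by (auto elim!: ext_E)
  note c = D.V_carrier[OF d(1)] D.V_carrier[OF d(4)] M'(5)[OF d(2)] M'(5)[OF d(5)]
  have "(d \<oplus> m) \<oplus> (d' \<oplus> m') = (d \<oplus> d') \<oplus> (m \<oplus> m')" using c by algebra
  then show "h \<oplus>\<^bsub>L\<^esub> h' \<in> ext M" using d ext_I D.V_add M'(3) by simp
  have "d \<otimes> m' \<oplus> d' \<otimes> m \<oplus> m \<otimes> m' \<in> M" using d M'(3,4) rng_latticeD(2)[OF M] by simp
  moreover have "(d \<oplus> m) \<otimes> (d' \<oplus> m') = d \<otimes> d' \<oplus> (d \<otimes> m' \<oplus> d' \<otimes> m \<oplus> m \<otimes> m')" using c by algebra
  ultimately show "h \<otimes>\<^bsub>L\<^esub> h' \<in> ext M" using d ext_I D.V_mult by simp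
qed

lemma rng_lattice_opposite_parity:
  assumes M: "rng_lattice M"
  obtains x y n n' where "x \<in> M" "x \<in> D1.S n" "y \<in> M" "y \<in> D1.S n'" "even n \<noteq> even n'"
    "M = {a \<otimes> x \<oplus> b \<otimes> y | a b. a \<in> D \<and> b \<in> D}"
proof -
  obtain N where N: "D1.P N \<subseteq> M" using rng_latticeD(3)[OF M] by auto
  have NM: "\<tau> [^] N \<in> M" "\<tau> [^] Suc N \<in> M"
    using N D1.pi_pow_P[of N] D1.pi_pow_P[of "Suc N"] D1.P_mono[of N "Suc N"] by auto
  have parity: "even N \<noteq> even (Suc N)" by simp
  show thesis
    by (rule dmodule_structure[OF rng_latticeD(1)[OF M] NM(1) D1.pi_pow_S NM(2) D1.pi_pow_S parity])
      (rule that; assumption)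
qed

lemma DL_list_3:
  assumes "length ds = 3" "set ds \<subseteq> DL"
  obtains a b c where "a \<in> D" "b \<in> D" "c \<in> D" "ds = [(a, a), (b, b), (c, c)]"
  using assms by (auto simp: length_Suc_conv numeral_3_eq_3)

text \<open>A basis over the diagonal is (1, 1), (x, 0), (y, 0), where x and y have valuations of
  different parity; the parity gives uniqueness of the coefficients.\<close>

lemma cubic_ring_ext: assumes M: "rng_lattice M" shows "cubic_ring L DL (ext M)"
proof -
  note dM = rng_latticeD(1)[OF M] note M' = dmoduleD[OF dM]
  have "DL \<subseteq> ext M" using ext_I[OF _ M'(2)] D.V_carrier by force
  moreover obtain x y n n' where xy: "x \<in> M" "x \<in> D1.S n" "y \<in> M" "y \<in> D1.S n'" "even n \<noteq> even n'"
    "M = {a \<otimes> x \<oplus> b \<otimes> y | a b. a \<in> D \<and> b \<in> D}"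
    by (rule rng_lattice_opposite_parity[OF M])
  note c = M'(5)[OF xy(1)] M'(5)[OF xy(3)]
  let ?us = "[(\<one>, \<one>), (x, \<zero>), (y, \<zero>)]"
  let ?ds = "{ds. length ds = 3 \<and> set ds \<subseteq> DL}"
  have comb: "L.combine [(d, d), (a, a), (b, b)] ?us = (d \<oplus> (a \<otimes> x \<oplus> b \<otimes> y), d)"
    if "a \<in> D" "b \<in> D" "d \<in> D" for a b d
    using that D.V_carrier c by simp
  have "bij_betw (\<lambda>ds. L.combine ds ?us) ?ds (ext M)"
  proof (rule bij_betw_imageI)
    show "inj_on (\<lambda>ds. L.combine ds ?us) ?ds"
    proof (rule inj_onI)
      fix ds ds' assume ds: "ds \<in> ?ds" "ds' \<in> ?ds" and eq: "L.combine ds ?us = L.combine ds' ?us"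
      from ds obtain d a b where 1: "d \<in> D" "a \<in> D" "b \<in> D" "ds = [(d, d), (a, a), (b, b)]"
        using DL_list_3[of ds] by blast
      from ds obtain d' a' b' where 2: "d' \<in> D" "a' \<in> D" "b' \<in> D" "ds' = [(d', d'), (a', a'), (b', b')]"
        using DL_list_3[of ds'] by blast
      have p: "(d \<oplus> (a \<otimes> x \<oplus> b \<otimes> y), d) = (d' \<oplus> (a' \<otimes> x \<oplus> b' \<otimes> y), d')"
        using eq unfolding 1(4) 2(4) comb[OF 1(2,3,1)] comb[OF 2(2,3,1)] .
      note e = conjunct1[OF iffD1[OF prod.inject p]] conjunct2[OF iffD1[OF prod.inject p]]
      have "a \<otimes> x \<oplus> b \<otimes> y \<in> carrier R" "a' \<otimes> x \<oplus> b' \<otimes> y \<in> carrier R"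
        using 1(2,3) 2(2,3) D.V_carrier c by auto
      then have "a \<otimes> x \<oplus> b \<otimes> y = a' \<otimes> x \<oplus> b' \<otimes> y"
        using e(1) D.V_carrier[OF 2(1)] unfolding e(2) by (metis add.l_cancel)
      then have "a = a'" "b = b'" using unique_parity[OF xy(2,4,5)] 1 2 by auto
      then show "ds = ds'" using e 1 2 by simp
    qed
    show "(\<lambda>ds. L.combine ds ?us) ` ?ds = ext M"
    proof
      show "(\<lambda>ds. L.combine ds ?us) ` ?ds \<subseteq> ext M"
      proof
        fix p assume "p \<in> (\<lambda>ds. L.combine ds ?us) ` ?ds"
        then obtain ds where ds: "ds \<in> ?ds" "p = L.combine ds ?us" by auto
        then obtain d a b where 1: "d \<in> D" "a \<in> D" "b \<in> D" "ds = [(d, d), (a, a), (b, b)]"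
          using DL_list_3[of ds] by blast
        have "a \<otimes> x \<oplus> b \<otimes> y \<in> M" using xy(6) 1 by blast
        then show "p \<in> ext M" unfolding ds(2) 1(4) comb[OF 1(2,3,1)] by (rule ext_I[OF 1(1)])
      qed
      show "ext M \<subseteq> (\<lambda>ds. L.combine ds ?us) ` ?ds"
      proof
        fix p assume "p \<in> ext M"
        then obtain d m where d: "d \<in> D" "m \<in> M" "p = (d \<oplus> m, d)" by (rule ext_E)
        then obtain a b where ab: "a \<in> D" "b \<in> D" "m = a \<otimes> x \<oplus> b \<otimes> y" using xy(6) by auto
        have "p = L.combine [(d, d), (a, a), (b, b)] ?us" using comb d ab by simp
        moreover have "[(d, d), (a, a), (b, b)] \<in> ?ds" using d ab by auto
        ultimately show "p \<in> (\<lambda>ds. L.combine ds ?us) ` ?ds" by blast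
      qed
    qed
  qed
  moreover have "set ?us \<subseteq> carrier L" using c D_K D.V_closed by auto
  ultimately show ?thesis using subring_ext[OF M] unfolding cubic_ring_def free_of_rank_def
    by (intro conjI exI[of _ ?us]) auto
qed

section \<open>Cubic rings lie in A and have the form D + M\<close>

text \<open>The elements 1, \<tau> and \<open>fst u\<close> are dependent over D, with nonzero
  coefficient at \<open>fst u\<close> because 1 and \<tau> are independent by parity. This
  coefficient is a power of t times a unit and serves as a denominator. The second component is a
  fraction of elements of D.\<close>

lemma denominators_list:
  "set us \<subseteq> carrier L \<Longrightarrow> \<exists>N. \<forall>u\<in>set us. t [^] (N::nat) \<otimes> fst u \<in> D1 \<and> t [^] N \<otimes> snd u \<in> D"
proof (induction us)
  case (Cons u us)
  then obtain N where N: "\<forall>u\<in>set us. t [^] (N::nat) \<otimes> fst u \<in> D1 \<and> t [^] N \<otimes> snd u \<in> D" by auto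
  have u: "fst u \<in> carrier R" "snd u \<in> K" using Cons.prems by auto
  obtain n1 where n1: "t [^] (n1::nat) \<otimes> fst u \<in> D1"
  proof -
    obtain a b c where abc: "a \<in> D" "b \<in> D" "c \<in> D" "a \<noteq> \<zero> \<or> b \<noteq> \<zero> \<or> c \<noteq> \<zero>"
      "a \<otimes> \<one> \<oplus> b \<otimes> \<tau> \<oplus> c \<otimes> fst u = \<zero>" using dependent[of \<one> \<tau> "fst u"] u D1.pi_carrier by blast
    note cc = abc(1-3)[THEN D.V_carrier] D1.pi_carrier u(1)
    have "c \<noteq> \<zero>"
    proof
      assume c0: "c = \<zero>"
      have "a \<otimes> \<one> \<oplus> b \<otimes> \<tau> = \<zero>" using abc(5) cc unfolding c0 by simp
      moreover have "\<one> \<in> D1.S 0" "\<tau> \<in> D1.S 1" using D1.pi_pow_S[of 1] D1.pi_pow_S[of 0] D1.pi_carrier by auto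
      ultimately have "a = \<zero> \<and> b = \<zero>" using abc by (intro independent_parity[of \<one> 0 \<tau> 1]) auto
      then show False using abc c0 by simp
    qed
    then obtain n where "c \<in> D.S n" using D.S_ex abc by auto
    then obtain w where w: "w \<in> D.U" "c = t [^] n \<otimes> w" by (auto elim: D.S_E)
    note wc = D.U_carrier[OF w(1)] D.V_carrier[OF D.U_inv_V[OF w(1)]] t_pow_carrier[of n]
    have "c \<otimes> fst u = \<ominus> (a \<otimes> \<one> \<oplus> b \<otimes> \<tau>)"
      using minus_equality[of "c \<otimes> fst u" "a \<otimes> \<one> \<oplus> b \<otimes> \<tau>"] abc(5) cc by (simp add: a_comm)
    also have "\<dots> \<in> D1" using abc(1,2) D_in_D1 D1.V_closed D1.pi by simp
    finally have "inv w \<otimes> (c \<otimes> fst u) \<in> D1" using D_in_D1[OF D.U_inv_V[OF w(1)]] D1.V_mult by blast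
    moreover have "inv w \<otimes> (c \<otimes> fst u) = (inv w \<otimes> w) \<otimes> (t [^] n \<otimes> fst u)"
      unfolding w(2) using wc u(1) by (simp add: m_ac)
    ultimately show thesis using that[of n] D.U_cancel[OF w(1)] wc u(1) by simp
  qed
  obtain n2 where n2: "t [^] (n2::nat) \<otimes> snd u \<in> D" using K(3) u by auto
  let ?N = "N + n1 + n2"
  have mono: "t [^] n \<otimes> z \<in> D1 \<Longrightarrow> n \<le> n' \<Longrightarrow> t [^] n' \<otimes> z \<in> D1"
    and mono': "t [^] n \<otimes> z \<in> D \<Longrightarrow> n \<le> n' \<Longrightarrow> t [^] n' \<otimes> z \<in> D" if z: "z \<in> carrier R" for n n' :: nat and z
  proof -
    assume "n \<le> n'"
    then have e: "t [^] n' \<otimes> z = t [^] (n' - n) \<otimes> (t [^] n \<otimes> z)"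
      using z t_carrier by (simp add: m_assoc[symmetric] nat_pow_mult)
    show "t [^] n \<otimes> z \<in> D1 \<Longrightarrow> t [^] n' \<otimes> z \<in> D1" unfolding e
      by (rule D1.V_mult[OF D_in_D1[OF D.pi_pow_V]])
    show "t [^] n \<otimes> z \<in> D \<Longrightarrow> t [^] n' \<otimes> z \<in> D" unfolding e
      by (rule D.V_mult[OF D.pi_pow_V])
  qed
  have "t [^] ?N \<otimes> fst v \<in> D1 \<and> t [^] ?N \<otimes> snd v \<in> D" if v: "v \<in> set (u # us)" for v
  proof -
    have vc: "fst v \<in> carrier R" "snd v \<in> carrier R" using v Cons.prems K_carrier by auto
    show ?thesis
    proof (cases "v = u")
      case True
      then show ?thesis using mono[OF vc(1), of n1 ?N] mono'[OF vc(2), of n2 ?N] n1 n2 by auto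
    next
      case False
      then show ?thesis using mono[OF vc(1), of N ?N] mono'[OF vc(2), of N ?N] N v by auto
    qed
  qed
  then show ?case by blast
qed auto

lemma combine_denominators:
  "set us \<subseteq> carrier L \<Longrightarrow> \<forall>u\<in>set us. t [^] (N::nat) \<otimes> fst u \<in> D1 \<and> t [^] N \<otimes> snd u \<in> D \<Longrightarrow> set ds \<subseteq> DL \<Longrightarrow>
    t [^] N \<otimes> fst (L.combine ds us) \<in> D1 \<and> t [^] N \<otimes> snd (L.combine ds us) \<in> D"
proof (induction ds us rule: L.combine.induct)
  case (1 k Ks u Us)
  then obtain d where d: "d \<in> D" "k = (d, d)" by auto
  have IH: "t [^] N \<otimes> fst (L.combine Ks Us) \<in> D1" "t [^] N \<otimes> snd (L.combine Ks Us) \<in> D"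
    using 1 by auto
  have Kc: "set Ks \<subseteq> carrier L" using 1 D.V_carrier D_K by auto
  have c: "L.combine Ks Us \<in> carrier L" using L.combine_in_carrier[OF Kc] 1 by auto
  note c' = d(1)[THEN D.V_carrier] t_pow_carrier[of N]
  have uc: "fst u \<in> carrier R" "snd u \<in> carrier R" using 1 K_carrier by auto
  have cc: "fst (L.combine Ks Us) \<in> carrier R" "snd (L.combine Ks Us) \<in> carrier R" using c K_carrier by auto
  have e: "t [^] N \<otimes> (d \<otimes> v \<oplus> w) = d \<otimes> (t [^] N \<otimes> v) \<oplus> t [^] N \<otimes> w" if "v \<in> carrier R" "w \<in> carrier R" for v w
    using that c' by (simp add: r_distr m_ac)
  show ?case
    using 1(3) d IH e[OF uc(1) cc(1)] e[OF uc(2) cc(2)]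
    by (simp add: D1.V_add D1.V_mult D_in_D1 D.V_add D.V_mult)
qed (use D1.V_zero D.V_zero t_pow_carrier in auto)

text \<open>Finitely many generators share a denominator t^N, which then serves for the whole ring
  and so for all powers of one of its elements. The criterion on bounded powers applies to each
  coordinate.\<close>

lemma cubic_ring_subset_A: assumes C: "cubic_ring L DL C" shows "C \<subseteq> D1 \<times> D"
proof
  obtain us where us: "length us = 3" "set us \<subseteq> carrier L"
    "bij_betw (\<lambda>ds. L.combine ds us) {ds. length ds = 3 \<and> set ds \<subseteq> DL} C"
    using C by (auto simp: cubic_ring_def free_of_rank_def)
  obtain N where N: "\<forall>u\<in>set us. t [^] (N::nat) \<otimes> fst u \<in> D1 \<and> t [^] N \<otimes> snd u \<in> D"
    using denominators_list[OF us(2)] by blast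
  have bounded: "t [^] N \<otimes> fst p \<in> D1 \<and> t [^] N \<otimes> snd p \<in> D" if p: "p \<in> C" for p
  proof -
    obtain ds where "set ds \<subseteq> DL" "p = L.combine ds us"
      using p bij_betw_imp_surj_on[OF us(3)] by auto
    then show ?thesis using combine_denominators[OF us(2) N] by simp
  qed
  have sub: "subring C L" using C by (simp add: cubic_ring_def)
  fix p assume p: "p \<in> C"
  obtain x y where xy: "p = (x, y)" by (cases p)
  have c: "x \<in> carrier R" "y \<in> carrier R" using p subringE(1)[OF sub] K_carrier by (auto simp: xy)
  have pow: "(x [^] (n::nat), y [^] n) \<in> C" for n
  proof (induction n)
    case 0
    then show ?case using subringE(3)[OF sub] by simp
  next
    case (Suc n)
    then show ?case using subringE(6)[OF sub Suc p] by (simp add: xy)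
  qed
  \<comment> \<open>The criterion for D1 asks for a power of its own uniformizer, so t^N is traded
    for \<tau>^(2N).\<close>
  obtain a where a: "a \<in> D1.P (2 * N - 2 * N)" "\<tau> [^] (2 * N) = a \<otimes> t [^] N"
    using D1.S_div[OF t_pow_S D1.pi_pow_P, of N "2 * N"] by auto
  have "\<tau> [^] (2 * N) \<otimes> x = a \<otimes> (t [^] N \<otimes> x)"
    using a c D1.P_carrier[OF a(1)] t_pow_carrier by (simp add: m_assoc)
  then have "\<tau> [^] (2 * N) \<otimes> x \<in> D1" using a D1.P_V bounded[OF p] xy D1.V_mult by simp
  then have "x \<in> D1"
    using bounded[OF pow] D.pi_pow_nz D_in_D1[OF D.pi_pow_V]
    by (intro D1.bounded_powers_imp_V[OF c(1), of "2 * N" "t [^] N"]) auto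
  moreover have "y \<in> D"
    using bounded[OF pow] bounded[OF p] D.pi_pow_nz D.pi_pow_V xy
    by (intro D.bounded_powers_imp_V[OF c(2), of N "t [^] N"]) auto
  ultimately show "p \<in> D1 \<times> D" by (simp add: xy)
qed

text \<open>Replacing \<open>(d + a x, d)\<close> by \<open>d + a \<tau>\<close> turns dependence of three vectors of \<open>D\<^sup>2\<close> into
  dependence in the quadratic extension.\<close>
lemma rank_two_not_cubic:
  assumes x: "x \<in> carrier R" and C: "C \<subseteq> {(d \<oplus> a \<otimes> x, d) | a d. a \<in> D \<and> d \<in> D}" "C \<subseteq> carrier L"
    and us: "set us \<subseteq> C" "length us = 3"
  shows "\<not> inj_on (\<lambda>ds. L.combine ds us) {ds. length ds = 3 \<and> set ds \<subseteq> DL}"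
proof
  assume inj: "inj_on (\<lambda>ds. L.combine ds us) {ds. length ds = 3 \<and> set ds \<subseteq> DL}"
  obtain u1 u2 u3 where u: "us = [u1, u2, u3]" using us(2) by (auto simp: length_Suc_conv numeral_3_eq_3)
  have "\<exists>a d. a \<in> D \<and> d \<in> D \<and> v = (d \<oplus> a \<otimes> x, d)" if "v \<in> set us" for v
    using that us C(1) by blast
  then have "\<forall>v \<in> set us. \<exists>a d. a \<in> D \<and> d \<in> D \<and> v = (d \<oplus> a \<otimes> x, d)" by blast
  then obtain a1 d1 a2 d2 a3 d3 where
    u123: "a1 \<in> D" "d1 \<in> D" "u1 = (d1 \<oplus> a1 \<otimes> x, d1)" "a2 \<in> D" "d2 \<in> D" "u2 = (d2 \<oplus> a2 \<otimes> x, d2)"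
      "a3 \<in> D" "d3 \<in> D" "u3 = (d3 \<oplus> a3 \<otimes> x, d3)"
    unfolding u by auto
  note c = u123(1,2,4,5,7,8)[THEN D.V_carrier] x D1.pi_carrier one_closed
  obtain c1 c2 c3 where c123: "c1 \<in> D" "c2 \<in> D" "c3 \<in> D" "c1 \<noteq> \<zero> \<or> c2 \<noteq> \<zero> \<or> c3 \<noteq> \<zero>"
    "c1 \<otimes> (d1 \<oplus> a1 \<otimes> \<tau>) \<oplus> c2 \<otimes> (d2 \<oplus> a2 \<otimes> \<tau>) \<oplus> c3 \<otimes> (d3 \<oplus> a3 \<otimes> \<tau>) = \<zero>"
    using dependent[of "d1 \<oplus> a1 \<otimes> \<tau>" "d2 \<oplus> a2 \<otimes> \<tau>" "d3 \<oplus> a3 \<otimes> \<tau>"] c by auto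
  note cc = c c123(1-3)[THEN D.V_carrier]
  let ?d = "c1 \<otimes> d1 \<oplus> c2 \<otimes> d2 \<oplus> c3 \<otimes> d3" and ?a = "c1 \<otimes> a1 \<oplus> c2 \<otimes> a2 \<oplus> c3 \<otimes> a3"
  have "?d \<otimes> \<one> \<oplus> ?a \<otimes> \<tau> = c1 \<otimes> (d1 \<oplus> a1 \<otimes> \<tau>) \<oplus> c2 \<otimes> (d2 \<oplus> a2 \<otimes> \<tau>) \<oplus> c3 \<otimes> (d3 \<oplus> a3 \<otimes> \<tau>)"
    using cc by algebra
  moreover have "\<one> \<in> D1.S 0" "\<tau> \<in> D1.S 1" using D1.pi_pow_S[of 1] D1.pi_pow_S[of 0] D1.pi_carrier by auto
  ultimately have z: "?d = \<zero>" "?a = \<zero>"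
    using c123 u123 D.V_add D.V_mult independent_parity[of \<one> 0 \<tau> 1 ?d ?a] by auto
  have "c1 \<otimes> (d1 \<oplus> a1 \<otimes> x) \<oplus> (c2 \<otimes> (d2 \<oplus> a2 \<otimes> x) \<oplus> c3 \<otimes> (d3 \<oplus> a3 \<otimes> x)) = ?d \<oplus> ?a \<otimes> x"
    using cc by algebra
  also have "\<dots> = \<zero>" using z x by simp
  finally have "L.combine [(c1, c1), (c2, c2), (c3, c3)] us = (\<zero>, \<zero>)"
    using z(1) cc by (simp add: u u123 a_assoc)
  moreover have "L.combine [(\<zero>, \<zero>), (\<zero>, \<zero>), (\<zero>, \<zero>)] us = (\<zero>, \<zero>)"
    using c by (simp add: u u123)
  ultimately have "[(c1, c1), (c2, c2), (c3, c3)] = [(\<zero>, \<zero>), (\<zero>, \<zero>), (\<zero>, \<zero>)]"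
    using c123 D.V_zero by (intro inj_onD[OF inj]) auto
  then show False using c123 by simp
qed

lemma cubic_ring_E:
  assumes C: "cubic_ring L DL C"
  obtains M where "rng_lattice M" "C = ext M"
proof -
  have sub: "subring C L" and DC: "DL \<subseteq> C" using C by (auto simp: cubic_ring_def)
  have CA: "C \<subseteq> D1 \<times> D" by (rule cubic_ring_subset_A[OF C])
  define M where "M = {x. (x, \<zero>) \<in> C}"
  have MD: "M \<subseteq> D1" using CA by (auto simp: M_def)
  have dM: "dmodule M"
    unfolding dmodule_def
  proof (intro conjI ballI)
    show "M \<subseteq> D1" by fact
    show "\<zero> \<in> M" using subringE(2)[OF sub] by (simp add: M_def)
    show "x \<oplus> y \<in> M" if "x \<in> M" "y \<in> M" for x y
      using subringE(7)[OF sub, of "(x, \<zero>)" "(y, \<zero>)"] that by (simp add: M_def)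
    show "d \<otimes> x \<in> M" if "d \<in> D" "x \<in> M" for d x
      using subringE(6)[OF sub, of "(d, d)" "(x, \<zero>)"] that DC D.V_carrier by (auto simp: M_def)
  qed
  note M' = dmoduleD[OF dM]
  have mult: "x \<otimes> y \<in> M" if "x \<in> M" "y \<in> M" for x y
    using subringE(6)[OF sub, of "(x, \<zero>)" "(y, \<zero>)"] that by (simp add: M_def)
  have CM: "C = ext M"
  proof
    show "C \<subseteq> ext M"
    proof
      fix p assume p: "p \<in> C"
      obtain x y where xy: "p = (x, y)" by (cases p)
      have d: "x \<in> D1" "y \<in> D" using p CA xy by auto
      have "(\<ominus> y, \<ominus> y) \<in> C" using DC D.V_neg[OF d(2)] by auto
      then have "p \<oplus>\<^bsub>L\<^esub> (\<ominus> y, \<ominus> y) \<in> C" using subringE(7)[OF sub p] by blast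
      then have "x \<ominus> y \<in> M" using D.V_carrier[OF d(2)] by (simp add: xy M_def minus_eq r_neg)
      moreover have "M \<subseteq> carrier R" using M'(5) by auto
      ultimately show "p \<in> ext M" using d D1.V_carrier by (simp add: xy ext_iff)
    qed
    show "ext M \<subseteq> C"
    proof
      fix p assume "p \<in> ext M"
      then obtain d m where d: "d \<in> D" "m \<in> M" "p = (d \<oplus> m, d)" by (rule ext_E)
      then have "(d, d) \<oplus>\<^bsub>L\<^esub> (m, \<zero>) \<in> C" using subringE(7)[OF sub, of "(d, d)" "(m, \<zero>)"] DC by (auto simp: M_def)
      then show "p \<in> C" using d D.V_carrier by simp
    qed
  qed
  have "\<exists>N. D1.P N \<subseteq> M"
  proof (cases "\<exists>p i p' i'. p \<in> M \<and> p \<in> D1.S i \<and> p' \<in> M \<and> p' \<in> D1.S i' \<and> even i \<noteq> even i'")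
    case True
    then obtain p i p' i' where p: "p \<in> M" "p \<in> D1.S i" "p' \<in> M" "p' \<in> D1.S i'" "even i \<noteq> even i'" by blast
    obtain x n' where x: "x \<in> M" "M = gen x n'"
      by (rule dmodule_structure[OF dM p]) (rule that; assumption)
    then show ?thesis using P_subset_gen[of x n'] MD by blast
  next
    case False
    \<comment> \<open>All nonzero elements of \<open>M\<close> now have valuations of one parity, so
      nothing remains after subtraction of a multiple of an element x of least valuation, and
      \<open>M\<close> is \<open>D x\<close> (with x zero if \<open>M\<close> is). Then
      \<open>C\<close> is spanned by two elements, against rank 3.\<close>
    have "\<exists>x \<in> M. \<forall>z \<in> M. \<exists>a \<in> D. z = a \<otimes> x"
    proof (cases "\<exists>n. \<exists>x \<in> M. x \<in> D1.S n")
      case False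
      then have "z = \<zero>" if "z \<in> M" for z using D1.S_ex MD that by blast
      then show ?thesis using M'(2) D.V_zero by (metis zero_closed l_null)
    next
      case ex: True
      define n where "n = (LEAST n. \<exists>x \<in> M. x \<in> D1.S n)"
      have "\<exists>x \<in> M. x \<in> D1.S n" unfolding n_def by (rule LeastI_ex[OF ex])
      then obtain x where x: "x \<in> M" "x \<in> D1.S n" by auto
      have min: "n \<le> m" if "z \<in> M" "z \<in> D1.S m" for z m
        unfolding n_def by (rule Least_le) (use that in auto)
      have "\<exists>a \<in> D. z = a \<otimes> x" if z: "z \<in> M" for z
      proof -
        obtain a w where w: "a \<in> D" "w \<in> M" "z = a \<otimes> x \<oplus> w" "w = \<zero> \<or> (\<exists>m. w \<in> D1.S m \<and> even m \<noteq> even n)"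
          by (rule minimal_valuation_remainder[OF dM x min z])
        have "w = \<zero>" using w(2,4) x False by blast
        then show ?thesis using w(1,3) M'(5)[OF x(1)] D.V_carrier by auto
      qed
      then show ?thesis using x by auto
    qed
    then obtain x where x: "x \<in> M" "\<And>z. z \<in> M \<Longrightarrow> \<exists>a \<in> D. z = a \<otimes> x" by auto
    have "C \<subseteq> {(d \<oplus> a \<otimes> x, d) | a d. a \<in> D \<and> d \<in> D}"
      unfolding CM using x(2) by (fastforce simp: ext_def)
    moreover obtain us where us: "length us = 3" "set us \<subseteq> carrier L"
      "bij_betw (\<lambda>ds. L.combine ds us) {ds. length ds = 3 \<and> set ds \<subseteq> DL} C"
      using C by (auto simp: cubic_ring_def free_of_rank_def)
    \<comment> \<open>\<open>free_of_rank\<close> places the basis only in \<open>carrier L\<close>;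
      the unit coefficient vectors show that it lies in \<open>C\<close>.\<close>
    moreover have "set us \<subseteq> C"
    proof -
      obtain u1 u2 u3 where u: "us = [u1, u2, u3]" using us(1) by (auto simp: length_Suc_conv numeral_3_eq_3)
      have uc: "fst u \<in> carrier R" "snd u \<in> carrier R" if "u \<in> set us" for u using us(2) K_carrier that by auto
      have CI: "L.combine [(a, a), (b, b), (d, d)] us \<in> C" if "a \<in> D" "b \<in> D" "d \<in> D" for a b d
        using bij_betw_apply[OF us(3), of "[(a, a), (b, b), (d, d)]"] that by auto
      have "u1 \<in> C" using CI[OF D.V_one D.V_zero D.V_zero] uc by (simp add: u)
      moreover have "u2 \<in> C" using CI[OF D.V_zero D.V_one D.V_zero] uc by (simp add: u)
      moreover have "u3 \<in> C" using CI[OF D.V_zero D.V_zero D.V_one] uc by (simp add: u)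
      ultimately show ?thesis by (simp add: u)
    qed
    ultimately show ?thesis
      using rank_two_not_cubic[of x C us] M'(5)[OF x(1)] subringE(1)[OF sub] by (auto simp: bij_betw_def)
  qed
  then have "rng_lattice M" using dM mult by (auto simp: rng_lattice_def)
  then show thesis using that CM by auto
qed

section \<open>The rings of the two families in the form D + M\<close>

text \<open>The diagonal part t^k d is absorbed by the summand D, so scaling acts on
  \<open>M\<close> alone.\<close>

lemma scaled_ring_ext:
  assumes M: "M \<subseteq> carrier R" shows "scaled_ring L DL tL k (ext M) = ext (scale k M)"
proof
  show "scaled_ring L DL tL k (ext M) \<subseteq> ext (scale k M)"
  proof
    fix p assume "p \<in> scaled_ring L DL tL k (ext M)"
    then obtain d m d' where d: "d \<in> D" "m \<in> M" "d' \<in> D"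
      "p = (t [^] k \<otimes> (d \<oplus> m) \<oplus> d', t [^] k \<otimes> d \<oplus> d')"
      by (auto simp: scaled_ring_def set_add_def' l_coset_def tL_pow ext_def)
    have "t [^] k \<otimes> (d \<oplus> m) \<oplus> d' = (t [^] k \<otimes> d \<oplus> d') \<oplus> t [^] k \<otimes> m"
      using d M D.V_carrier t_pow_carrier by (auto simp: r_distr a_ac subset_iff)
    then show "p \<in> ext (scale k M)"
      using d ext_I[of "t [^] k \<otimes> d \<oplus> d'" "t [^] k \<otimes> m" "scale k M"] D.V_add D.V_mult D.pi_pow_V
      by (auto simp: scale_def)
  qed
  show "ext (scale k M) \<subseteq> scaled_ring L DL tL k (ext M)"
  proof
    fix p assume "p \<in> ext (scale k M)"
    then obtain d m where d: "d \<in> D" "m \<in> M" "p = (d \<oplus> t [^] k \<otimes> m, d)"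
      by (auto simp: ext_def scale_def)
    have p: "p = (tL [^]\<^bsub>L\<^esub> k \<otimes>\<^bsub>L\<^esub> (\<zero> \<oplus> m, \<zero>)) \<oplus>\<^bsub>L\<^esub> (d, d)"
      using d M D.V_carrier t_pow_carrier by (auto simp: tL_pow a_comm subset_iff)
    show "p \<in> scaled_ring L DL tL k (ext M)"
      unfolding p scaled_ring_def by (intro set_add_I l_coset_I ext_I) (use d D.V_zero in auto)
  qed
qed

text \<open>An element of t^j A splits as t^j (z, c) = t^j (c, c) + t^j (z - c, 0); the first
  summand is diagonal and joins D.\<close>

lemma gen_ring_eq_ext:
  assumes x: "x \<in> carrier R"
  shows "(DL <+>\<^bsub>L\<^esub> ((x, \<zero>) <#\<^bsub>L\<^esub> DL)) <+>\<^bsub>L\<^esub> ((tL [^]\<^bsub>L\<^esub> j) <#\<^bsub>L\<^esub> (D1 \<times> D)) = ext (gen x (2 * j))"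
    (is "?C = _")
proof
  show "?C \<subseteq> ext (gen x (2 * j))"
  proof
    fix p assume "p \<in> ?C"
    then obtain d a z c where d: "d \<in> D" "a \<in> D" "z \<in> D1" "c \<in> D"
      "p = (d \<oplus> x \<otimes> a \<oplus> t [^] j \<otimes> z, d \<oplus> \<zero> \<otimes> a \<oplus> t [^] j \<otimes> c)"
      by (auto simp: set_add_def' l_coset_def tL_pow)
    note cc = d(1,2,4)[THEN D.V_carrier] D1.V_carrier[OF d(3)] t_pow_carrier[of j] x
    have "d \<oplus> x \<otimes> a \<oplus> t [^] j \<otimes> z = (d \<oplus> t [^] j \<otimes> c) \<oplus> (a \<otimes> x \<oplus> t [^] j \<otimes> (z \<ominus> c))"
      using cc by algebra
    moreover have "t [^] j \<otimes> (z \<ominus> c) \<in> D1.P (2 * j)"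
      using t_pow_P[of "z \<ominus> c" 0 j] d D_in_D1 D1.V_minus by (simp add: D1.P_0)
    ultimately show "p \<in> ext (gen x (2 * j))"
      using d cc ext_I[of "d \<oplus> t [^] j \<otimes> c"] gen_I D.V_add D.V_mult D.pi_pow_V by auto
  qed
  show "ext (gen x (2 * j)) \<subseteq> ?C"
  proof
    fix p assume "p \<in> ext (gen x (2 * j))"
    then obtain d a w where d: "d \<in> D" "a \<in> D" "w \<in> D1.P (2 * j)" "p = (d \<oplus> (a \<otimes> x \<oplus> w), d)"
      by (auto simp: ext_def gen_def)
    obtain z where z: "z \<in> D1" "w = t [^] j \<otimes> z" using P_even_E[of w j 0] d(3) by (auto simp: D1.P_0)
    have p: "p = ((d, d) \<oplus>\<^bsub>L\<^esub> ((x, \<zero>) \<otimes>\<^bsub>L\<^esub> (a, a))) \<oplus>\<^bsub>L\<^esub> (tL [^]\<^bsub>L\<^esub> j \<otimes>\<^bsub>L\<^esub> (z, \<zero>))"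
      using d z x D.V_carrier D1.V_carrier t_pow_carrier by (simp add: tL_pow a_assoc m_comm)
    show "p \<in> ?C" unfolding p by (intro set_add_I l_coset_I) (use d z D.V_zero in auto)
  qed
qed

lemma ring_C_lq_eq_ext:
  assumes "\<alpha> \<in> D1.S 1"
  shows "ring_C_lq L DL (D1 \<times> D) tL (\<one>, \<zero>) l q (\<alpha>, \<zero>) = ext (even_module l q \<alpha>)"
proof -
  have "tL [^]\<^bsub>L\<^esub> l \<otimes>\<^bsub>L\<^esub> ((\<one>, \<zero>) \<oplus>\<^bsub>L\<^esub> tL [^]\<^bsub>L\<^esub> q \<otimes>\<^bsub>L\<^esub> (\<alpha>, \<zero>)) = (t [^] l \<otimes> (\<one> \<oplus> t [^] q \<otimes> \<alpha>), \<zero>)"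
    using t_pow_carrier by (simp add: tL_pow)
  then show ?thesis
    unfolding ring_C_lq_def even_module_def
    using gen_ring_eq_ext[OF D1.S_carrier[OF even_generator_S[OF assms]]] by metis
qed

lemma ring_C_r_eq_ext:
  assumes "\<alpha> \<in> D1.S 1"
  shows "ring_C_r L DL (D1 \<times> D) tL r (\<alpha>, \<zero>) = ext (odd_module r \<alpha>)"
proof -
  have "tL [^]\<^bsub>L\<^esub> r \<otimes>\<^bsub>L\<^esub> (\<alpha>, \<zero>) = (t [^] r \<otimes> \<alpha>, \<zero>)"
    using t_pow_carrier by (simp add: tL_pow)
  then show ?thesis
    unfolding ring_C_r_def odd_module_def
    using gen_ring_eq_ext[OF D1.S_carrier[OF odd_generator_S[OF assms]]] by metis
qed

lemma P_subset_of_over_ring: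
  assumes M: "M \<subseteq> carrier R" and "scaled_ring L DL tL m (D1 \<times> D) \<subseteq> ext M"
  shows "D1.P (2 * m) \<subseteq> M"
proof
  fix w assume w: "w \<in> D1.P (2 * m)"
  then obtain z where z: "z \<in> D1" "w = t [^] m \<otimes> z" using P_even_E[of w m 0] by (auto simp: D1.P_0)
  have w0: "(w, \<zero>) = (tL [^]\<^bsub>L\<^esub> m \<otimes>\<^bsub>L\<^esub> (z, \<zero>)) \<oplus>\<^bsub>L\<^esub> (\<zero>, \<zero>)"
    using z D1.V_carrier t_pow_carrier by (simp add: tL_pow)
  have "(w, \<zero>) \<in> scaled_ring L DL tL m (D1 \<times> D)"
    unfolding w0 scaled_ring_def by (intro set_add_I l_coset_I) (use z D.V_zero in auto)
  then have "w \<ominus> \<zero> \<in> M" using assms by (auto simp: ext_iff)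
  then show "w \<in> M" using D1.P_carrier[OF w] by (simp add: minus_eq)
qed

lemma over_ring_classification:
  assumes B: "over_ring L DL (scaled_ring L DL tL m (D1 \<times> D)) B"
  shows "(\<exists>k l q \<alpha>. \<alpha> \<in> D1.S 1 \<and> k + (2 * l + q) \<le> m \<and>
            B = scaled_ring L DL tL k (ring_C_lq L DL (D1 \<times> D) tL (\<one>, \<zero>) l q (\<alpha>, \<zero>))) \<or>
         (\<exists>k r \<alpha>. \<alpha> \<in> D1.S 1 \<and> k + r \<le> m \<and>
            B = scaled_ring L DL tL k (ring_C_r L DL (D1 \<times> D) tL r (\<alpha>, \<zero>)))"
proof -
  obtain M where M: "rng_lattice M" "B = ext M" using B cubic_ring_E by (auto simp: over_ring_def)
  have P: "D1.P (2 * m) \<subseteq> M"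
    using B M rng_latticeD(4) by (intro P_subset_of_over_ring) (auto simp: over_ring_def)
  from rng_lattice_classification[OF M(1)] show ?thesis
  proof (elim disjE exE conjE)
    fix k l q \<alpha>
    assume \<alpha>: "\<alpha> \<in> D1.S 1" and "M = scale k (even_module l q \<alpha>)"
      and m: "\<forall>m. D1.P (2 * m) \<subseteq> M \<longrightarrow> k + (2 * l + q) \<le> m"
    then have "B = scaled_ring L DL tL k (ring_C_lq L DL (D1 \<times> D) tL (\<one>, \<zero>) l q (\<alpha>, \<zero>))"
      using M(2) rng_latticeD(4)[OF even_module_plane(1)[OF \<alpha> refl]] by (simp add: ring_C_lq_eq_ext scaled_ring_ext)
    then show ?thesis using \<alpha> m P by blast
  next
    fix k r \<alpha>
    assume \<alpha>: "\<alpha> \<in> D1.S 1" and "M = scale k (odd_module r \<alpha>)"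
      and m: "\<forall>m. D1.P (2 * m) \<subseteq> M \<longrightarrow> k + r \<le> m"
    then have "B = scaled_ring L DL tL k (ring_C_r L DL (D1 \<times> D) tL r (\<alpha>, \<zero>))"
      using M(2) rng_latticeD(4)[OF odd_module_plane(1)[OF \<alpha> refl]] by (simp add: ring_C_r_eq_ext scaled_ring_ext)
    then show ?thesis using \<alpha> m P by blast
  qed
qed

end

section \<open>Plane curve singularities\<close>

text \<open>An element of least valuation in \<open>N\<close> divides all others. It is applied
  below to sets of leading coefficients, and this form spares checking that they are ideals.\<close>

lemma (in valuation_subring) divides_all:
  assumes N: "N \<subseteq> V" "\<zero> \<in> N"
  shows "\<exists>g \<in> N. \<forall>z \<in> N. \<exists>a \<in> V. z = a \<otimes> g"
proof (cases "\<exists>n. \<exists>g \<in> N. g \<in> S n")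
  case False
  then have "z = \<zero>" if "z \<in> N" for z using S_ex N that by blast
  then show ?thesis using N V_zero by (metis zero_closed l_null)
next
  case ex: True
  define n where "n = (LEAST n. \<exists>g \<in> N. g \<in> S n)"
  have "\<exists>g \<in> N. g \<in> S n" unfolding n_def by (rule LeastI_ex[OF ex])
  then obtain g where g: "g \<in> N" "g \<in> S n" by auto
  have "\<exists>a \<in> V. z = a \<otimes> g" if z: "z \<in> N" for z
  proof (cases "z = \<zero>")
    case True
    then show ?thesis using S_carrier[OF g(2)] V_zero by (intro bexI[of _ \<zero>]) auto
  next
    case False
    then obtain m where m: "z \<in> S m" using S_ex N z by auto
    have "n \<le> m" unfolding n_def by (rule Least_le) (use z m in auto)
    then show ?thesis using S_div[OF g(2) S_P[OF m]] P_V by blast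
  qed
  then show ?thesis using g by auto
qed

lemma (in primeideal) pow_mem:
  assumes a: "a \<in> carrier R" shows "a [^] (n::nat) \<in> I \<Longrightarrow> a \<in> I"
proof (induction n)
  case 0
  then show ?case using one_imp_carrier I_notcarr by simp
next
  case (Suc n)
  then show ?case using I_prime[of "a [^] n" a] a by auto
qed

section \<open>Units and maximal ideals of D + M\<close>

context two_branch_algebra
begin

abbreviation E where "E M \<equiv> L\<lparr>carrier := ext M\<rparr>"

definition extJ where "extJ M = {(d \<oplus> m, d) | d m. d \<in> D.P 1 \<and> m \<in> M}"

lemma L_pow: "(a, b) [^]\<^bsub>L\<^esub> (n::nat) = (a [^] n, b [^] n)"
  by (induction n) auto

lemma extJ_I: "d \<in> D.P 1 \<Longrightarrow> m \<in> M \<Longrightarrow> (d \<oplus> m, d) \<in> extJ M" unfolding extJ_def by blast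
lemma extJ_E: "p \<in> extJ M \<Longrightarrow> (\<And>d m. d \<in> D.P 1 \<Longrightarrow> m \<in> M \<Longrightarrow> p = (d \<oplus> m, d) \<Longrightarrow> thesis) \<Longrightarrow> thesis"
  unfolding extJ_def by blast

lemma extJ_ext: "extJ M \<subseteq> ext M" unfolding extJ_def ext_def using D.P_V by blast

lemma E_cring: assumes "rng_lattice M" shows "cring (E M)"
  using L.subcringI'[OF subring_ext[OF assms]] L.subcring_iff[OF subringE(1)[OF subring_ext[OF assms]]] by simp

lemma ideal_extJ: assumes M: "rng_lattice M" shows "ideal (extJ M) (E M)"
proof (rule cring.idealI_closed[OF E_cring[OF M]])
  note M' = dmoduleD[OF rng_latticeD(1)[OF M]]
  show "extJ M \<subseteq> carrier (E M)" using extJ_ext by simp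
  show "\<zero>\<^bsub>E M\<^esub> \<in> extJ M" using extJ_I[OF D.P_zero M'(2)] by simp
  show "p \<oplus>\<^bsub>E M\<^esub> p' \<in> extJ M" if pp: "p \<in> extJ M" "p' \<in> extJ M" for p p'
  proof -
    obtain d m d' m' where d: "d \<in> D.P 1" "m \<in> M" "p = (d \<oplus> m, d)" "d' \<in> D.P 1" "m' \<in> M" "p' = (d' \<oplus> m', d')"
      using pp by (meson extJ_E)
    note c = D.P_carrier[OF d(1)] D.P_carrier[OF d(4)] M'(5)[OF d(2)] M'(5)[OF d(5)]
    have "(d \<oplus> m) \<oplus> (d' \<oplus> m') = (d \<oplus> d') \<oplus> (m \<oplus> m')" using c by algebra
    then show ?thesis using d extJ_I[OF D.P_add M'(3)] by simp
  qed
  show "a \<otimes>\<^bsub>E M\<^esub> p \<in> extJ M" if ap: "a \<in> carrier (E M)" "p \<in> extJ M" for a p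
  proof -
    have "a \<in> ext M" using ap by simp
    then obtain d m d' m' where d: "d \<in> D" "m \<in> M" "a = (d \<oplus> m, d)" "d' \<in> D.P 1" "m' \<in> M" "p = (d' \<oplus> m', d')"
      using ap(2) by (meson extJ_E ext_E)
    note c = D.V_carrier[OF d(1)] D.P_carrier[OF d(4)] M'(5)[OF d(2)] M'(5)[OF d(5)]
    have "(d \<oplus> m) \<otimes> (d' \<oplus> m') = d \<otimes> d' \<oplus> (d \<otimes> m' \<oplus> d' \<otimes> m \<oplus> m \<otimes> m')" using c by algebra
    moreover have "d \<otimes> m' \<oplus> d' \<otimes> m \<oplus> m \<otimes> m' \<in> M" using d D.P_V M'(3,4) rng_latticeD(2)[OF M] by simp
    ultimately show ?thesis using d extJ_I[OF D.P_smult[OF d(1,4)]] by simp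
  qed
qed

text \<open>Put \<open>w = (d + m)\<^sup>-\<^sup>1 - d\<^sup>-\<^sup>1\<close>. It satisfies \<open>w = m' + m'' w\<close> with \<open>m', m'' \<in> M\<close>, and iterating this
  equation approximates \<open>w\<close> by elements of \<open>M\<close> modulo arbitrarily high powers of \<open>\<tau>\<close>.\<close>
lemma inverse_in_ext:
  assumes M: "rng_lattice M" "M \<subseteq> D1.P 1" and d: "d \<in> D.U" "m \<in> M"
  shows "(inv (d \<oplus> m), inv d) \<in> ext M" "(d \<oplus> m) \<otimes> inv (d \<oplus> m) = \<one>"
proof -
  note dM = rng_latticeD(1)[OF M(1)] note M' = dmoduleD[OF dM]
  have "d \<oplus> m \<in> D1.S 0" using d M D_U by (intro D1.S_perturb) (auto simp: D1.S_0)
  then have U: "d \<oplus> m \<in> D1.U" by (simp add: D1.S_0)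
  show one: "(d \<oplus> m) \<otimes> inv (d \<oplus> m) = \<one>" by (rule D1.U_cancel[OF U])
  define i j w where "i = inv (d \<oplus> m)" and "j = inv d" and "w = i \<ominus> j"
  have j: "j \<in> D" "d \<otimes> j = \<one>" using D.U_inv_V[OF d(1)] D.U_cancel[OF d(1)] by (auto simp: j_def)
  have i: "i \<in> D1" using D1.U_inv_V[OF U] by (simp add: i_def)
  have one': "(d \<oplus> m) \<otimes> i = \<one>" using one by (simp add: i_def)
  note c = D.U_carrier[OF d(1)] M'(5)[OF d(2)] D.V_carrier[OF j(1)] D1.V_carrier[OF i]
  have wD: "w \<in> D1" using i j D_in_D1 D1.V_minus by (simp add: w_def)
  note wc = D1.V_carrier[OF wD]
  define m' m'' where "m' = (\<ominus> (j \<otimes> j)) \<otimes> m" and "m'' = (\<ominus> j) \<otimes> m"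
  have mM: "m' \<in> M" "m'' \<in> M" unfolding m'_def m''_def using M'(4) D.V_neg D.V_mult j d by auto
  have "w = (d \<otimes> j) \<otimes> i \<ominus> ((d \<oplus> m) \<otimes> i) \<otimes> j" using one' j c by (simp add: w_def)
  also have "\<dots> = m' \<oplus> m'' \<otimes> w" unfolding m'_def m''_def w_def using c by algebra
  finally have w: "w = m' \<oplus> m'' \<otimes> w" .
  have approx: "\<exists>a b. a \<in> M \<and> b \<in> D1.P n \<and> w = a \<oplus> b" for n
  proof (induction n)
    case 0
    show ?case using wD M'(2) wc by (intro exI[of _ \<zero>] exI[of _ w]) (auto simp: D1.P_0)
  next
    case (Suc n)
    then obtain a b where ab: "a \<in> M" "b \<in> D1.P n" "w = a \<oplus> b" by auto
    note cc = M'(5)[OF ab(1)] D1.P_carrier[OF ab(2)] M'(5)[OF mM(1)] M'(5)[OF mM(2)]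
    have "w = m' \<oplus> m'' \<otimes> (a \<oplus> b)" using w unfolding ab(3) .
    also have "\<dots> = (m' \<oplus> m'' \<otimes> a) \<oplus> m'' \<otimes> b" using cc by algebra
    finally have "w = (m' \<oplus> m'' \<otimes> a) \<oplus> m'' \<otimes> b" .
    moreover have "m' \<oplus> m'' \<otimes> a \<in> M" using mM ab rng_latticeD(2)[OF M(1)] M'(3) by simp
    moreover have "m'' \<otimes> b \<in> D1.P (1 + n)" using mM M(2) ab by (intro D1.P_mult) auto
    ultimately show ?case by (metis plus_1_eq_Suc)
  qed
  obtain N where N: "D1.P N \<subseteq> M" using rng_latticeD(3)[OF M(1)] by auto
  obtain a b where "a \<in> M" "b \<in> D1.P N" "w = a \<oplus> b" using approx[of N] by auto
  then have "w \<in> M" using N M'(3) by auto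
  then show "(inv (d \<oplus> m), inv d) \<in> ext M"
    using j c rng_latticeD(4)[OF M(1)] by (simp add: ext_iff i_def j_def w_def)
qed

text \<open>Outside \<open>extJ M\<close> the diagonal part d is a unit of D, and then d + m is
  invertible within the ring.\<close>

lemma maximal_E_iff:
  assumes M: "rng_lattice M" "M \<subseteq> D1.P 1"
  shows "maximalideal I (E M) \<longleftrightarrow> I = extJ M"
proof (rule cring.unique_maximalideal[OF E_cring[OF M(1)] ideal_extJ[OF M(1)]])
  note M' = dmoduleD[OF rng_latticeD(1)[OF M(1)]]
  have "(\<one> \<oplus> \<zero>, \<one>) \<in> ext M" using ext_I[OF D.V_one M'(2)] .
  moreover have "(\<one> \<oplus> \<zero>, \<one>) \<notin> extJ M"
    using D.U_one D.U_iff unfolding extJ_def by auto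
  ultimately show "carrier (E M) \<noteq> extJ M" by auto
  fix p assume p: "p \<in> carrier (E M)" "p \<notin> extJ M"
  then obtain d m where d: "d \<in> D" "m \<in> M" "p = (d \<oplus> m, d)" by (auto elim: ext_E)
  then have dU: "d \<in> D.U" using p extJ_I D.U_iff by auto
  let ?q = "(inv (d \<oplus> m), inv d)"
  note q = inverse_in_ext[OF M dU d(2)]
  have "p \<otimes>\<^bsub>E M\<^esub> ?q = \<one>\<^bsub>E M\<^esub>" using q(2) D.U_cancel[OF dU] d by simp
  moreover have "?q \<otimes>\<^bsub>E M\<^esub> p = p \<otimes>\<^bsub>E M\<^esub> ?q"
    using cring.cring_simprules(14)[OF E_cring[OF M(1)], of ?q p] q(1) p by simp
  ultimately show "p \<in> Units (E M)" using p q(1) unfolding Units_def by (auto intro!: bexI[of _ ?q])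
qed

lemma
  assumes M: "rng_lattice M" "M \<subseteq> D1.P 1"
  shows local_ring_E: "local_ring (E M)" and max_ideal_E: "max_ideal (E M) = extJ M"
  using E_cring[OF M(1)] maximal_E_iff[OF M] by (simp_all add: local_ring_def max_ideal_def)

text \<open>If 1 lies in \<open>M\<close>, then (1, 0) and (0, 1) are in the ring, and it is the
  product of \<open>M\<close> and D. Two different maximal ideals are the preimages of t D and
  \<tau> D1 under the projections.\<close>

lemma one_in_M_not_local:
  assumes M: "rng_lattice M" and one: "\<one> \<in> M"
  shows "\<not> local_ring (E M)"
proof -
  note dM = rng_latticeD(1)[OF M] note M' = dmoduleD[OF dM]
  interpret E: cring "E M" by (rule E_cring[OF M])
  have DM: "d \<in> M" if "d \<in> D" for d using M'(4)[OF that one] D.V_carrier[OF that] by simp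
  have memb: "(x, y) \<in> ext M \<longleftrightarrow> x \<in> M \<and> y \<in> D" for x y
  proof
    assume "(x, y) \<in> ext M"
    then show "x \<in> M \<and> y \<in> D" using DM M'(3) by (auto simp: ext_def)
  next
    assume "x \<in> M \<and> y \<in> D"
    then show "(x, y) \<in> ext M" using DM dmodule_minus[OF dM] M'(5) rng_latticeD(4)[OF M] by (simp add: ext_iff)
  qed
  have memb2: "fst p \<in> M \<and> snd p \<in> D" if "p \<in> ext M" for p
    using memb[of "fst p" "snd p"] that by simp
  define I1 where "I1 = {p \<in> ext M. snd p \<in> D.P 1}"
  define I2 where "I2 = {p \<in> ext M. fst p \<in> D1.P 1}"
  have i1: "ideal I1 (E M)"
  proof (rule E.idealI_closed)
    show "p \<oplus>\<^bsub>E M\<^esub> q \<in> I1" if "p \<in> I1" "q \<in> I1" for p q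
      using that E.a_closed[of p q] D.P_add by (auto simp: I1_def)
    show "a \<otimes>\<^bsub>E M\<^esub> q \<in> I1" if "a \<in> carrier (E M)" "q \<in> I1" for a q
      using that E.m_closed[of a q] D.P_smult memb2[of a] by (auto simp: I1_def)
  qed (use E.zero_closed D.P_zero in \<open>auto simp: I1_def\<close>)
  have i2: "ideal I2 (E M)"
  proof (rule E.idealI_closed)
    show "p \<oplus>\<^bsub>E M\<^esub> q \<in> I2" if "p \<in> I2" "q \<in> I2" for p q
      using that E.a_closed[of p q] D1.P_add by (auto simp: I2_def)
    show "a \<otimes>\<^bsub>E M\<^esub> q \<in> I2" if "a \<in> carrier (E M)" "q \<in> I2" for a q
      using that E.m_closed[of a q] D1.P_smult memb2[of a] M'(1) by (auto simp: I2_def)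
  qed (use E.zero_closed D1.P_zero in \<open>auto simp: I2_def\<close>)
  have e: "(\<one>, \<zero>) \<in> ext M" "(\<zero>, \<one>) \<in> ext M" using memb one M'(2) D.V_closed by auto
  have n1: "\<one> \<notin> D.P 1" "\<one> \<notin> D1.P 1" using D.U_iff D.U_one D1.U_iff D1.U_one by auto
  have sum: "I = carrier (E M)" if I: "ideal I (E M)" "(\<one>, \<zero>) \<in> I" "(\<zero>, \<one>) \<in> I" for I
  proof -
    interpret I: ideal I "E M" by (rule I(1))
    have "(\<one>, \<zero>) \<oplus>\<^bsub>E M\<^esub> (\<zero>, \<one>) \<in> I" using I by (intro I.a_closed)
    then show ?thesis using I.one_imp_carrier by simp
  qed
  have "maximalideal I1 (E M)"
  proof (rule maximalidealI[OF i1])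
    have "(\<zero>, \<one>) \<notin> I1" using n1 by (simp add: I1_def)
    then show "carrier (E M) \<noteq> I1" using e by auto
    fix J assume J: "ideal J (E M)" "I1 \<subseteq> J" "J \<subseteq> carrier (E M)"
    interpret J: ideal J "E M" by (rule J(1))
    show "J = I1 \<or> J = carrier (E M)"
    proof (cases "J \<subseteq> I1")
      case False
      then obtain a c where p: "(a, c) \<in> J" "(a, c) \<notin> I1" by auto
      then have ac: "a \<in> M" "c \<in> D" using J(3) memb by auto
      then have cU: "c \<in> D.U" using p J(3) D.U_iff by (auto simp: I1_def)
      have "(\<zero>, inv c) \<otimes>\<^bsub>E M\<^esub> (a, c) \<in> J" using p memb M'(2) D.U_inv_V[OF cU] by (intro J.I_l_closed) auto
      then have "(\<zero>, \<one>) \<in> J" using D.U_cancel[OF cU] M'(5)[OF ac(1)] by simp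
      moreover have "(\<one>, \<zero>) \<in> J" using J(2) e D.P_zero by (auto simp: I1_def)
      ultimately show ?thesis using sum J(1) by blast
    qed (use J in auto)
  qed
  moreover have "maximalideal I2 (E M)"
  proof (rule maximalidealI[OF i2])
    have "(\<one>, \<zero>) \<notin> I2" using n1 by (simp add: I2_def)
    then show "carrier (E M) \<noteq> I2" using e by auto
    fix J assume J: "ideal J (E M)" "I2 \<subseteq> J" "J \<subseteq> carrier (E M)"
    interpret J: ideal J "E M" by (rule J(1))
    show "J = I2 \<or> J = carrier (E M)"
    proof (cases "J \<subseteq> I2")
      case False
      then obtain a c where p: "(a, c) \<in> J" "(a, c) \<notin> I2" by auto
      then have ac: "a \<in> M" "c \<in> D" using J(3) memb by auto
      then have aU: "a \<in> D1.U" using p J(3) D1.U_iff M'(1) by (auto simp: I2_def)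
      \<comment> \<open>That the inverse of a lies in \<open>M\<close> is not at hand, so a is
        compared with its residue d, a unit of D, whose inverse does lie in \<open>M\<close>: the
        difference of inv d a and 1 is in \<open>M\<close> and in \<tau> D1, so it gives an element
        of \<open>I2\<close>.\<close>
      obtain d b where d: "d \<in> D.U" "b \<in> D" "a = d \<oplus> b \<otimes> \<tau>" using unit_residue[OF aU] by auto
      let ?s = "inv d \<otimes> (b \<otimes> \<tau>)"
      note cc = D.U_carrier[OF d(1)] D.V_carrier[OF D.U_inv_V[OF d(1)]] D.V_carrier[OF d(2)] D1.pi_carrier
      have inv: "inv d \<otimes> a = \<one> \<oplus> ?s" unfolding d(3) using cc D.U_cancel[OF d(1)] by (simp add: r_distr)
      have "?s = (inv d \<otimes> a) \<ominus> \<one>" unfolding inv using cc by algebra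
      also have "\<dots> \<in> M" using dmodule_minus[OF dM M'(4)[OF D.U_inv_V[OF d(1)] ac(1)] one] .
      finally have s: "\<ominus> ?s \<in> M" using dmodule_neg[OF dM] by simp
      have "?s \<in> D1.P 1"
        using D1.P_smult[OF D_in_D1[OF D.U_inv_V[OF d(1)]] D1.P_smult[OF D_in_D1[OF d(2)]]] D1.pi_pow_P[of 1] D1.pi_carrier
        by simp
      then have "(\<ominus> ?s, \<zero>) \<in> I2" using s memb D.V_zero D1.P_neg by (auto simp: I2_def)
      then have 1: "(\<ominus> ?s, \<zero>) \<in> J" using J(2) by auto
      have "(inv d, \<zero>) \<otimes>\<^bsub>E M\<^esub> (a, c) \<in> J" using p memb DM D.U_inv_V[OF d(1)] D.V_zero by (intro J.I_l_closed) auto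
      then have "(inv d, \<zero>) \<otimes>\<^bsub>E M\<^esub> (a, c) \<oplus>\<^bsub>E M\<^esub> (\<ominus> ?s, \<zero>) \<in> J" using 1 by (rule J.a_closed)
      then have "(\<one> \<oplus> ?s \<oplus> \<ominus> ?s, \<zero>) \<in> J" using inv D.V_carrier[OF ac(2)] by simp
      then have "(\<one>, \<zero>) \<in> J" using cc by (simp add: a_assoc r_neg)
      moreover have "(\<zero>, \<one>) \<in> J" using J(2) e D1.P_zero by (auto simp: I2_def)
      ultimately show ?thesis using sum J(1) by blast
    qed (use J in auto)
  qed
  moreover have "(\<one>, \<zero>) \<in> I1" "(\<one>, \<zero>) \<notin> I2" using e n1 D.P_zero by (auto simp: I1_def I2_def)
  then have "I1 \<noteq> I2" by auto
  ultimately show ?thesis unfolding local_ring_def by blast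
qed

section \<open>Noetherian property and Krull dimension\<close>

text \<open>The ring is free over D with basis 1, x, y, and an ideal is in particular a D-submodule.
  Elimination gives three generators: one whose first coordinate has least valuation, one with first
  coordinate 0 and second coordinate of least valuation, and one with only a third
  coordinate.\<close>

lemma noetherian_E: assumes M: "rng_lattice M" shows "noetherian_ring (E M)"
proof -
  note dM = rng_latticeD(1)[OF M] note M' = dmoduleD[OF dM]
  interpret E: cring "E M" by (rule E_cring[OF M])
  obtain x y n n' where xy: "x \<in> M" "y \<in> M" "M = {a \<otimes> x \<oplus> b \<otimes> y | a b. a \<in> D \<and> b \<in> D}"
    by (rule rng_lattice_opposite_parity[OF M]) (rule that; assumption)
  note xyc = M'(5)[OF xy(1)] M'(5)[OF xy(2)]
  define \<phi> where "\<phi> d a b = (d \<oplus> (a \<otimes> x \<oplus> b \<otimes> y), d)" for d a b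
  have \<phi>: "\<phi> d a b \<in> ext M" if "d \<in> D" "a \<in> D" "b \<in> D" for d a b
    using that xy(3) unfolding \<phi>_def by (intro ext_I) auto
  have \<phi>_E: "\<exists>d a b. d \<in> D \<and> a \<in> D \<and> b \<in> D \<and> p = \<phi> d a b" if "p \<in> ext M" for p
    using that xy(3) unfolding \<phi>_def ext_def by blast
  have scal: "(c, c) \<in> ext M" if "c \<in> D" for c
    using ext_I[OF that M'(2)] D.V_carrier[OF that] by simp
  \<comment> \<open>The identity behind both directions of the elimination: read one way it keeps a
    difference in the ideal, read the other way it rebuilds an element from a generator.\<close>
  have lin: "\<phi> d a b = ((c, c) \<otimes>\<^bsub>E M\<^esub> \<phi> d' a' b') \<oplus>\<^bsub>E M\<^esub> \<phi> (d \<ominus> c \<otimes> d') (a \<ominus> c \<otimes> a') (b \<ominus> c \<otimes> b')"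
    if D: "c \<in> D" "d \<in> D" "a \<in> D" "b \<in> D" "d' \<in> D" "a' \<in> D" "b' \<in> D" for c d a b d' a' b'
  proof -
    note cc = D[THEN D.V_carrier] xyc
    have "d \<oplus> (a \<otimes> x \<oplus> b \<otimes> y) = c \<otimes> (d' \<oplus> (a' \<otimes> x \<oplus> b' \<otimes> y)) \<oplus>
        ((d \<ominus> c \<otimes> d') \<oplus> ((a \<ominus> c \<otimes> a') \<otimes> x \<oplus> (b \<ominus> c \<otimes> b') \<otimes> y))"
      using cc by algebra
    moreover have "d = c \<otimes> d' \<oplus> (d \<ominus> c \<otimes> d')" using cc by (simp add: add_minus_cancel)
    ultimately show ?thesis by (simp add: \<phi>_def)
  qed
  show ?thesis
  proof (rule E.noetherian_ringI)
    fix I assume I: "ideal I (E M)"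
    interpret I: ideal I "E M" by (rule I)
    have I_diff: "\<phi> (d \<ominus> c \<otimes> d') (a \<ominus> c \<otimes> a') (b \<ominus> c \<otimes> b') \<in> I"
      if D: "c \<in> D" "d \<in> D" "a \<in> D" "b \<in> D" "d' \<in> D" "a' \<in> D" "b' \<in> D"
        and I: "\<phi> d a b \<in> I" "\<phi> d' a' b' \<in> I" for c d a b d' a' b'
    proof -
      let ?p = "(c, c) \<otimes>\<^bsub>E M\<^esub> \<phi> d' a' b'" and ?r = "\<phi> (d \<ominus> c \<otimes> d') (a \<ominus> c \<otimes> a') (b \<ominus> c \<otimes> b')"
      have r: "?r \<in> carrier (E M)" using D \<phi> D.V_minus D.V_mult by simp
      have p: "?p \<in> I" using I(2) scal[OF D(1)] by (intro I.I_l_closed) auto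
      then have pc: "?p \<in> carrier (E M)" by (rule I.Icarr)
      have "\<ominus>\<^bsub>E M\<^esub> ?p \<oplus>\<^bsub>E M\<^esub> \<phi> d a b \<in> I" using p I(1) I.a_inv_closed by (intro I.a_closed) auto
      moreover have "\<ominus>\<^bsub>E M\<^esub> ?p \<oplus>\<^bsub>E M\<^esub> \<phi> d a b = ?r"
        unfolding lin[OF D] by (rule E.r_neg1[OF pc r])
      ultimately show ?thesis by simp
    qed
    have zI: "\<phi> \<zero> \<zero> \<zero> \<in> I" using I.zero_closed xyc by (simp add: \<phi>_def)
    define N1 where "N1 = {d \<in> D. \<exists>a \<in> D. \<exists>b \<in> D. \<phi> d a b \<in> I}"
    define N2 where "N2 = {a \<in> D. \<exists>b \<in> D. \<phi> \<zero> a b \<in> I}"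
    define N3 where "N3 = {b \<in> D. \<phi> \<zero> \<zero> b \<in> I}"
    have "N1 \<subseteq> D" "\<zero> \<in> N1" "N2 \<subseteq> D" "\<zero> \<in> N2" "N3 \<subseteq> D" "\<zero> \<in> N3"
      using zI D.V_zero by (auto simp: N1_def N2_def N3_def)
    then obtain d1 a2 b3 where g: "d1 \<in> N1" "\<And>z. z \<in> N1 \<Longrightarrow> \<exists>a \<in> D. z = a \<otimes> d1"
      "a2 \<in> N2" "\<And>z. z \<in> N2 \<Longrightarrow> \<exists>a \<in> D. z = a \<otimes> a2"
      "b3 \<in> N3" "\<And>z. z \<in> N3 \<Longrightarrow> \<exists>a \<in> D. z = a \<otimes> b3"
      using D.divides_all[of N1] D.divides_all[of N2] D.divides_all[of N3] by metis
    obtain a1 b1 where g1: "d1 \<in> D" "a1 \<in> D" "b1 \<in> D" "\<phi> d1 a1 b1 \<in> I" using g(1) by (auto simp: N1_def)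
    obtain b2 where g2: "a2 \<in> D" "b2 \<in> D" "\<phi> \<zero> a2 b2 \<in> I" using g(3) by (auto simp: N2_def)
    have g3: "b3 \<in> D" "\<phi> \<zero> \<zero> b3 \<in> I" using g(5) by (auto simp: N3_def)
    let ?G = "{\<phi> d1 a1 b1, \<phi> \<zero> a2 b2, \<phi> \<zero> \<zero> b3}"
    have GI: "?G \<subseteq> I" using g1 g2 g3 by auto
    have Gc: "?G \<subseteq> carrier (E M)" using GI I.Icarr by blast
    interpret G: ideal "Idl\<^bsub>E M\<^esub> ?G" "E M" by (rule E.genideal_ideal[OF Gc])
    have G: "?G \<subseteq> Idl\<^bsub>E M\<^esub> ?G" by (rule E.genideal_self[OF Gc])
    have step: "\<phi> d a b \<in> Idl\<^bsub>E M\<^esub> ?G"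
      if D: "c \<in> D" "d \<in> D" "a \<in> D" "b \<in> D" "d' \<in> D" "a' \<in> D" "b' \<in> D"
        and "\<phi> d' a' b' \<in> ?G" "\<phi> (d \<ominus> c \<otimes> d') (a \<ominus> c \<otimes> a') (b \<ominus> c \<otimes> b') \<in> Idl\<^bsub>E M\<^esub> ?G" for c d a b d' a' b'
      unfolding lin[OF D] using that(8,9) G scal[OF D(1)] by (intro G.a_closed G.I_l_closed) auto
    have self: "c \<ominus> d \<otimes> \<zero> = c" "c \<ominus> c = \<zero>"
      if "c \<in> carrier R" "d \<in> carrier R" for c d using that by (auto simp: minus_eq r_neg)
    have "I \<subseteq> Idl\<^bsub>E M\<^esub> ?G"
    proof
      fix p assume p: "p \<in> I"
      then have "p \<in> ext M" using I.Icarr[OF p] by simp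
      then obtain d a b where d: "d \<in> D" "a \<in> D" "b \<in> D" "p = \<phi> d a b" using \<phi>_E by blast
      then have "d \<in> N1" using p by (auto simp: N1_def)
      then obtain c1 where c1: "c1 \<in> D" "d = c1 \<otimes> d1" using g(2) by auto
      let ?a = "a \<ominus> c1 \<otimes> a1" and ?b = "b \<ominus> c1 \<otimes> b1"
      have ab: "?a \<in> D" "?b \<in> D" using d c1 g1 by (auto intro: D.V_minus D.V_mult)
      have z1: "d \<ominus> c1 \<otimes> d1 = \<zero>" using c1 d D.V_carrier self by simp
      have p1: "\<phi> \<zero> ?a ?b \<in> I" using I_diff[OF c1(1) d(1-3) g1(1-3) _ g1(4)] p d(4) z1 by simp
      then have "?a \<in> N2" using ab by (auto simp: N2_def)
      then obtain c2 where c2: "c2 \<in> D" "?a = c2 \<otimes> a2" using g(4) by auto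
      let ?b' = "?b \<ominus> c2 \<otimes> b2"
      have b': "?b' \<in> D" using ab c2 g2 by (auto intro: D.V_minus D.V_mult)
      have z2: "?a \<ominus> c2 \<otimes> a2 = \<zero>" "\<zero> \<ominus> c2 \<otimes> \<zero> = \<zero>"
        using c2 ab D.V_carrier self(2)[of ?a] self(1)[of \<zero> c2] by simp_all
      have p2: "\<phi> \<zero> \<zero> ?b' \<in> I"
        using I_diff[OF c2(1) D.V_zero ab D.V_zero g2(1,2) p1 g2(3)] z2 by simp
      then have "?b' \<in> N3" using b' by (auto simp: N3_def)
      then obtain c3 where c3: "c3 \<in> D" "?b' = c3 \<otimes> b3" using g(6) by auto
      have z3: "?b' \<ominus> c3 \<otimes> b3 = \<zero>" "\<zero> \<ominus> c3 \<otimes> \<zero> = \<zero>"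
        using c3 b' D.V_carrier self(2)[of ?b'] self(1)[of \<zero> c3] by simp_all
      have "\<phi> \<zero> \<zero> \<zero> \<in> Idl\<^bsub>E M\<^esub> ?G" using G.zero_closed xyc by (simp add: \<phi>_def)
      then have "\<phi> \<zero> \<zero> ?b' \<in> Idl\<^bsub>E M\<^esub> ?G"
        using z3 by (intro step[OF c3(1) D.V_zero D.V_zero b' D.V_zero D.V_zero g3(1)]) auto
      then have "\<phi> \<zero> ?a ?b \<in> Idl\<^bsub>E M\<^esub> ?G"
        using z2 by (intro step[OF c2(1) D.V_zero ab D.V_zero g2(1,2)]) auto
      then show "p \<in> Idl\<^bsub>E M\<^esub> ?G"
        unfolding d(4) using z1 by (intro step[OF c1(1) d(1-3) g1(1-3)]) auto
    qed
    then have "I = Idl\<^bsub>E M\<^esub> ?G" using E.genideal_minimal[OF I GI] by blast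
    then show "\<exists>A \<subseteq> carrier (E M). finite A \<and> I = Idl\<^bsub>E M\<^esub> A" using Gc by blast
  qed
qed

text \<open>A prime strictly above another prime contains an element with both components nonzero,
  hence a multiple of it that is a power of t, hence t, and the only prime containing t is the
  maximal ideal. The kernel of the second projection is the lower end of a chain of length
  1.\<close>

lemma krull_dim_E:
  assumes M: "rng_lattice M" "M \<subseteq> D1.P 1" shows "krull_dim (E M) = 1"
proof -
  note dM = rng_latticeD(1)[OF M(1)] note M' = dmoduleD[OF dM]
  interpret E: cring "E M" by (rule E_cring[OF M(1)])
  have max: "maximalideal (extJ M) (E M)" using maximal_E_iff[OF M] by simp
  interpret J: maximalideal "extJ M" "E M" by (rule max)
  obtain N where N: "D1.P N \<subseteq> M" using rng_latticeD(3)[OF M(1)] by auto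
  have PM: "z \<in> M" if "z \<in> D1.P n" "N \<le> n" for z n using that N D1.P_mono by auto
  have DM: "z \<in> M" if "z \<in> D.P n" "N \<le> n" for z n
  proof -
    have "z \<in> D1.P (2 * n)"
      using D_P_smult[OF that(1), of \<one> 0] D1.V_one D.P_carrier[OF that(1)] by (simp add: D1.P_0)
    then show ?thesis using PM that by simp
  qed
  have E_pow: "(a, b) [^]\<^bsub>E M\<^esub> (k::nat) = (a [^] k, b [^] k)" for a b k
    using L.nat_pow_consistent[of "(a, b)" k "ext M"] L_pow by simp
  have memb: "(z, c) \<in> ext M" if "z \<in> M" "c \<in> M" "c \<in> D" for z c
    using that dmodule_minus[OF dM] M'(5) rng_latticeD(4)[OF M(1)] by (simp add: ext_iff)
  \<comment> \<open>Every element of the maximal ideal has a power divisible by t in the ring, so a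
    prime that contains t contains the whole maximal ideal.\<close>
  have J_sub: "Q = extJ M" if Q: "primeideal Q (E M)" "tL \<in> Q" for Q
  proof -
    interpret Q: primeideal Q "E M" by (rule Q(1))
    have "extJ M \<subseteq> Q"
    proof
      fix p assume p: "p \<in> extJ M"
      then obtain d m where d: "d \<in> D.P 1" "m \<in> M" "p = (d \<oplus> m, d)" by (rule extJ_E)
      have "d \<in> D1.P 2" using D_P_smult[OF d(1), of \<one> 0] D1.V_one D.P_carrier[OF d(1)] by (simp add: D1.P_0)
      then have dm: "d \<oplus> m \<in> D1.P 1" using D1.P_mono[of 1 2 d] M(2) d(2) by (auto intro: D1.P_add)
      have pow1: "z [^] (k::nat) \<in> D1.P k" if "z \<in> D1.P 1" for z k
      proof (induction k)
        case (Suc k)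
        then show ?case using D1.P_mult[OF Suc that] by simp
      qed (simp add: D1.P_0 D1.V_one)
      have pow2: "z [^] (k::nat) \<in> D.P k" if "z \<in> D.P 1" for z k
      proof (induction k)
        case (Suc k)
        then show ?case using D.P_mult[OF Suc that] by simp
      qed (simp add: D.P_0 D.V_one)
      \<comment> \<open>Valuation 2 + N leaves at least N after division by t, enough for the
        quotient to lie in \<tau>^N D1 and thus in \<open>M\<close>. In the second component the
        same exponent leaves t^(1+N).\<close>
      obtain z where z: "z \<in> D1.P N" "(d \<oplus> m) [^] (2 + N) = t [^] (1::nat) \<otimes> z"
        using P_even_E[of "(d \<oplus> m) [^] (2 + N)" 1 N] pow1[OF dm, of "2 + N"] by auto
      obtain c' where c': "c' \<in> D" "d [^] (2 + N) = t [^] (2 + N) \<otimes> c'"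
        using pow2[OF d(1), of "2 + N"] by (auto elim: D.P_E)
      define c where "c = t [^] (1 + N) \<otimes> c'"
      have c1: "c \<in> D.P (1 + N)" unfolding c_def by (rule D.P_I[OF c'(1)])
      have c2: "d [^] (2 + N) = t [^] (1::nat) \<otimes> c"
        unfolding c_def c'(2) using D.V_carrier[OF c'(1)] t_carrier by (simp add: m_ac)
      note c = c1 c2
      have "(z, c) \<in> ext M" using PM[OF z(1)] DM[OF c(1)] D.P_V[OF c(1)] by (intro memb) auto
      then have "(z, c) \<otimes>\<^bsub>E M\<^esub> tL \<in> Q" using Q(2) by (intro Q.I_l_closed) auto
      moreover have "(z, c) \<otimes>\<^bsub>E M\<^esub> tL = p [^]\<^bsub>E M\<^esub> (2 + N)"
        unfolding d(3) E_pow z(2) c(2) using t_carrier D1.P_carrier[OF z(1)] D.P_carrier[OF c(1)] by (simp add: m_comm)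
      ultimately show "p \<in> Q" using Q.pow_mem[of p "2 + N"] J.Icarr[OF p] by simp
    qed
    then show ?thesis using J.I_maximal[OF Q.is_ideal] Q.I_notcarr Q.a_subset by auto
  qed
  have above: "Q = extJ M" if P: "primeideal P (E M)" and Q: "primeideal Q (E M)" and sub: "P \<subset> Q" for P Q
  proof -
    interpret P: primeideal P "E M" by (rule P)
    interpret Q: primeideal Q "E M" by (rule Q)
    have tN: "t [^] N \<in> D1.P (2 * N)" "t [^] N \<in> D" using D1.S_P[OF t_pow_S] D.pi_pow_V by auto
    have f: "(t [^] N, \<zero>) \<in> ext M" "(\<zero>, t [^] N) \<in> ext M"
      using memb PM[OF tN(1)] M'(2) tN D.V_zero by auto
    have nz: "t [^] N \<noteq> \<zero>" "t [^] N \<in> carrier R" using D.pi_pow_nz t_pow_carrier by auto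
    obtain p where p: "p \<in> Q" "p \<notin> P" using sub by auto
    have pE: "p \<in> ext M" using Q.Icarr[OF p(1)] by simp
    then obtain d m where d: "d \<in> D" "m \<in> M" "p = (d \<oplus> m, d)" by (rule ext_E)
    have pc: "d \<oplus> m \<in> D1" "d \<in> D" using d D_in_D1 M'(1) D1.V_add by auto
    note pcc = D1.V_carrier[OF pc(1)] D.V_carrier[OF pc(2)]
    \<comment> \<open>If a component of p vanishes, the product of p with (0, t^N) or (t^N, 0) is
      zero, hence in \<open>P\<close>. As p is not in \<open>P\<close>, the other factor is in
      \<open>P\<close> and so in \<open>Q\<close>, and adding it to p fills the vanishing
      component.\<close>
    have "\<exists>z c. z \<in> D1 \<and> c \<in> D \<and> z \<noteq> \<zero> \<and> c \<noteq> \<zero> \<and> (z, c) \<in> Q"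
    proof (cases "d = \<zero>")
      case d0: True
      have "p \<otimes>\<^bsub>E M\<^esub> (\<zero>, t [^] N) \<in> P" using P.zero_closed d d0 pcc nz by simp
      then have "(\<zero>, t [^] N) \<in> Q" using P.I_prime[of p "(\<zero>, t [^] N)"] pE f p sub by auto
      then have "p \<oplus>\<^bsub>E M\<^esub> (\<zero>, t [^] N) \<in> Q" using p by (intro Q.a_closed)
      then have "(d \<oplus> m, t [^] N) \<in> Q" using d d0 pcc nz by simp
      moreover have "d \<oplus> m \<noteq> \<zero>" using p d d0 P.zero_closed by auto
      ultimately show ?thesis using pc nz tN by blast
    next
      case d0: False
      show ?thesis
      proof (cases "d \<oplus> m = \<zero>")
        case True
        have "p \<otimes>\<^bsub>E M\<^esub> (t [^] N, \<zero>) \<in> P" using P.zero_closed d True pcc nz by simp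
        then have "(t [^] N, \<zero>) \<in> Q" using P.I_prime[of p "(t [^] N, \<zero>)"] pE f p sub by auto
        then have "p \<oplus>\<^bsub>E M\<^esub> (t [^] N, \<zero>) \<in> Q" using p by (intro Q.a_closed)
        then have "(t [^] N, d) \<in> Q" using d True pcc nz by simp
        then show ?thesis using pc nz d0 tN D_in_D1 by blast
      next
        case False
        then show ?thesis using pc d0 d(3) p(1) by blast
      qed
    qed
    then obtain z c where zc: "z \<in> D1" "c \<in> D" "z \<noteq> \<zero>" "c \<noteq> \<zero>" "(z, c) \<in> Q" by auto
    obtain a b where ab: "z \<in> D1.S a" "c \<in> D.S b" using D1.S_ex D.S_ex zc by meson
    \<comment> \<open>Large enough for the quotients t^s / z and t^s / c to lie in \<tau>^N D1,
      which places both in \<open>M\<close> and so the pair in the ring.\<close>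
    let ?s = "N + a + b"
    obtain h1 where h1: "h1 \<in> D1.P (2 * ?s - a)" "t [^] ?s = h1 \<otimes> z"
      using D1.S_div[OF ab(1) D1.S_P[OF t_pow_S[of ?s]]] by auto
    obtain h2 where h2: "h2 \<in> D.P (?s - b)" "t [^] ?s = h2 \<otimes> c"
      using D.S_div[OF ab(2) D.pi_pow_P[of ?s]] by auto
    have "(h1, h2) \<in> ext M" using PM[OF h1(1)] DM[OF h2(1)] D.P_V[OF h2(1)] by (intro memb) auto
    then have "(h1, h2) \<otimes>\<^bsub>E M\<^esub> (z, c) \<in> Q" using zc(5) by (intro Q.I_l_closed) auto
    then have "tL [^]\<^bsub>E M\<^esub> ?s \<in> Q" using h1 h2 by (simp add: E_pow)
    moreover have "tL \<in> carrier (E M)" using ext_I[OF D.pi(1) M'(2)] t_carrier by simp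
    ultimately have "tL \<in> Q" using Q.pow_mem by blast
    then show ?thesis by (rule J_sub[OF Q])
  qed
  define P0 where "P0 = {p \<in> ext M. snd p = \<zero>}"
  have DE: "snd p \<in> D" if "p \<in> ext M" for p using that by (auto simp: ext_def)
  have fE: "fst p \<in> carrier R" if "p \<in> ext M" for p using that D.V_carrier M'(5) by (auto simp: ext_def)
  have P0_ideal: "ideal P0 (E M)"
  proof (rule E.idealI_closed)
    show "p \<oplus>\<^bsub>E M\<^esub> q \<in> P0" if "p \<in> P0" "q \<in> P0" for p q
      using that E.a_closed[of p q] by (auto simp: P0_def)
    show "a \<otimes>\<^bsub>E M\<^esub> q \<in> P0" if "a \<in> carrier (E M)" "q \<in> P0" for a q
      using that E.m_closed[of a q] DE[of a] D.V_carrier by (auto simp: P0_def)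
  qed (use E.zero_closed in \<open>auto simp: P0_def\<close>)
  have "primeideal P0 (E M)"
  proof (rule primeidealI[OF P0_ideal E.is_cring])
    have "\<one>\<^bsub>E M\<^esub> \<notin> P0" by (simp add: P0_def)
    then show "carrier (E M) \<noteq> P0" using E.one_closed by auto
    show "a \<in> P0 \<or> b \<in> P0" if "a \<in> carrier (E M)" "b \<in> carrier (E M)" "a \<otimes>\<^bsub>E M\<^esub> b \<in> P0" for a b
      using that DE[of a] DE[of b] D.V_carrier by (auto simp: P0_def integral_iff)
  qed
  moreover have "P0 \<subset> extJ M"
  proof
    show "P0 \<subseteq> extJ M"
    proof
      fix p assume "p \<in> P0"
      then obtain m where "m \<in> M" "p = (\<zero> \<oplus> m, \<zero>)" by (auto simp: P0_def ext_def)
      then show "p \<in> extJ M" using extJ_I[OF D.P_zero] by simp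
    qed
    have "t \<in> D.P 1" using D.pi_pow_P[of 1] t_carrier by simp
    then have "(t \<oplus> \<zero>, t) \<in> extJ M" using M'(2) by (rule extJ_I)
    moreover have "(t \<oplus> \<zero>, t) \<notin> P0" using D.pi by (simp add: P0_def)
    ultimately show "P0 \<noteq> extJ M" by auto
  qed
  ultimately show ?thesis by (rule E.krull_dim_eq_1[OF max]) (rule above)
qed

section \<open>Embedding dimension of D + M\<close>

lemma embedding_dim_E_eq_card:
  assumes M: "rng_lattice M" "M \<subseteq> D1.P 1" and S: "finite S" "S \<subseteq> extJ M"
    and span: "\<And>p. p \<in> extJ M \<Longrightarrow> \<exists>g \<in> S \<rightarrow> ext M. p = (\<Oplus>\<^bsub>E M\<^esub>s\<in>S. g s \<otimes>\<^bsub>E M\<^esub> s)"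
    and indep: "\<And>g. g \<in> S \<rightarrow> ext M \<Longrightarrow>
      (\<Oplus>\<^bsub>E M\<^esub>s\<in>S. g s \<otimes>\<^bsub>E M\<^esub> s) \<in> ideal_prod (E M) (extJ M) (extJ M) \<Longrightarrow> \<forall>s\<in>S. g s \<in> extJ M"
  shows "embedding_dim (E M) = card S"
proof -
  interpret E: cring "E M" by (rule E_cring[OF M(1)])
  have max: "maximalideal (extJ M) (E M)" using maximal_E_iff[OF M] by simp
  interpret T: cotangent "E M" "extJ M" by (rule cotangent.intro[OF E.is_cring cotangent_axioms.intro[OF max]])
  show ?thesis unfolding embedding_dim_def max_ideal_E[OF M]
  proof (rule T.dim_M_eq_card[OF S])
    fix p assume p: "p \<in> extJ M"
    obtain g where g: "g \<in> S \<rightarrow> ext M" "p = (\<Oplus>\<^bsub>E M\<^esub>s\<in>S. g s \<otimes>\<^bsub>E M\<^esub> s)" using span[OF p] by auto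
    have pc: "p \<in> carrier (E M)" using p extJ_ext by auto
    then have "p \<ominus>\<^bsub>E M\<^esub> (\<Oplus>\<^bsub>E M\<^esub>s\<in>S. g s \<otimes>\<^bsub>E M\<^esub> s) = \<zero>\<^bsub>E M\<^esub>"
      unfolding g(2)[symmetric] by (simp only: E.r_right_minus_eq)
    then show "\<exists>g\<in>S \<rightarrow> carrier (E M). p \<ominus>\<^bsub>E M\<^esub> (\<Oplus>\<^bsub>E M\<^esub>s\<in>S. g s \<otimes>\<^bsub>E M\<^esub> s) \<in> ideal_prod (E M) (extJ M) (extJ M)"
      using g(1) T.J2.zero_closed by (intro bexI[of _ g]) (simp only:, simp)
  next
    fix g assume "g \<in> S \<rightarrow> carrier (E M)"
      "(\<Oplus>\<^bsub>E M\<^esub>s\<in>S. g s \<otimes>\<^bsub>E M\<^esub> s) \<in> ideal_prod (E M) (extJ M) (extJ M)"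
    then show "\<forall>s\<in>S. g s \<in> extJ M" using indep[of g] by simp
  qed
qed

text \<open>\<open>N\<close> is left open because two choices are needed: \<tau>^(n+1) D1, which
  does not contain x, if x and x^2 generate \<open>M\<close>, and t M if \<open>M\<close> is a
  module scaled by a positive power of t.\<close>

lemma square_extJ_subset:
  assumes M: "rng_lattice M" and N: "dmodule N"
    and DM: "\<And>d m. d \<in> D.P 1 \<Longrightarrow> m \<in> M \<Longrightarrow> d \<otimes> m \<in> N"
    and MM: "\<And>m m'. m \<in> M \<Longrightarrow> m' \<in> M \<Longrightarrow> m \<otimes> m' \<in> N"
    and p: "p \<in> ideal_prod (E M) (extJ M) (extJ M)"
  shows "\<exists>u m. u \<in> D.P 2 \<and> m \<in> N \<and> p = (u \<oplus> m, u)"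
  using p
proof (induction rule: ideal_prod.induct)
  note M' = dmoduleD[OF rng_latticeD(1)[OF M]] note N' = dmoduleD[OF N]
  case (prod i j)
  obtain d m d' m' where d: "d \<in> D.P 1" "m \<in> M" "i = (d \<oplus> m, d)" "d' \<in> D.P 1" "m' \<in> M" "j = (d' \<oplus> m', d')"
    using prod by (meson extJ_E)
  note c = D.P_carrier[OF d(1)] D.P_carrier[OF d(4)] M'(5)[OF d(2)] M'(5)[OF d(5)]
  have "(d \<oplus> m) \<otimes> (d' \<oplus> m') = d \<otimes> d' \<oplus> (d \<otimes> m' \<oplus> d' \<otimes> m \<oplus> m \<otimes> m')" using c by algebra
  moreover have "d \<otimes> m' \<oplus> d' \<otimes> m \<oplus> m \<otimes> m' \<in> N" using d DM MM N'(3) by simp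
  moreover have "d \<otimes> d' \<in> D.P 2" using D.P_mult[OF d(1,4)] by (simp add: numeral_2_eq_2)
  ultimately show ?case using d by auto
next
  note N' = dmoduleD[OF N]
  case (sum s1 s2)
  then obtain u m u' m' where u: "u \<in> D.P 2" "m \<in> N" "s1 = (u \<oplus> m, u)" "u' \<in> D.P 2" "m' \<in> N" "s2 = (u' \<oplus> m', u')"
    by auto
  note c = D.P_carrier[OF u(1)] D.P_carrier[OF u(4)] N'(5)[OF u(2)] N'(5)[OF u(5)]
  have "(u \<oplus> m) \<oplus> (u' \<oplus> m') = (u \<oplus> u') \<oplus> (m \<oplus> m')" using c by algebra
  then show ?case using u D.P_add N'(3) by (intro exI[of _ "u \<oplus> u'"] exI[of _ "m \<oplus> m'"]) simp
qed

lemma dmodule_P: "dmodule (D1.P n)"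
  unfolding dmodule_def using D1.P_V D1.P_zero D1.P_add D1.P_smult D_in_D1 by auto

lemma t_P_1: "t \<in> D.P 1" using D.pi_pow_P[of 1] t_carrier by simp

lemma P_1_of_t_mult: assumes "a \<in> D" "a \<otimes> t \<in> D.P 2" shows "a \<in> D.P 1"
proof -
  have "t \<in> D.S 1" using D.pi_pow_S[of 1] t_carrier by simp
  then show ?thesis using D.S_mult_P[of t 1 a 2] assms D.V_carrier[OF assms(1)] t_carrier
    by (simp add: m_comm)
qed

text \<open>The generators t and x stay independent modulo J^2, because the diagonal part of J^2
  lies in t^2 D and the remaining part in \<tau>^(n+1) D1, which does not contain x.\<close>

lemma embedding_dim_monogenic:
  assumes M: "rng_lattice M" "M \<subseteq> D1.P n" "n \<ge> 1" and x: "x \<in> M" "x \<in> D1.S n"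
    and gen: "\<And>z. z \<in> M \<Longrightarrow> \<exists>a b. a \<in> D \<and> b \<in> D \<and> z = a \<otimes> x \<oplus> b \<otimes> (x \<otimes> x)"
  shows "embedding_dim (E M) = 2"
proof -
  note dM = rng_latticeD(1)[OF M(1)] note M' = dmoduleD[OF dM]
  have M1: "M \<subseteq> D1.P 1" using M D1.P_mono by blast
  interpret E: cring "E M" by (rule E_cring[OF M(1)])
  note xc = M'(5)[OF x(1)]
  let ?X = "(x, \<zero>)"
  have tJ: "tL \<in> extJ M" using extJ_I[OF t_P_1 M'(2)] t_carrier by simp
  have xJ: "?X \<in> extJ M" using extJ_I[OF D.P_zero x(1)] xc by simp
  have ne: "tL \<noteq> ?X" using D.pi by simp
  have sum: "(\<Oplus>\<^bsub>E M\<^esub>s\<in>{tL, ?X}. g s \<otimes>\<^bsub>E M\<^esub> s) = g tL \<otimes>\<^bsub>E M\<^esub> tL \<oplus>\<^bsub>E M\<^esub> g ?X \<otimes>\<^bsub>E M\<^esub> ?X"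
    if "g tL \<in> ext M" "g ?X \<in> ext M" for g
    using that tJ xJ extJ_ext[of M] E.m_closed by (intro E.finsum_two[OF ne]) auto
  have "embedding_dim (E M) = card {tL, ?X}"
  proof (rule embedding_dim_E_eq_card[OF M(1) M1])
    fix p assume "p \<in> extJ M"
    then obtain d m where d: "d \<in> D.P 1" "m \<in> M" "p = (d \<oplus> m, d)" by (rule extJ_E)
    obtain d' where d': "d' \<in> D" "d = t \<otimes> d'" by (rule D.P_1_E[OF d(1)])
    obtain a b where ab: "a \<in> D" "b \<in> D" "m = a \<otimes> x \<oplus> b \<otimes> (x \<otimes> x)" using gen[OF d(2)] by auto
    \<comment> \<open>The term b x^2 is moved into the coefficient of (x, 0). The second component
      of this coefficient is multiplied by 0; the value a keeps the pair in the ring.\<close>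
    define g where "g s = (if s = tL then (d', d') else (a \<oplus> b \<otimes> x, a))" for s
    have g1: "(d', d') \<in> ext M" using ext_I[OF d'(1) M'(2)] D.V_carrier[OF d'(1)] by simp
    have g2: "(a \<oplus> b \<otimes> x, a) \<in> ext M" using ext_I ab x M'(4) by simp
    have "g tL = (d', d')" "g ?X = (a \<oplus> b \<otimes> x, a)" using D.pi by (auto simp: g_def)
    moreover have "p = (d', d') \<otimes>\<^bsub>E M\<^esub> tL \<oplus>\<^bsub>E M\<^esub> (a \<oplus> b \<otimes> x, a) \<otimes>\<^bsub>E M\<^esub> ?X"
      unfolding d(3) d'(2) ab(3)
      using D.V_carrier[OF d'(1)] D.V_carrier[OF ab(1)] D.V_carrier[OF ab(2)] t_carrier xc
      by (simp add: l_distr m_assoc m_comm[of t d'])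
    ultimately have "p = (\<Oplus>\<^bsub>E M\<^esub>s\<in>{tL, ?X}. g s \<otimes>\<^bsub>E M\<^esub> s)" using sum[of g] g1 g2 by simp
    moreover have "g \<in> {tL, ?X} \<rightarrow> ext M" using g1 g2 by (auto simp: g_def)
    ultimately show "\<exists>g \<in> {tL, ?X} \<rightarrow> ext M. p = (\<Oplus>\<^bsub>E M\<^esub>s\<in>{tL, ?X}. g s \<otimes>\<^bsub>E M\<^esub> s)" by blast
  next
    fix g assume g: "g \<in> {tL, ?X} \<rightarrow> ext M"
      and z: "(\<Oplus>\<^bsub>E M\<^esub>s\<in>{tL, ?X}. g s \<otimes>\<^bsub>E M\<^esub> s) \<in> ideal_prod (E M) (extJ M) (extJ M)"
    have "g tL \<in> ext M" "g ?X \<in> ext M" using g by auto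
    then obtain a m b m' where ab: "a \<in> D" "m \<in> M" "g tL = (a \<oplus> m, a)" "b \<in> D" "m' \<in> M" "g ?X = (b \<oplus> m', b)"
      by (meson ext_E)
    note c = D.V_carrier[OF ab(1)] D.V_carrier[OF ab(4)] M'(5)[OF ab(2)] M'(5)[OF ab(5)] t_carrier xc
    have "\<exists>u k. u \<in> D.P 2 \<and> k \<in> D1.P (Suc n) \<and>
        (g tL \<otimes>\<^bsub>E M\<^esub> tL \<oplus>\<^bsub>E M\<^esub> g ?X \<otimes>\<^bsub>E M\<^esub> ?X) = (u \<oplus> k, u)"
    proof (rule square_extJ_subset[OF M(1) dmodule_P])
      show "d \<otimes> k \<in> D1.P (Suc n)" if "d \<in> D.P 1" "k \<in> M" for d k
        using D_P_smult[OF that(1), of k n] that M(2) D1.P_mono[of "Suc n" "2 * 1 + n"] by auto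
      show "k \<otimes> k' \<in> D1.P (Suc n)" if "k \<in> M" "k' \<in> M" for k k'
        using D1.P_mult[of k n k' n] that M(2,3) D1.P_mono[of "Suc n" "n + n"] by auto
      show "(g tL \<otimes>\<^bsub>E M\<^esub> tL \<oplus>\<^bsub>E M\<^esub> g ?X \<otimes>\<^bsub>E M\<^esub> ?X) \<in> ideal_prod (E M) (extJ M) (extJ M)"
        using z sum[of g] g by simp
    qed
    then obtain u k where u: "u \<in> D.P 2" "k \<in> D1.P (Suc n)"
      "((a \<oplus> m) \<otimes> t \<oplus> (b \<oplus> m') \<otimes> x, a \<otimes> t \<oplus> b \<otimes> \<zero>) = (u \<oplus> k, u)" by (auto simp: ab)
    have at: "u = a \<otimes> t" using u(3) c by simp
    then have aP: "a \<in> D.P 1" using u(1) ab(1) by (intro P_1_of_t_mult) simp_all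
    have kc: "k \<in> carrier R" by (rule D1.P_carrier[OF u(2)])
    have eq: "(a \<oplus> m) \<otimes> t \<oplus> (b \<oplus> m') \<otimes> x = a \<otimes> t \<oplus> k" using u(3) at by simp
    have "x \<otimes> b = ((a \<oplus> m) \<otimes> t \<oplus> (b \<oplus> m') \<otimes> x) \<ominus> a \<otimes> t \<ominus> t \<otimes> m \<ominus> m' \<otimes> x" using c by algebra
    also have "\<dots> = k \<ominus> t \<otimes> m \<ominus> m' \<otimes> x" unfolding eq using c kc by algebra
    also have "\<dots> \<in> D1.P (Suc n)"
    proof (intro D1.P_minus u(2))
      show "t \<otimes> m \<in> D1.P (Suc n)"
        using D_P_smult[OF t_P_1, of m n] ab(2) M(2) D1.P_mono[of "Suc n" "2 * 1 + n"] by auto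
      show "m' \<otimes> x \<in> D1.P (Suc n)"
        using D1.P_mult[of m' n x n] ab(5) x(1) M(2,3) D1.P_mono[of "Suc n" "n + n"] by auto
    qed
    finally have "b \<in> D1.P 1" using D1.S_mult_P[OF x(2) D_in_D1[OF ab(4)], of "Suc n"] by simp
    then have bP: "b \<in> D.P 1" using D_P_1 ab(4) by simp
    show "\<forall>s \<in> {tL, ?X}. g s \<in> extJ M"
      using extJ_I[OF aP ab(2)] extJ_I[OF bP ab(5)] ab by simp
  qed (use tJ xJ in auto)
  then show ?thesis using ne by simp
qed

text \<open>As M0 is closed under products, products of elements of \<open>M\<close> lie in t M, and
  J^2 in t J. The elements t, (x, 0), (y, 0) form a basis of J over D, so they stay independent
  modulo t J.\<close>

lemma embedding_dim_scaled:
  assumes M0: "rng_lattice M0" and M: "rng_lattice M" "M = scale k M0" and k: "k \<ge> 1"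
  shows "M \<subseteq> D1.P 1" "embedding_dim (E M) = 3"
proof -
  note dM = rng_latticeD(1)[OF M(1)] note M' = dmoduleD[OF dM]
  note M0' = dmoduleD[OF rng_latticeD(1)[OF M0]]
  show M1: "M \<subseteq> D1.P 1"
  proof
    fix z assume "z \<in> M"
    then obtain w where "w \<in> M0" "z = t [^] k \<otimes> w" by (auto simp: M(2) scale_def)
    then show "z \<in> D1.P 1"
      using t_pow_P[of w 0 k] M0'(1) k D1.P_mono[of 1 "2 * k + 0"] by (auto simp: D1.P_0)
  qed
  interpret E: cring "E M" by (rule E_cring[OF M(1)])
  obtain x y n n' where xy: "x \<in> M" "x \<in> D1.S n" "y \<in> M" "y \<in> D1.S n'" "even n \<noteq> even n'"
    "M = {a \<otimes> x \<oplus> b \<otimes> y | a b. a \<in> D \<and> b \<in> D}"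
    by (rule rng_lattice_opposite_parity[OF M(1)])
  note xyc = M'(5)[OF xy(1)] M'(5)[OF xy(3)]
  define N where "N = scale 1 M"
  have N_iff: "z \<in> N \<longleftrightarrow> (\<exists>m \<in> M. z = t \<otimes> m)" for z using t_carrier by (auto simp: N_def scale_def)
  have dN: "dmodule N"
    unfolding dmodule_def
  proof (intro conjI ballI subsetI)
    show "z \<in> D1" if "z \<in> N" for z using that M'(1) t_D1 D1.V_mult by (auto simp: N_iff)
    show "\<zero> \<in> N" using M'(2) t_carrier by (force simp: N_iff)
    show "z \<oplus> z' \<in> N" if zz: "z \<in> N" "z' \<in> N" for z z'
    proof -
      obtain m m' where m: "m \<in> M" "z = t \<otimes> m" "m' \<in> M" "z' = t \<otimes> m'" using zz by (auto simp: N_iff)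
      then have "z \<oplus> z' = t \<otimes> (m \<oplus> m')" using M'(5) t_carrier by (simp add: r_distr)
      then show ?thesis using m M'(3) N_iff by blast
    qed
    show "d \<otimes> z \<in> N" if dz: "d \<in> D" "z \<in> N" for d z
    proof -
      obtain m where m: "m \<in> M" "z = t \<otimes> m" using dz by (auto simp: N_iff)
      then have "d \<otimes> z = t \<otimes> (d \<otimes> m)" using dz M'(5) D.V_carrier t_carrier by (simp add: m_lcomm)
      then show ?thesis using m dz M'(4) N_iff by blast
    qed
  qed
  have DMN: "d \<otimes> m \<in> N" if dm: "d \<in> D.P 1" "m \<in> M" for d m
  proof -
    obtain d' where d': "d' \<in> D" "d = t \<otimes> d'" by (rule D.P_1_E[OF dm(1)])
    then have "d \<otimes> m = t \<otimes> (d' \<otimes> m)" using dm M'(5) D.V_carrier t_carrier by (simp add: m_assoc)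
    then show ?thesis using d' dm M'(4) N_iff by blast
  qed
  have MMN: "m \<otimes> m' \<in> N" if mm: "m \<in> M" "m' \<in> M" for m m'
  proof -
    obtain z z' where z: "z \<in> M0" "m = t [^] k \<otimes> z" "z' \<in> M0" "m' = t [^] k \<otimes> z'"
      using mm by (auto simp: M(2) scale_def)
    note c = M0'(5)[OF z(1)] M0'(5)[OF z(3)] t_pow_carrier[of k]
    have "m \<otimes> m' = t [^] k \<otimes> (t [^] k \<otimes> (z \<otimes> z'))" unfolding z(2,4) using c by algebra
    moreover have "t [^] k \<otimes> (z \<otimes> z') \<in> M" using rng_latticeD(2)[OF M0 z(1,3)] by (auto simp: M(2) scale_def)
    moreover have "t [^] k \<in> D.P 1" using D.pi_pow_P[of k] k D.P_mono by blast
    ultimately show ?thesis using DMN by simp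
  qed
  let ?X = "(x, \<zero>)" and ?Y = "(y, \<zero>)"
  have tJ: "tL \<in> extJ M" using extJ_I[OF t_P_1 M'(2)] t_carrier by simp
  have xJ: "?X \<in> extJ M" using extJ_I[OF D.P_zero xy(1)] xyc by simp
  have yJ: "?Y \<in> extJ M" using extJ_I[OF D.P_zero xy(3)] xyc by simp
  have "x \<noteq> y" using xy(2,4,5) D1.S_unique by blast
  then have ne: "tL \<noteq> ?X" "tL \<noteq> ?Y" "?X \<noteq> ?Y" using D.pi by auto
  have sum: "(\<Oplus>\<^bsub>E M\<^esub>s\<in>{tL, ?X, ?Y}. g s \<otimes>\<^bsub>E M\<^esub> s) =
      g tL \<otimes>\<^bsub>E M\<^esub> tL \<oplus>\<^bsub>E M\<^esub> (g ?X \<otimes>\<^bsub>E M\<^esub> ?X \<oplus>\<^bsub>E M\<^esub> g ?Y \<otimes>\<^bsub>E M\<^esub> ?Y)"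
    if "g tL \<in> ext M" "g ?X \<in> ext M" "g ?Y \<in> ext M" for g
    using that tJ xJ yJ extJ_ext[of M] E.m_closed by (intro E.finsum_three[OF ne]) auto
  have "embedding_dim (E M) = card {tL, ?X, ?Y}"
  proof (rule embedding_dim_E_eq_card[OF M(1) M1])
    fix p assume "p \<in> extJ M"
    then obtain d m where d: "d \<in> D.P 1" "m \<in> M" "p = (d \<oplus> m, d)" by (rule extJ_E)
    obtain d' where d': "d' \<in> D" "d = t \<otimes> d'" by (rule D.P_1_E[OF d(1)])
    obtain a b where ab: "a \<in> D" "b \<in> D" "m = a \<otimes> x \<oplus> b \<otimes> y" using d(2) xy(6) by auto
    define g where "g s = (if s = tL then (d', d') else if s = ?X then (a, a) else (b, b))" for s
    have scal: "(e, e) \<in> ext M" if "e \<in> D" for e using ext_I[OF that M'(2)] D.V_carrier[OF that] by simp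
    have "g tL = (d', d')" "g ?X = (a, a)" "g ?Y = (b, b)" using D.pi \<open>x \<noteq> y\<close> by (auto simp: g_def)
    moreover have "p = (d', d') \<otimes>\<^bsub>E M\<^esub> tL \<oplus>\<^bsub>E M\<^esub> ((a, a) \<otimes>\<^bsub>E M\<^esub> ?X \<oplus>\<^bsub>E M\<^esub> (b, b) \<otimes>\<^bsub>E M\<^esub> ?Y)"
      unfolding d(3) d'(2) ab(3)
      using D.V_carrier[OF d'(1)] D.V_carrier[OF ab(1)] D.V_carrier[OF ab(2)] t_carrier xyc
      by (simp add: m_comm[of t d'])
    ultimately have "p = (\<Oplus>\<^bsub>E M\<^esub>s\<in>{tL, ?X, ?Y}. g s \<otimes>\<^bsub>E M\<^esub> s)" using sum[of g] scal d'(1) ab(1,2) by simp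
    moreover have "g \<in> {tL, ?X, ?Y} \<rightarrow> ext M" using scal d'(1) ab(1,2) by (auto simp: g_def)
    ultimately show "\<exists>g \<in> {tL, ?X, ?Y} \<rightarrow> ext M. p = (\<Oplus>\<^bsub>E M\<^esub>s\<in>{tL, ?X, ?Y}. g s \<otimes>\<^bsub>E M\<^esub> s)" by blast
  next
    fix g assume g: "g \<in> {tL, ?X, ?Y} \<rightarrow> ext M"
      and z: "(\<Oplus>\<^bsub>E M\<^esub>s\<in>{tL, ?X, ?Y}. g s \<otimes>\<^bsub>E M\<^esub> s) \<in> ideal_prod (E M) (extJ M) (extJ M)"
    have gE: "g tL \<in> ext M" "g ?X \<in> ext M" "g ?Y \<in> ext M" using g by auto
    obtain a m where a: "a \<in> D" "m \<in> M" "g tL = (a \<oplus> m, a)" using gE(1) by (rule ext_E)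
    obtain b m' where b: "b \<in> D" "m' \<in> M" "g ?X = (b \<oplus> m', b)" using gE(2) by (rule ext_E)
    obtain e m'' where e: "e \<in> D" "m'' \<in> M" "g ?Y = (e \<oplus> m'', e)" using gE(3) by (rule ext_E)
    note c = D.V_carrier[OF a(1)] D.V_carrier[OF b(1)] D.V_carrier[OF e(1)]
      M'(5)[OF a(2)] M'(5)[OF b(2)] M'(5)[OF e(2)] t_carrier xyc
    obtain u w where u: "u \<in> D.P 2" "w \<in> N"
      "(g tL \<otimes>\<^bsub>E M\<^esub> tL \<oplus>\<^bsub>E M\<^esub> (g ?X \<otimes>\<^bsub>E M\<^esub> ?X \<oplus>\<^bsub>E M\<^esub> g ?Y \<otimes>\<^bsub>E M\<^esub> ?Y)) = (u \<oplus> w, u)"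
      using square_extJ_subset[OF M(1) dN DMN MMN z] unfolding sum[OF gE] by blast
    have u3: "((a \<oplus> m) \<otimes> t \<oplus> ((b \<oplus> m') \<otimes> x \<oplus> (e \<oplus> m'') \<otimes> y), a \<otimes> t \<oplus> (b \<otimes> \<zero> \<oplus> e \<otimes> \<zero>)) = (u \<oplus> w, u)"
      using u(3) by (simp add: a b e)
    have at: "u = a \<otimes> t" using u3 c by simp
    then have aP: "a \<in> D.P 1" using u(1) a(1) by (intro P_1_of_t_mult) simp_all
    have wc: "w \<in> carrier R" using dmoduleD(5)[OF dN u(2)] .
    have eq: "(a \<oplus> m) \<otimes> t \<oplus> ((b \<oplus> m') \<otimes> x \<oplus> (e \<oplus> m'') \<otimes> y) = a \<otimes> t \<oplus> w" using u3 at by simp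
    have "b \<otimes> x \<oplus> e \<otimes> y = ((a \<oplus> m) \<otimes> t \<oplus> ((b \<oplus> m') \<otimes> x \<oplus> (e \<oplus> m'') \<otimes> y))
        \<ominus> a \<otimes> t \<ominus> t \<otimes> m \<ominus> m' \<otimes> x \<ominus> m'' \<otimes> y" using c by algebra
    also have "\<dots> = w \<ominus> t \<otimes> m \<ominus> m' \<otimes> x \<ominus> m'' \<otimes> y" unfolding eq using c wc by algebra
    also have "\<dots> \<in> N"
      by (intro dmodule_minus[OF dN] u(2) DMN[OF t_P_1] MMN a b e xy)
    finally obtain v where v: "v \<in> M" "b \<otimes> x \<oplus> e \<otimes> y = t \<otimes> v" by (auto simp: N_iff)
    obtain b' e' where be: "b' \<in> D" "e' \<in> D" "v = b' \<otimes> x \<oplus> e' \<otimes> y" using v(1) xy(6) by auto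
    have "b \<otimes> x \<oplus> e \<otimes> y = (t \<otimes> b') \<otimes> x \<oplus> (t \<otimes> e') \<otimes> y"
      unfolding v(2) be(3) using D.V_carrier[OF be(1)] D.V_carrier[OF be(2)] c by (simp add: r_distr m_assoc)
    \<comment> \<open>Coordinates with respect to x and y are unique by parity, so divisibility of
      the combination by t within \<open>M\<close> passes to b and e.\<close>
    then have "b = t \<otimes> b'" "e = t \<otimes> e'"
      using unique_parity[OF xy(2,4,5) b(1) e(1) D.V_mult[OF D.pi(1) be(1)] D.V_mult[OF D.pi(1) be(2)]] by auto
    then have "b \<in> D.P 1" "e \<in> D.P 1"
      using D.P_I[OF be(1), of 1] D.P_I[OF be(2), of 1] t_carrier by simp_all
    then show "\<forall>s \<in> {tL, ?X, ?Y}. g s \<in> extJ M"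
      using extJ_I[OF aP a(2)] extJ_I[OF _ b(2)] extJ_I[OF _ e(2)] a b e by simp
  qed (use tJ xJ yJ in auto)
  then show "embedding_dim (E M) = 3" using ne by simp
qed

lemma plane_curve_singularity_E:
  assumes M: "rng_lattice M" "M \<subseteq> D1.P n" "n \<ge> 1" and x: "x \<in> M" "x \<in> D1.S n"
    and gen: "\<And>z. z \<in> M \<Longrightarrow> \<exists>a b. a \<in> D \<and> b \<in> D \<and> z = a \<otimes> x \<oplus> b \<otimes> (x \<otimes> x)"
  shows "plane_curve_singularity (E M)"
proof -
  have M1: "M \<subseteq> D1.P 1" using M D1.P_mono by blast
  show ?thesis unfolding plane_curve_singularity_def
    using local_ring_E[OF M(1) M1] noetherian_E[OF M(1)] krull_dim_E[OF M(1) M1]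
      embedding_dim_monogenic[OF M x gen] by blast
qed

section \<open>Classification of the plane curve singularities\<close>

lemma plane_curve_singularity_even:
  assumes "\<alpha> \<in> D1.S 1" "l \<ge> 1" shows "plane_curve_singularity (E (even_module l q \<alpha>))"
  by (rule plane_curve_singularity_E[OF even_module_plane(1,4)[OF assms(1) refl] _
        even_module_plane(2,3)[OF assms(1) refl] even_module_plane(5)[OF assms(1) refl]])
    (use assms in auto)

lemma plane_curve_singularity_odd:
  assumes "\<alpha> \<in> D1.S 1" shows "plane_curve_singularity (E (odd_module r \<alpha>))"
  by (rule plane_curve_singularity_E[OF odd_module_plane(1,4)[OF assms(1) refl] _
        odd_module_plane(2,3)[OF assms(1) refl] odd_module_plane(5)[OF assms(1) refl]])
    (use assms in auto)

lemma scale_0: "M \<subseteq> carrier R \<Longrightarrow> scale 0 M = M"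
  by (force simp: scale_def subset_iff)

text \<open>The generator is 1 + t^q \<alpha>, and t^q \<alpha> has valuation 2 q + 1, so it lies in
  the ideal part \<tau>^(2q) D1; the difference is 1.\<close>

lemma even_module_0_not_local:
  assumes \<alpha>: "\<alpha> \<in> D1.S 1" shows "\<not> local_ring (E (even_module 0 q \<alpha>))"
proof (rule one_in_M_not_local)
  let ?M = "even_module 0 q \<alpha>" and ?x = "t [^] (0::nat) \<otimes> (\<one> \<oplus> t [^] q \<otimes> \<alpha>)"
  show M: "rng_lattice ?M" by (rule even_module_plane(1)[OF \<alpha> refl])
  have c: "t [^] q \<in> carrier R" "\<alpha> \<in> carrier R" "\<one> \<in> carrier R" using t_pow_carrier D1.S_carrier[OF \<alpha>] by auto
  have "t [^] q \<otimes> \<alpha> \<in> D1.P (2 * (2 * 0 + q))"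
    using t_pow_P[OF D1.S_P[OF \<alpha>], of q] D1.P_mono[of "2 * (2 * 0 + q)" "2 * q + 1"] by simp
  then have "t [^] q \<otimes> \<alpha> \<in> ?M"
    unfolding even_module_def using P_subset_gen[OF D1.S_V[OF even_generator_S[OF \<alpha>]]] by blast
  then have "?x \<ominus> t [^] q \<otimes> \<alpha> \<in> ?M"
    by (intro dmodule_minus[OF rng_latticeD(1)[OF M]] even_module_plane(2)[OF \<alpha> refl])
  moreover have "(\<one> \<oplus> t [^] q \<otimes> \<alpha>) \<ominus> t [^] q \<otimes> \<alpha> = \<one>" using c by algebra
  ultimately show "\<one> \<in> ?M" using c by simp
qed

lemma plane_curve_singularity_classification:
  assumes C: "cubic_ring L DL C" and p: "plane_curve_singularity (L\<lparr>carrier := C\<rparr>)"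
  shows "(\<exists>l q \<alpha>. 1 \<le> l \<and> \<alpha> \<in> D1.S 1 \<and> C = ext (even_module l q \<alpha>)) \<or>
    (\<exists>r \<alpha>. \<alpha> \<in> D1.S 1 \<and> C = ext (odd_module r \<alpha>))"
proof -
  obtain M where M: "rng_lattice M" "C = ext M" using cubic_ring_E[OF C] by blast
  have p': "local_ring (E M)" "embedding_dim (E M) = 2"
    using p M(2) by (auto simp: plane_curve_singularity_def)
  have k0: "k = 0" if "rng_lattice M0" "M = scale k M0" for k M0
    using embedding_dim_scaled(2)[OF that(1) M(1) that(2)] p'(2) by (cases k) auto
  from rng_lattice_classification[OF M(1)] show ?thesis
  proof (elim disjE exE conjE)
    fix k l q \<alpha> assume \<alpha>: "\<alpha> \<in> D1.S 1" and Mk: "M = scale k (even_module l q \<alpha>)"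
    note n = even_module_plane(1)[OF \<alpha> refl, of l q]
    have Me: "M = even_module l q \<alpha>" using k0[OF n Mk] Mk scale_0[OF rng_latticeD(4)[OF n]] by simp
    then have "l \<noteq> 0" using p'(1) even_module_0_not_local[OF \<alpha>] by (cases "l = 0") auto
    then show ?thesis using \<alpha> M(2) Me by (metis One_nat_def Suc_leI neq0_conv)
  next
    fix k r \<alpha> assume \<alpha>: "\<alpha> \<in> D1.S 1" and Mk: "M = scale k (odd_module r \<alpha>)"
    note n = odd_module_plane(1)[OF \<alpha> refl, of r]
    have "M = odd_module r \<alpha>" using k0[OF n Mk] Mk scale_0[OF rng_latticeD(4)[OF n]] by simp
    then show ?thesis using \<alpha> M(2) by blast
  qed
qed

lemma plane_curve_singularities:
  "{C. cubic_ring L DL C \<and> plane_curve_singularity (L\<lparr>carrier := C\<rparr>)} =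
    {ring_C_lq L DL (D1 \<times> D) tL (\<one>, \<zero>) l q (\<alpha>, \<zero>) | l q \<alpha>. 1 \<le> l \<and> \<alpha> \<in> D1.S 1} \<union>
    {ring_C_r L DL (D1 \<times> D) tL r (\<alpha>, \<zero>) | r \<alpha>. \<alpha> \<in> D1.S 1}" (is "?A = ?B \<union> ?C")
proof
  show "?A \<subseteq> ?B \<union> ?C"
    using plane_curve_singularity_classification ring_C_lq_eq_ext ring_C_r_eq_ext by blast
  show "?B \<union> ?C \<subseteq> ?A"
    using cubic_ring_ext[OF even_module_plane(1)[OF _ refl]] cubic_ring_ext[OF odd_module_plane(1)[OF _ refl]]
      plane_curve_singularity_even plane_curve_singularity_odd
    by (auto simp: ring_C_lq_eq_ext ring_C_r_eq_ext)
qed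

end

section \<open>Translation of the hypotheses of the theorem\<close>

text \<open>d is a root of X - d, whose constant coefficient is the reason for the assumption on the
  negative of d.\<close>

lemma (in ring) mem_integral_closure:
  assumes d: "d \<in> carrier R" "\<ominus> d \<in> D" and one: "\<one> \<in> D" "\<one> \<noteq> \<zero>"
  shows "d \<in> integral_closure R D"
proof -
  have "polynomial\<^bsub>R\<^esub> D [\<one>, \<ominus> d]" using d one by (simp add: polynomial_def)
  moreover have "eval [\<one>, \<ominus> d] d = \<zero>" using d by (simp add: r_neg)
  ultimately show ?thesis
    unfolding integral_closure_def using d by (auto intro!: exI[of _ "[\<one>, \<ominus> d]"])
qed

lemma (in valuation_subring) fraction_denominator:
  assumes "y \<in> fraction_field_of R V" shows "\<exists>n. \<pi> [^] (n::nat) \<otimes> y \<in> V"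
proof -
  obtain a b where ab: "a \<in> V" "b \<in> V" "b \<noteq> \<zero>" "y = a \<otimes> inv b"
    using assms by (auto simp: fraction_field_of_def)
  obtain n where "b \<in> S n" using S_ex ab by auto
  then obtain u where u: "u \<in> U" "b = \<pi> [^] n \<otimes> u" by (auto elim: S_E)
  note c = V_carrier[OF ab(1)] pi_pow_carrier[of n] U_carrier[OF u(1)] V_carrier[OF U_inv_V[OF u(1)]]
    inv_closed_nz[OF pi_pow_carrier pi_pow_nz]
  have "\<pi> [^] n \<otimes> y = a \<otimes> inv u \<otimes> (\<pi> [^] n \<otimes> inv (\<pi> [^] n))"
    unfolding ab(4) u(2) using c pi_pow_nz U_nz[OF u(1)] by (simp add: inv_mult_nz m_ac)
  also have "\<dots> = a \<otimes> inv u" using c by simp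
  finally have "\<pi> [^] n \<otimes> y \<in> V" using ab(1) U_inv_V[OF u(1)] V_mult by simp
  then show ?thesis by blast
qed

lemma (in valuation_subring) V_subset_fractions: "V \<subseteq> fraction_field_of R V"
proof
  fix d assume d: "d \<in> V"
  have "d = d \<otimes> inv \<one>" using V_carrier[OF d] by simp
  then show "d \<in> fraction_field_of R V"
    unfolding fraction_field_of_def using d V_one one_not_zero by blast
qed

text \<open>Three vectors in dimension 2 are dependent over the fraction field; a common power of
  the uniformizer moves the coefficients into \<open>V\<close>.\<close>

lemma (in valuation_subring) dependent_over_V:
  assumes K: "subfield (fraction_field_of R V) R"
    and quadratic: "dimension 2 (fraction_field_of R V) (carrier R)"
    and xyz: "x \<in> carrier R" "y \<in> carrier R" "z \<in> carrier R"
  shows "\<exists>a b c. a \<in> V \<and> b \<in> V \<and> c \<in> V \<and> (a \<noteq> \<zero> \<or> b \<noteq> \<zero> \<or> c \<noteq> \<zero>) \<and> a \<otimes> x \<oplus> b \<otimes> y \<oplus> c \<otimes> z = \<zero>"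
proof -
  let ?K = "fraction_field_of R V"
  have "dependent ?K [x, y, z]"
    using independent_length_le_dimension[OF K quadratic, of "[x, y, z]"] xyz by auto
  then obtain Ks where Ks: "length Ks = length [x, y, z]" "combine Ks [x, y, z] = \<zero>" "set Ks \<subseteq> ?K" "set Ks \<noteq> {\<zero>}"
    using dependent_imp_non_trivial_combine[OF K, of "[x, y, z]"] xyz by auto
  obtain p q r where pqr: "Ks = [p, q, r]" using Ks(1) by (auto simp: length_Suc_conv)
  have pqrc: "p \<in> carrier R" "q \<in> carrier R" "r \<in> carrier R"
    using Ks(3) subfieldE(3)[OF K] by (auto simp: pqr)
  obtain i j k where ijk: "\<pi> [^] (i::nat) \<otimes> p \<in> V" "\<pi> [^] (j::nat) \<otimes> q \<in> V" "\<pi> [^] (k::nat) \<otimes> r \<in> V"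
    using Ks(3) fraction_denominator unfolding pqr by (auto simp: subset_iff) metis
  let ?n = "i + j + k"
  have mult: "\<pi> [^] ?n \<otimes> w \<in> V" if w: "w \<in> carrier R" "\<pi> [^] m \<otimes> w \<in> V" "m \<le> ?n" for w and m :: nat
  proof -
    have "\<pi> [^] ?n \<otimes> w = \<pi> [^] (?n - m) \<otimes> (\<pi> [^] m \<otimes> w)"
      using w pi_carrier by (simp add: m_assoc[symmetric] nat_pow_mult)
    then show ?thesis using w V_mult[OF pi_pow_V] by simp
  qed
  let ?t = "\<pi> [^] ?n"
  have tc: "?t \<in> carrier R" by (rule pi_pow_carrier)
  have "?t \<otimes> p \<otimes> x \<oplus> ?t \<otimes> q \<otimes> y \<oplus> ?t \<otimes> r \<otimes> z = ?t \<otimes> (p \<otimes> x \<oplus> (q \<otimes> y \<oplus> r \<otimes> z))"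
    using tc pqrc xyz by algebra
  also have "\<dots> = \<zero>" using Ks(2) tc pqrc xyz by (simp add: pqr)
  finally have "?t \<otimes> p \<otimes> x \<oplus> ?t \<otimes> q \<otimes> y \<oplus> ?t \<otimes> r \<otimes> z = \<zero>" .
  moreover have "p \<noteq> \<zero> \<or> q \<noteq> \<zero> \<or> r \<noteq> \<zero>" using Ks(4) by (auto simp: pqr)
  then have "?t \<otimes> p \<noteq> \<zero> \<or> ?t \<otimes> q \<noteq> \<zero> \<or> ?t \<otimes> r \<noteq> \<zero>"
    using tc pqrc pi_pow_nz by (auto simp: integral_iff)
  moreover have "?t \<otimes> p \<in> V" "?t \<otimes> q \<in> V" "?t \<otimes> r \<in> V"
    using mult[OF pqrc(1) ijk(1)] mult[OF pqrc(2) ijk(2)] mult[OF pqrc(3) ijk(3)] by simp_all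
  ultimately show ?thesis by blast
qed

text \<open>Equal principal ideals mean that t and \<pi>^2 divide each other. One direction gives t
  in \<open>P 2\<close>; were t in \<open>P 3\<close>, its multiple \<pi>^2 would be there
  too.\<close>

lemma (in valuation_subring) ramified_S_2:
  assumes t: "t \<in> V" "PIdl\<^bsub>R\<lparr>carrier := V\<rparr>\<^esub> t = PIdl\<^bsub>R\<lparr>carrier := V\<rparr>\<^esub> (\<pi> [^] (2::nat))"
  shows "t \<in> S 2"
proof -
  have mem: "PIdl\<^bsub>R\<lparr>carrier := V\<rparr>\<^esub> x = {a \<otimes> x | a. a \<in> V}" for x by (simp add: cgenideal_def)
  have self: "x \<in> {a \<otimes> x | a. a \<in> V}" if "x \<in> V" for x
  proof -
    have "x = \<one> \<otimes> x" using V_carrier[OF that] by simp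
    then show ?thesis using V_one by blast
  qed
  have "t \<in> {a \<otimes> \<pi> [^] (2::nat) | a. a \<in> V}" "\<pi> [^] (2::nat) \<in> {a \<otimes> t | a. a \<in> V}"
    using self[OF t(1)] self[OF pi_pow_V[of 2]] t(2) unfolding mem by auto
  then obtain a b where ab: "a \<in> V" "t = a \<otimes> \<pi> [^] (2::nat)" "b \<in> V" "\<pi> [^] (2::nat) = b \<otimes> t" by auto
  have "t \<in> P 2" unfolding ab(2) using ab(1) by (intro P_smult pi_pow_P)
  moreover have "t \<notin> P (Suc 2)"
    using P_smult[OF ab(3), of t "Suc 2"] S_P_le[OF pi_pow_S[of 2], of "Suc 2"] unfolding ab(4)[symmetric] by auto
  ultimately show ?thesis by (simp add: S_iff)
qed

theorem theorem2p3:
  fixes K1 :: "('a, 'm) ring_scheme"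
    and K D D1 :: "'a set" and t \<tau> :: 'a
    and L :: "('a \<times> 'a) ring"
    and DL A :: "('a \<times> 'a) set" and tL e :: "'a \<times> 'a"
  assumes K1: "field K1" and K: "subfield K K1"
    and quadratic: "ring.dimension K1 2 K (carrier K1)"
    and D: "subring D K1" "K = fraction_field_of K1 D"
    and D_dvr: "discrete_valuation_ring (K1\<lparr>carrier := D\<rparr>)"
    and D_complete: "complete_local_ring (K1\<lparr>carrier := D\<rparr>)"
    and t: "t \<in> D" "maximalideal (PIdl\<^bsub>K1\<lparr>carrier := D\<rparr>\<^esub> t) (K1\<lparr>carrier := D\<rparr>)"
    and L: "L = RDirProd K1 (K1\<lparr>carrier := K\<rparr>)"
    and DL: "DL = {(d, d) | d. d \<in> D}" and tL: "tL = (t, t)"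
    and A: "A = integral_closure L DL"
    and A_fg: "finitely_generated_over L DL A"
    and A_prod: "A = D1 \<times> D"
    and D1: "subring D1 K1" "discrete_valuation_ring (K1\<lparr>carrier := D1\<rparr>)"
    and \<tau>: "\<tau> \<in> D1" "maximalideal (PIdl\<^bsub>K1\<lparr>carrier := D1\<rparr>\<^esub> \<tau>) (K1\<lparr>carrier := D1\<rparr>)"
    and residue: "(K1\<lparr>carrier := D1\<rparr>) Quot (PIdl\<^bsub>K1\<lparr>carrier := D1\<rparr>\<^esub> \<tau>) \<simeq>
                  (K1\<lparr>carrier := D\<rparr>) Quot (PIdl\<^bsub>K1\<lparr>carrier := D\<rparr>\<^esub> t)"
    and ramified: "PIdl\<^bsub>K1\<lparr>carrier := D1\<rparr>\<^esub> t = PIdl\<^bsub>K1\<lparr>carrier := D1\<rparr>\<^esub> (\<tau> [^]\<^bsub>K1\<^esub> (2::nat))"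
    and e: "e = (\<one>\<^bsub>K1\<^esub>, \<zero>\<^bsub>K1\<^esub>)"
  shows "(\<forall>m B. over_ring L DL (scaled_ring L DL tL m A) B \<longrightarrow>
            (\<exists>k l q \<alpha>. \<alpha> \<in> D1 \<and> normalized_valuation (K1\<lparr>carrier := D1\<rparr>) \<alpha> = 1 \<and>
               k + (2 * l + q) \<le> m \<and>
               B = scaled_ring L DL tL k (ring_C_lq L DL A tL e l q (\<alpha>, \<zero>\<^bsub>K1\<^esub>))) \<or>
            (\<exists>k r \<alpha>. \<alpha> \<in> D1 \<and> normalized_valuation (K1\<lparr>carrier := D1\<rparr>) \<alpha> = 1 \<and>
               k + r \<le> m \<and>
               B = scaled_ring L DL tL k (ring_C_r L DL A tL r (\<alpha>, \<zero>\<^bsub>K1\<^esub>)))) \<and>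
         {C. cubic_ring L DL C \<and> plane_curve_singularity (L\<lparr>carrier := C\<rparr>)} =
           {ring_C_lq L DL A tL e l q (\<alpha>, \<zero>\<^bsub>K1\<^esub>) | l q \<alpha>.
              1 \<le> l \<and> \<alpha> \<in> D1 \<and> normalized_valuation (K1\<lparr>carrier := D1\<rparr>) \<alpha> = 1} \<union>
           {ring_C_r L DL A tL r (\<alpha>, \<zero>\<^bsub>K1\<^esub>) | r \<alpha>.
              \<alpha> \<in> D1 \<and> normalized_valuation (K1\<lparr>carrier := D1\<rparr>) \<alpha> = 1}"
proof -
  interpret K1: field K1 by (rule K1)
  interpret D: valuation_subring K1 D t by (rule K1.valuation_subringI[OF D(1) D_dvr t])
  interpret D1: valuation_subring K1 D1 \<tau> by (rule K1.valuation_subringI[OF D1 \<tau>])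
  have DK: "D \<subseteq> K" using D.V_subset_fractions D(2) by simp
  have subK: "subring K K1" by (rule subfieldE(1)[OF K])
  \<comment> \<open>Diagonal elements are integral over the diagonal, so they lie in A = D1 \<times>
    D, and the first coordinate shows that D is inside D1.\<close>
  have D_D1: "D \<subseteq> D1"
  proof
    fix d assume d: "d \<in> D"
    interpret L: ring L
      unfolding L by (rule RDirProd_ring[OF K1.ring_axioms K1.subring_is_ring[OF subK]])
    have L_simps: "carrier L = carrier K1 \<times> K" "\<zero>\<^bsub>L\<^esub> = (\<zero>\<^bsub>K1\<^esub>, \<zero>\<^bsub>K1\<^esub>)" "\<one>\<^bsub>L\<^esub> = (\<one>\<^bsub>K1\<^esub>, \<one>\<^bsub>K1\<^esub>)"
      "(x, y) \<oplus>\<^bsub>L\<^esub> (x', y') = (x \<oplus>\<^bsub>K1\<^esub> x', y \<oplus>\<^bsub>K1\<^esub> y')" for x y x' y'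
      by (simp_all add: L RDirProd_def DirProd_def monoid.defs)
    have "\<ominus>\<^bsub>L\<^esub> (d, d) = (\<ominus>\<^bsub>K1\<^esub> d, \<ominus>\<^bsub>K1\<^esub> d)"
      using d DK D.V_carrier D.V_neg by (intro L.minus_equality) (auto simp: L_simps K1.l_neg)
    then have "(d, d) \<in> integral_closure L DL"
      using d DK D.V_carrier D.V_neg D.V_one by (intro L.mem_integral_closure) (auto simp: L_simps DL)
    then show "d \<in> D1" using A A_prod by auto
  qed
  have "two_branch_algebra K1 D t D1 \<tau> K"
  proof (intro two_branch_algebra.intro two_branch.intro two_branch_axioms.intro two_branch_algebra_axioms.intro)
    show "t \<in> D1.S 2" using t(1) D_D1 ramified by (intro D1.ramified_S_2) auto
  qed (use K1 D.valuation_subring_axioms D1.valuation_subring_axioms D_D1 subK DK D.fraction_denominator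
      D.dependent_over_V K quadratic D(2) in auto)
  then interpret two_branch_algebra K1 D t D1 \<tau> K .
  have val: "x \<in> D1 \<and> normalized_valuation (K1\<lparr>carrier := D1\<rparr>) x = 1 \<longleftrightarrow> x \<in> D1.S 1" for x
    using D1.normalized_valuation_eq_1 D1.S_V by blast
  show ?thesis
    unfolding A_prod L DL tL e val
    by (intro conjI allI impI plane_curve_singularities)
      (use over_ring_classification val in blast)
qed

end
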